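(* Let $L$ be one of the strongly squarefree lattices of the finite list $\mathcal{T}$ over $\mathbb{Z}[\sqrt2]$ described in the context, and assume that every bounded chain of roots of $L$ has a next root and a previous root. Let $\Phi=\{r_1,\dots,r_{k+1}\}$ be a bounded chain of roots of $L$ all of whose mirrors bound a single copy of the chamber $C$, and let $c_i$ be the corner formed by $r_i$ and $r_{i+1}$. Then $\Phi$ can be extended by repeatedly adjoining the next root. After adjoining a finite number of roots, either $\Phi$ will become a closed chain of roots, or else there will be an orientation preserving automorphism $\psi$ of $L$ that takes a corner basis at some corner $c_i$ to a corner basis at the last corner $c_k$ (where $\Phi=\{r_1,\dots,r_{k+1}\}$ now denotes the extended chain). After applying all powers of $\psi$ to the roots in $\Phi$ and adjoining all these roots to $\Phi$, $\Phi$ completely describes a boundary component of $C$.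
   Context: Let $F=\mathbb{Q}(\sqrt2)\subset\mathbb{R}$, $\mathfrak{o}=\mathbb{Z}[\sqrt2]$; bar is Galois conjugation. A lattice $L$ is a free $\mathfrak{o}$-module of finite rank with a symmetric bilinear form $v\cdot w$ (write $v^2=v\cdot v$), here non-degenerate, $\mathfrak{o}$-valued, with values generating $\mathfrak{o}$ (unscaled), of signature $(2,1)$, and arithmetic: the Galois conjugate form is positive definite. Strongly squarefree means (in rank 3) that the determinant of a Gram matrix is squarefree in $\mathfrak{o}$. Put $V=L\otimes F$, with a fixed orientation. Fix a component $\mathfrak{C}^+$ of the cone of negative norm vectors; $\Lambda^2=\mathfrak{C}^+/\mathbb{R}_{>0}$ is the hyperbolic plane. $\operatorname{Aut}(L)$ is the group of isometries of $L$ preserving $\mathfrak{C}^+$; automorphisms of $L$ are its elements. A vector is primitive if it is not a non-unit $\mathfrak{o}$-multiple of a vector of $L$. A root is a primitive $r\in L$ with $r^2>0$ such that $R_r(v)=v-\frac{2r\cdot v}{r^2}r$ preserves $L$; roots differing by a positive unit are considered equivalent. $V_r=r^\perp$ (its image in $\Lambda^2$ is the mirror of $r$), $V_r^-=\{v:v\cdot r<0\}$. The mirrors of all roots divide $\Lambda^2$ into copies of the (Weyl) chamber. For a copy $C$ of the chamber, the roots $r_i$ with $C$ given irredundantly by $\bigcap_iV_{r_i}^-$ form a system of simple roots. A chain of roots is a set of roots indexed by a set $I$ of consecutive integers such that: (1) for $i<j$, $r_i\cdot r_j\le0$, and $\frac{r_i\cdot r_j}{\sqrt{r_i^2r_j^2}}$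 is $\ge-1$ if $j=i+1$ and $<-1$ otherwise; (2) $\bigcap_{i\in I}V_{r_i}^-$ is nonempty; (3) for consecutive $i,i+1\in I$, $r_i,r_{i+1}$ belong to a common system of simple roots of $L$. A closed chain of roots is the same but cyclically indexed. If $k=\max I$ exists, a next root is a root $r_{k+1}$ whose adjunction gives a chain of roots and such that $r_{k-1},r_k,r_{k+1}$ all bound a single copy of the chamber; a previous root is defined similarly when $\min I$ exists. A corner basis at a corner $c$ of $C$ is $\{r,s,p\}$ where $r,s$ are the outward pointing roots of the walls of $C$ meeting at $c$ and $p\in V_r\cap V_s\cap\mathfrak{C}^+$ is a primitive lattice vector, with $(r,s,p)$ in the orientation of $V$; it is unique up to multiplying its members by positive units. The list $\mathcal{T}$ (2381 entries, with repetitions) is produced as follows; lattices are taken up to isometry and scaling. A good factorization of $z\in\mathfrak{o}$ is $z=uv$ with $u,v\in\mathfrak{o}$, $u,v,\bar u,\bar v>0$, $\bar z<4$; $(u,v)$ and $(u\alpha,v\alpha^{-1})$ are equivalent when $\alpha$ is the square of a unit, and factorizations are taken up to equivalence. Given $(A,B),(A',B'),(C,C')$, put $\mu=\sqrt{AB}/2$, $\mu'=\sqrt{A'B'}/2$, $K=1+\mu+\mu'+2\sqrt{1+\mu}\sqrt{1+\mu'}$. If $A',B'>0$ require that $\frac{AB'C'}{A'BC}=u^2$ for a unit $u$ that is the square of a unit, and put $\beta=A'BCu=AB'C'u^{-1}$; if $A'=B'=0$ put $\beta=0$. Vectors $r,t,r'$ have inner products, when $A',B'>0$: $r^2=2AB'$,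 $t^2=2BB'$, $r'^2=2A'B$, $r\cdot t=-ABB'$, $t\cdot r'=-A'B'B$, $r\cdot r'=-\beta$; when $A'=B'=0$: $r^2=2AC$, $t^2=2BC$, $r'^2=2AC'$, $r\cdot t=-ABC$, $t\cdot r'=0$, $r\cdot r'=-ACC'$. Put $N=4+4\frac{CC'+\beta+A'B'}{AB-4}$ and $N'=4+4\frac{CC'+\beta+AB}{A'B'-4}$. (a) Short edge, sequence $r,t,r'$: $(A,B)$ a good factorization of some $z$ with $0<z,\bar z<4$; $(A',B')$ likewise or $(0,0)$; $(C,C')$ a good factorization of some $z$ with $0<z<4K^2$, $0<\bar z<4$. (b) Short pair, sequence $r,s,t,r'$: $(A,B)$ a good factorization of some $z$ with $4<z<36$, $\bar z<4$; $(A',B')$ one of some $z$ with $z,\bar z<4$, or $(0,0)$; $(C,C')$ one of some $z$ with $4<z<4K^2$, $0<\bar z<4$; $N\in\mathfrak{o}$; $k\in\mathfrak{o}$ positive (up to positive units) dividing $N$; $s\cdot r=s\cdot t=0$, $s\cdot r'=-\frac{N}{2k}r'^2$, $s^2=\frac{N}{k^2}r'^2$. (c) Close pair, sequence $r,s,t,s',r'$: $(A,B),(A',B')$ good factorizations of elements $z$ with $4<z<36$, $0<\bar z<4$; $(C,C')$ one of some $z$ with $4<z<4K^2$, $\bar z<4$; $N,N'\in\mathfrak{o}$; $k,k'\in\mathfrak{o}$ positive (up to positive units) dividing $N,N'$ respectively; $\frac{\gamma k^2}{A'BN},\frac{\gamma k'^2}{AB'N'}\in\mathfrak{o}$, where $\gamma=\frac{2\beta}{kk'}\left(2+\frac{\beta}{CC'}-\frac{(2CC'+\beta)^3}{(AB-4)(A'B'-4)(CC')^2}\right)$;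 $s$ as in (b), $s'\cdot r'=s'\cdot t=0$, $s'\cdot r=-\frac{N'}{2k'}r^2$, $s'^2=\frac{N'}{k'^2}r^2$, $s\cdot s'=\gamma$. Keep only the configurations of rank 3 for which $r,t,r'$ have inner product matrix of signature $(2,1)$ with positive definite Galois conjugate. For the lattice $M_0$ generated by the vectors of a configuration (modulo the radical), take all reflection-stable enlargements $M$, i.e. lattices $M_0\subset M\subset M_0^{rh}=\{v\in M_0\otimes F: x\cdot v\in\frac{x^2}{2}\mathfrak{o}\text{ for all roots }x\in M_0\}$, in which the vectors of the configuration remain primitive. After rescaling to be unscaled, keep those $M$ that are strongly squarefree and in which any two consecutive members of the sequence belong to a common system of simple roots. These $M$ form $\mathcal{T}$. *)

theory Defs
  imports "HOL-Analysis.Analysis"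
begin

section \<open>The field Q(sqrt 2) and its ring of integers, as subsets of the reals\<close>

definition F_field :: "real set" where
  "F_field = {of_rat a + of_rat b * sqrt 2 | a b. True}"

definition O_ring :: "real set" where
  "O_ring = {of_int a + of_int b * sqrt 2 | a b. True}"

text \<open>Galois conjugation; meaningful on \<^const>\<open>F_field\<close> only.\<close>

definition gal :: "real \<Rightarrow> real" where
  "gal x = (THE y. \<exists>a b. x = of_rat a + of_rat b * sqrt 2 \<and> y = of_rat a - of_rat b * sqrt 2)"

definition O_unit :: "real \<Rightarrow> bool" where
  "O_unit u \<longleftrightarrow> u \<in> O_ring \<and> (\<exists>v\<in>O_ring. u * v = 1)"

definition O_dvd :: "real \<Rightarrow> real \<Rightarrow> bool" where
  "O_dvd x y \<longleftrightarrow> (\<exists>z\<in>O_ring. y = x * z)"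

definition O_squarefree :: "real \<Rightarrow> bool" where
  "O_squarefree d \<longleftrightarrow> d \<in> O_ring \<and> (\<forall>x\<in>O_ring. O_dvd (x^2) d \<longrightarrow> O_unit x)"

text \<open>Submodule generated by \<open>S\<close> over a subring \<open>R\<close> of the reals.\<close>

definition span_over :: "real set \<Rightarrow> 'a::real_vector set \<Rightarrow> 'a set" where
  "span_over R S = {(\<Sum>x\<in>A. c x *\<^sub>R x) | A c. finite A \<and> A \<subseteq> S \<and> c ` A \<subseteq> R}"


section \<open>Lattices\<close>

text \<open>A lattice of rank \<open>n\<close> is realized inside \<open>\<real>\<^sup>n\<close>, which plays the role of its tensor product with
  \<open>\<real>\<close>; the rows of the matrix \<open>e\<close> are a basis. The form lives on all of \<open>\<real>\<^sup>n\<close> and is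
  determined by its values on the lattice.\<close>

type_synonym 'n form = "real^'n \<Rightarrow> real^'n \<Rightarrow> real"

definition O_basis :: "(real^'n) set \<Rightarrow> real^'n^'n \<Rightarrow> bool" where
  "O_basis L e \<longleftrightarrow> invertible e \<and> L = {(\<Sum>i\<in>UNIV. a i *\<^sub>R e $ i) | a. range a \<subseteq> O_ring}"

definition symmetric_form :: "'n::finite form \<Rightarrow> bool" where
  "symmetric_form b \<longleftrightarrow> bilinear b \<and> (\<forall>x y. b x y = b y x)"

definition is_lattice :: "'n::finite form \<Rightarrow> (real^'n) set \<Rightarrow> bool" where
  "is_lattice b L \<longleftrightarrow> symmetric_form b \<and> (\<exists>e. O_basis L e) \<and> (\<forall>x\<in>L. \<forall>y\<in>L. b x y \<in> F_field)"

definition gram :: "'n::finite form \<Rightarrow> real^'n^'n \<Rightarrow> real^'n^'n" where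
  "gram b e = (\<chi> i j. b (e $ i) (e $ j))"

definition has_signature :: "real^'n^'n \<Rightarrow> nat \<Rightarrow> nat \<Rightarrow> bool" where
  "has_signature G p q \<longleftrightarrow> (\<exists>P :: real^'n^'n. invertible P \<and>
     (\<forall>i j. i \<noteq> j \<longrightarrow> (transpose P ** G ** P) $ i $ j = 0) \<and>
     card {i. (transpose P ** G ** P) $ i $ i > 0} = p \<and>
     card {i. (transpose P ** G ** P) $ i $ i < 0} = q)"

definition pos_def :: "real^'n^'n \<Rightarrow> bool" where
  "pos_def G \<longleftrightarrow> (\<forall>x. x \<noteq> 0 \<longrightarrow> x \<bullet> (G *v x) > 0)"

definition hyperbolic_arithmetic :: "real^3^3 \<Rightarrow> bool" where
  "hyperbolic_arithmetic G \<longleftrightarrow> has_signature G 2 1 \<and> pos_def (\<chi> i j. gal (G $ i $ j))"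

text \<open>The equation says both that the form is integral and that its values generate the unit
  ideal. Non-degeneracy is part of the signature.\<close>

definition unscaled :: "'n::finite form \<Rightarrow> (real^'n) set \<Rightarrow> bool" where
  "unscaled b L \<longleftrightarrow> span_over O_ring {b x y | x y. x \<in> L \<and> y \<in> L} = O_ring"

definition admissible_lattice :: "3 form \<Rightarrow> (real^3) set \<Rightarrow> bool" where
  "admissible_lattice b L \<longleftrightarrow> is_lattice b L \<and> unscaled b L \<and>
     (\<exists>e. O_basis L e \<and> hyperbolic_arithmetic (gram b e))"

definition strongly_squarefree :: "3 form \<Rightarrow> (real^3) set \<Rightarrow> bool" where
  "strongly_squarefree b L \<longleftrightarrow> (\<exists>e. O_basis L e \<and> O_squarefree (det (gram b e)))"

definition isometric ::
    "'n::finite form \<Rightarrow> (real^'n) set \<Rightarrow> 'n form \<Rightarrow> (real^'n) set \<Rightarrow> bool" where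
  "isometric b L b' L' \<longleftrightarrow>
     (\<exists>f. linear f \<and> bij f \<and> f ` L = L' \<and> (\<forall>x y. b' (f x) (f y) = b x y))"


section \<open>Roots and chambers\<close>

definition primitive :: "(real^'n) set \<Rightarrow> real^'n \<Rightarrow> bool" where
  "primitive L v \<longleftrightarrow> v \<in> L \<and> \<not> (\<exists>a\<in>O_ring. \<not> O_unit a \<and> (\<exists>w\<in>L. v = a *\<^sub>R w))"

definition reflection :: "'n::finite form \<Rightarrow> real^'n \<Rightarrow> real^'n \<Rightarrow> real^'n" where
  "reflection b r v = v - (2 * b r v / b r r) *\<^sub>R r"

definition root :: "'n::finite form \<Rightarrow> (real^'n) set \<Rightarrow> real^'n \<Rightarrow> bool" where
  "root b L r \<longleftrightarrow> primitive L r \<and> b r r > 0 \<and> reflection b r ` L = L"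

definition mirror :: "'n::finite form \<Rightarrow> real^'n \<Rightarrow> (real^'n) set" where
  "mirror b r = {v. b v r = 0}"

definition neg_half :: "'n::finite form \<Rightarrow> real^'n \<Rightarrow> (real^'n) set" where
  "neg_half b r = {v. b v r < 0}"

text \<open>\<open>P\<close> denotes the chosen component of the cone of negative norm vectors. Subsets of the
  hyperbolic plane are represented by the corresponding unions of open rays in \<open>P\<close>.\<close>

definition neg_cone_component :: "'n::finite form \<Rightarrow> (real^'n) set \<Rightarrow> bool" where
  "neg_cone_component b P \<longleftrightarrow> P \<in> components {v. b v v < 0}"

definition chamber :: "'n::finite form \<Rightarrow> (real^'n) set \<Rightarrow> (real^'n) set \<Rightarrow> (real^'n) set \<Rightarrow> bool" where
  "chamber b P L C \<longleftrightarrow> C \<in> components (P - (\<Union>r\<in>{r. root b L r}. mirror b r))"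

definition simple_system ::
    "'n::finite form \<Rightarrow> (real^'n) set \<Rightarrow> (real^'n) set \<Rightarrow> (real^'n) set \<Rightarrow> (real^'n) set \<Rightarrow> bool" where
  "simple_system b P L C S \<longleftrightarrow> chamber b P L C \<and> (\<forall>r\<in>S. root b L r) \<and>
     C = P \<inter> (\<Inter>r\<in>S. neg_half b r) \<and>
     (\<forall>r\<in>S. C \<noteq> P \<inter> (\<Inter>r'\<in>S - {r}. neg_half b r'))"

text \<open>\<open>r\<close> is the outward pointing root of a wall of \<open>C\<close>.\<close>

definition bounds ::
    "'n::finite form \<Rightarrow> (real^'n) set \<Rightarrow> (real^'n) set \<Rightarrow> (real^'n) set \<Rightarrow> real^'n \<Rightarrow> bool" where
  "bounds b P L C r \<longleftrightarrow> (\<exists>S. simple_system b P L C S \<and> r \<in> S)"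

definition common_simple ::
    "'n::finite form \<Rightarrow> (real^'n) set \<Rightarrow> (real^'n) set \<Rightarrow> real^'n \<Rightarrow> real^'n \<Rightarrow> bool" where
  "common_simple b P L r s \<longleftrightarrow> (\<exists>C S. simple_system b P L C S \<and> r \<in> S \<and> s \<in> S)"


section \<open>Chains of roots\<close>

definition normalized_product :: "'n::finite form \<Rightarrow> real^'n \<Rightarrow> real^'n \<Rightarrow> real" where
  "normalized_product b r s = b r s / sqrt (b r r * b s s)"

definition chain ::
    "'n::finite form \<Rightarrow> (real^'n) set \<Rightarrow> (real^'n) set \<Rightarrow> int set \<Rightarrow> (int \<Rightarrow> real^'n) \<Rightarrow> bool" where
  "chain b P L I x \<longleftrightarrow>
     (\<forall>i\<in>I. \<forall>j\<in>I. {i..j} \<subseteq> I) \<and>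
     (\<forall>i\<in>I. root b L (x i)) \<and>
     (\<forall>i\<in>I. \<forall>j\<in>I. i < j \<longrightarrow> b (x i) (x j) \<le> 0 \<and>
        (if j = i + 1 then normalized_product b (x i) (x j) \<ge> -1
         else normalized_product b (x i) (x j) < -1)) \<and>
     (\<Inter>i\<in>I. neg_half b (x i)) \<noteq> {} \<and>
     (\<forall>i. i \<in> I \<and> i + 1 \<in> I \<longrightarrow> common_simple b P L (x i) (x (i + 1)))"

text \<open>Closed chains are indexed by \<open>{m..n}\<close>, with \<open>n\<close> followed by \<open>m\<close>. At least three members are
  required: with two, the two neighbours of a root would coincide, and every bounded chain with
  two members would count as closed.\<close>

definition cyc_succ :: "int \<Rightarrow> int \<Rightarrow> int \<Rightarrow> int" where
  "cyc_succ m n i = (if i = n then m else i + 1)"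

definition closed_chain ::
    "'n::finite form \<Rightarrow> (real^'n) set \<Rightarrow> (real^'n) set \<Rightarrow> int \<Rightarrow> int \<Rightarrow> (int \<Rightarrow> real^'n) \<Rightarrow> bool" where
  "closed_chain b P L m n x \<longleftrightarrow>
     m + 2 \<le> n \<and>
     (\<forall>i\<in>{m..n}. root b L (x i)) \<and>
     (\<forall>i\<in>{m..n}. \<forall>j\<in>{m..n}. i \<noteq> j \<longrightarrow> b (x i) (x j) \<le> 0 \<and>
        (if j = cyc_succ m n i \<or> i = cyc_succ m n j then normalized_product b (x i) (x j) \<ge> -1
         else normalized_product b (x i) (x j) < -1)) \<and>
     (\<Inter>i\<in>{m..n}. neg_half b (x i)) \<noteq> {} \<and>
     (\<forall>i\<in>{m..n}. common_simple b P L (x i) (x (cyc_succ m n i)))"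

text \<open>The root closing a chain up is adjacent to both its ends, so its adjunction gives a closed
  chain and never a linearly indexed one; this counts as giving a chain of roots.\<close>

definition next_root ::
    "'n::finite form \<Rightarrow> (real^'n) set \<Rightarrow> (real^'n) set \<Rightarrow> int set \<Rightarrow> (int \<Rightarrow> real^'n) \<Rightarrow> real^'n \<Rightarrow> bool" where
  "next_root b P L I x v \<longleftrightarrow> (\<exists>k\<in>I. (\<forall>i\<in>I. i \<le> k) \<and> root b L v \<and>
     (chain b P L (insert (k + 1) I) (x(k + 1 := v)) \<or>
      (\<exists>m. I = {m..k} \<and> closed_chain b P L m (k + 1) (x(k + 1 := v)))) \<and>
     (\<exists>C. \<forall>i\<in>insert (k + 1) I. k - 1 \<le> i \<longrightarrow> bounds b P L C ((x(k + 1 := v)) i)))"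

definition previous_root ::
    "'n::finite form \<Rightarrow> (real^'n) set \<Rightarrow> (real^'n) set \<Rightarrow> int set \<Rightarrow> (int \<Rightarrow> real^'n) \<Rightarrow> real^'n \<Rightarrow> bool" where
  "previous_root b P L I x v \<longleftrightarrow> (\<exists>k\<in>I. (\<forall>i\<in>I. k \<le> i) \<and> root b L v \<and>
     (chain b P L (insert (k - 1) I) (x(k - 1 := v)) \<or>
      (\<exists>n. I = {k..n} \<and> closed_chain b P L (k - 1) n (x(k - 1 := v)))) \<and>
     (\<exists>C. \<forall>i\<in>insert (k - 1) I. i \<le> k + 1 \<longrightarrow> bounds b P L C ((x(k - 1 := v)) i)))"

text \<open>\<open>x\<close> prolongs the chain \<open>r\<close> indexed by \<open>{1..n}\<close> by adjoining next roots, as long as the result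
  is a chain with a last member; once the chain has closed up, the remaining values are irrelevant.\<close>

definition next_root_extension ::
    "'n::finite form \<Rightarrow> (real^'n) set \<Rightarrow> (real^'n) set \<Rightarrow> int \<Rightarrow> (int \<Rightarrow> real^'n) \<Rightarrow> (int \<Rightarrow> real^'n) \<Rightarrow> bool" where
  "next_root_extension b P L n r x \<longleftrightarrow>
     (\<forall>i\<in>{1..n}. x i = r i) \<and>
     (\<forall>j\<ge>n. chain b P L {1..j} x \<longrightarrow> next_root b P L {1..j} x (x (j + 1)))"


section \<open>Corners, automorphisms and boundary components\<close>

definition automorphism :: "'n::finite form \<Rightarrow> (real^'n) set \<Rightarrow> (real^'n) set \<Rightarrow> (real^'n \<Rightarrow> real^'n) \<Rightarrow> bool" where
  "automorphism b P L f \<longleftrightarrow> linear f \<and> bij f \<and> f ` L = L \<and> (\<forall>x y. b (f x) (f y) = b x y) \<and> f ` P = P"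

definition orientation_preserving :: "(real^'n \<Rightarrow> real^'n) \<Rightarrow> bool" where
  "orientation_preserving f \<longleftrightarrow> det (matrix f) > 0"

definition corner :: "'n::finite form \<Rightarrow> (real^'n) set \<Rightarrow> real^'n \<Rightarrow> real^'n \<Rightarrow> (real^'n) set" where
  "corner b P r s = mirror b r \<inter> mirror b s \<inter> P"

text \<open>The orientation is given by a sign \<open>\<omega>\<close>, relative to the standard one.\<close>

definition corner_basis ::
    "3 form \<Rightarrow> (real^3) set \<Rightarrow> (real^3) set \<Rightarrow> real \<Rightarrow> (real^3) set \<Rightarrow> (real^3) set \<Rightarrow>
     real^3 \<Rightarrow> real^3 \<Rightarrow> real^3 \<Rightarrow> bool" where
  "corner_basis b P L \<omega> C c r s p \<longleftrightarrow>
     bounds b P L C r \<and> bounds b P L C s \<and> c = corner b P r s \<and> c \<subseteq> closure C \<and>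
     p \<in> c \<and> primitive L p \<and> \<omega> * det (vector [r, s, p] :: real^3^3) > 0"

definition side :: "'n::finite form \<Rightarrow> (real^'n) set \<Rightarrow> (real^'n) set \<Rightarrow> real^'n \<Rightarrow> (real^'n) set" where
  "side b P C r = P \<inter> closure C \<inter> mirror b r"

definition describes_boundary_component ::
    "'n::finite form \<Rightarrow> (real^'n) set \<Rightarrow> (real^'n) set \<Rightarrow> (real^'n) set \<Rightarrow> (real^'n) set \<Rightarrow> bool" where
  "describes_boundary_component b P L C \<Phi> \<longleftrightarrow>
     (\<forall>r\<in>\<Phi>. bounds b P L C r) \<and> (\<Union>r\<in>\<Phi>. side b P C r) \<in> components (P \<inter> frontier C)"

text \<open>Images under all integral powers of \<open>f\<close>.\<close>

definition power_orbit :: "('a \<Rightarrow> 'a) \<Rightarrow> 'a set \<Rightarrow> 'a set" where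
  "power_orbit f A = (\<Union>n. (f ^^ n) ` A \<union> (inv f ^^ n) ` A)"


section \<open>The list of candidate lattices\<close>

definition good_factorization :: "real \<Rightarrow> real \<Rightarrow> real \<Rightarrow> bool" where
  "good_factorization z u v \<longleftrightarrow> u \<in> O_ring \<and> v \<in> O_ring \<and> z = u * v \<and>
     u > 0 \<and> v > 0 \<and> gal u > 0 \<and> gal v > 0 \<and> gal z < 4"

text \<open>Passing to an equivalent factorization, or multiplying \<open>k\<close> or \<open>k'\<close> by a positive unit, only
  multiplies the vectors of a configuration by positive units, so all representatives are allowed.\<close>

definition edge_bound :: "real \<Rightarrow> real \<Rightarrow> real \<Rightarrow> real \<Rightarrow> real" where
  "edge_bound A B A' B' =
     (let \<mu> = sqrt (A * B) / 2; \<mu>' = sqrt (A' * B') / 2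
      in 1 + \<mu> + \<mu>' + 2 * sqrt (1 + \<mu>) * sqrt (1 + \<mu>'))"

definition beta_value :: "real \<Rightarrow> real \<Rightarrow> real \<Rightarrow> real \<Rightarrow> real \<Rightarrow> real \<Rightarrow> real \<Rightarrow> bool" where
  "beta_value A B A' B' C C' \<beta> \<longleftrightarrow>
     (A' > 0 \<and> B' > 0 \<and>
        (\<exists>u e. O_unit e \<and> u = e^2 \<and> A * B' * C' / (A' * B * C) = u^2 \<and> \<beta> = A' * B * C * u)) \<or>
     (A' = 0 \<and> B' = 0 \<and> \<beta> = 0)"

definition base_products ::
    "3 form \<Rightarrow> real \<Rightarrow> real \<Rightarrow> real \<Rightarrow> real \<Rightarrow> real \<Rightarrow> real \<Rightarrow> real \<Rightarrow> real^3 \<Rightarrow> real^3 \<Rightarrow> real^3 \<Rightarrow> bool" where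
  "base_products b A B A' B' C C' \<beta> r t r' \<longleftrightarrow>
     (if A' = 0 \<and> B' = 0 then
        b r r = 2 * A * C \<and> b t t = 2 * B * C \<and> b r' r' = 2 * A * C' \<and>
        b r t = - (A * B * C) \<and> b t r' = 0 \<and> b r r' = - (A * C * C')
      else
        b r r = 2 * A * B' \<and> b t t = 2 * B * B' \<and> b r' r' = 2 * A' * B \<and>
        b r t = - (A * B * B') \<and> b t r' = - (A' * B' * B) \<and> b r r' = - \<beta>)"

definition N_value :: "real \<Rightarrow> real \<Rightarrow> real \<Rightarrow> real \<Rightarrow> real \<Rightarrow> real \<Rightarrow> real \<Rightarrow> real" where
  "N_value A B A' B' C C' \<beta> = 4 + 4 * ((C * C' + \<beta> + A' * B') / (A * B - 4))"

definition N'_value :: "real \<Rightarrow> real \<Rightarrow> real \<Rightarrow> real \<Rightarrow> real \<Rightarrow> real \<Rightarrow> real \<Rightarrow> real" where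
  "N'_value A B A' B' C C' \<beta> = 4 + 4 * ((C * C' + \<beta> + A * B) / (A' * B' - 4))"

definition short_edge_config :: "3 form \<Rightarrow> real^3 \<Rightarrow> real^3 \<Rightarrow> real^3 \<Rightarrow> bool" where
  "short_edge_config b r t r' \<longleftrightarrow> (\<exists>A B A' B' C C' \<beta>.
     (\<exists>z. good_factorization z A B \<and> 0 < z \<and> z < 4 \<and> 0 < gal z \<and> gal z < 4) \<and>
     ((\<exists>z. good_factorization z A' B' \<and> 0 < z \<and> z < 4 \<and> 0 < gal z \<and> gal z < 4) \<or>
      (A' = 0 \<and> B' = 0)) \<and>
     (\<exists>z. good_factorization z C C' \<and> 0 < z \<and> z < 4 * (edge_bound A B A' B')^2 \<and>
          0 < gal z \<and> gal z < 4) \<and>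
     beta_value A B A' B' C C' \<beta> \<and>
     base_products b A B A' B' C C' \<beta> r t r')"

definition short_pair_config :: "3 form \<Rightarrow> real^3 \<Rightarrow> real^3 \<Rightarrow> real^3 \<Rightarrow> real^3 \<Rightarrow> bool" where
  "short_pair_config b r s t r' \<longleftrightarrow> (\<exists>A B A' B' C C' \<beta> N k.
     (\<exists>z. good_factorization z A B \<and> 4 < z \<and> z < 36 \<and> gal z < 4) \<and>
     ((\<exists>z. good_factorization z A' B' \<and> z < 4 \<and> gal z < 4) \<or> (A' = 0 \<and> B' = 0)) \<and>
     (\<exists>z. good_factorization z C C' \<and> 4 < z \<and> z < 4 * (edge_bound A B A' B')^2 \<and>
          0 < gal z \<and> gal z < 4) \<and>
     beta_value A B A' B' C C' \<beta> \<and>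
     base_products b A B A' B' C C' \<beta> r t r' \<and>
     N = N_value A B A' B' C C' \<beta> \<and> N \<in> O_ring \<and>
     k \<in> O_ring \<and> k > 0 \<and> O_dvd k N \<and>
     b s r = 0 \<and> b s t = 0 \<and> b s r' = - (N / (2 * k)) * b r' r' \<and> b s s = N / k^2 * b r' r')"

definition close_pair_config ::
    "3 form \<Rightarrow> real^3 \<Rightarrow> real^3 \<Rightarrow> real^3 \<Rightarrow> real^3 \<Rightarrow> real^3 \<Rightarrow> bool" where
  "close_pair_config b r s t s' r' \<longleftrightarrow> (\<exists>A B A' B' C C' \<beta> N N' k k' \<gamma>.
     (\<exists>z. good_factorization z A B \<and> 4 < z \<and> z < 36 \<and> 0 < gal z \<and> gal z < 4) \<and>
     (\<exists>z. good_factorization z A' B' \<and> 4 < z \<and> z < 36 \<and> 0 < gal z \<and> gal z < 4) \<and>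
     (\<exists>z. good_factorization z C C' \<and> 4 < z \<and> z < 4 * (edge_bound A B A' B')^2 \<and> gal z < 4) \<and>
     beta_value A B A' B' C C' \<beta> \<and>
     base_products b A B A' B' C C' \<beta> r t r' \<and>
     N = N_value A B A' B' C C' \<beta> \<and> N \<in> O_ring \<and>
     N' = N'_value A B A' B' C C' \<beta> \<and> N' \<in> O_ring \<and>
     k \<in> O_ring \<and> k > 0 \<and> O_dvd k N \<and>
     k' \<in> O_ring \<and> k' > 0 \<and> O_dvd k' N' \<and>
     \<gamma> = 2 * \<beta> / (k * k') *
         (2 + \<beta> / (C * C') - (2 * C * C' + \<beta>)^3 / ((A * B - 4) * (A' * B' - 4) * (C * C')^2)) \<and>
     \<gamma> * k^2 / (A' * B * N) \<in> O_ring \<and> \<gamma> * k'^2 / (A * B' * N') \<in> O_ring \<and>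
     b s r = 0 \<and> b s t = 0 \<and> b s r' = - (N / (2 * k)) * b r' r' \<and> b s s = N / k^2 * b r' r' \<and>
     b s' r' = 0 \<and> b s' t = 0 \<and> b s' r = - (N' / (2 * k')) * b r r \<and> b s' s' = N' / k'^2 * b r r \<and>
     b s s' = \<gamma>)"

text \<open>The vectors live in the three-dimensional space obtained by dividing out the radical:
  since \<open>r, t, r'\<close> have a non-degenerate Gram matrix, a configuration is realizable here iff its
  full matrix of inner products has rank 3.\<close>

definition configuration :: "3 form \<Rightarrow> (real^3) list \<Rightarrow> bool" where
  "configuration b vs \<longleftrightarrow> symmetric_form b \<and> (\<exists>r t r'.
     hyperbolic_arithmetic (gram b (vector [r, t, r'])) \<and>
     ((vs = [r, t, r'] \<and> short_edge_config b r t r') \<or>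
      (\<exists>s. vs = [r, s, t, r'] \<and> short_pair_config b r s t r') \<or>
      (\<exists>s s'. vs = [r, s, t, s', r'] \<and> close_pair_config b r s t s' r')))"

definition reflection_hull :: "'n::finite form \<Rightarrow> (real^'n) set \<Rightarrow> (real^'n) set" where
  "reflection_hull b M = {v \<in> span_over F_field M.
     \<forall>x. root b M x \<longrightarrow> b x v \<in> {b x x / 2 * a | a. a \<in> O_ring}}"

text \<open>Membership in the list, up to isometry. That the rescaled form \<open>b'\<close> again has signature (2,1)
  and positive definite conjugate forces the factor \<open>c\<close> to be totally positive.\<close>

definition in_list_T :: "3 form \<Rightarrow> (real^3) set \<Rightarrow> bool" where
  "in_list_T b L \<longleftrightarrow> (\<exists>b\<^sub>0 vs M c b' P.
     configuration b\<^sub>0 vs \<and>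
     is_lattice b\<^sub>0 M \<and>
     span_over O_ring (set vs) \<subseteq> M \<and>
     M \<subseteq> reflection_hull b\<^sub>0 (span_over O_ring (set vs)) \<and>
     (\<forall>v\<in>set vs. primitive M v) \<and>
     c \<in> F_field \<and> b' = (\<lambda>x y. c * b\<^sub>0 x y) \<and>
     admissible_lattice b' M \<and> strongly_squarefree b' M \<and>
     neg_cone_component b' P \<and>
     (\<forall>i. Suc i < length vs \<longrightarrow> common_simple b' P M (vs ! i) (vs ! Suc i)) \<and>
     isometric b' M b L)"

end

theory Submission
  imports Defs
begin

text \<open>The form is anisotropic over \<open>\<rat>(\<surd>2)\<close>, because its conjugate is definite. Consecutive members of a
chain therefore never have parallel mirrors: their mirrors meet in a genuine point of the hyperbolic
plane, a corner. Two plane facts control the geometry near a corner. Distinct walls of a chamber have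
non-positive inner product (\<open>walls_obtuse\<close>), and at the meeting point of two walls every other wall is
strictly on the correct side (\<open>corner_other_walls\<close>). It follows that such a point lies in the closure of
the chamber, that two walls with a common corner determine the chamber (\<open>chamber_determined\<close>), and that a
side with two known corners meets no further walls (\<open>side_two_neighbours\<close>). So every adjoined next root is
again a wall of \<open>C\<close>, and a set of walls whose sides are linked together and each of which has two
neighbours in the set fills a whole boundary component (\<open>sides_form_component\<close>): connectedness comes from
the shared corners, openness from having both neighbours, and closedness from local finiteness of the
mirrors.

If the chain closes up, this already describes the component. Otherwise it is infinite, and a corner must
repeat up to automorphism. A root norm divides twice the determinant (\<open>root_norm_divides\<close>), so after
scaling by units all roots of the chain have bounded norm and bounded conjugate norm; two neighbours then
have one of finitely many Gram matrices. Attach to a corner \<open>(r, s)\<close> the lattice vector \<open>corner_vec r s\<close>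
orthogonal to both, given by a cross product. The span of the three vectors contains \<open>q \<cdot> L\<close> with \<open>q\<close>
depending on the Gram matrix only, so the linear map carrying one such triple to another preserves \<open>L\<close> as
soon as the two corners agree modulo \<open>q\<close> (\<open>corner_map_lattice\<close>). The pigeonhole principle provides two
such corners arbitrarily far out (\<open>corner_pigeonhole\<close>). Since the sense of rotation does not change along
a chain (\<open>orientation_step\<close>), this map preserves the orientation and the chosen cone. It preserves \<open>C\<close>
because a corner determines its chamber. Its powers repeat a segment of the chain in both directions,
which gives every wall of the orbit its two neighbours (\<open>periodic_chain_describes\<close>).\<close>

section \<open>Lorentzian geometry of the negative cone\<close>

text \<open>Stated through coefficients because the signs of the coefficients in decompositions such as
\<open>t = x r + y s + z p\<close> are what the arguments below are about.\<close>

lemma three_independent_span: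
  fixes x y z v :: "real^3"
  assumes indep: "\<And>p q s. p *\<^sub>R x + q *\<^sub>R y + s *\<^sub>R z = 0 \<Longrightarrow> p = 0 \<and> q = 0 \<and> s = 0"
  shows "\<exists>p q s. v = p *\<^sub>R x + q *\<^sub>R y + s *\<^sub>R z"
proof -
  define f :: "real^3 \<Rightarrow> real^3" where "f u = (u $ 1) *\<^sub>R x + (u $ 2) *\<^sub>R y + (u $ 3) *\<^sub>R z" for u
  have lin: "linear f" by (rule linearI) (auto simp: f_def algebra_simps)
  have "u = 0" if "f u = 0" for u
    using indep[OF that[unfolded f_def]] by (simp add: vec_eq_iff forall_3)
  then have "inj f" unfolding linear_injective_0[OF lin] by blast
  then have "surj f" using linear_injective_imp_surjective[OF lin] by simp
  then obtain u where "v = f u" by blast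
  then show ?thesis unfolding f_def by blast
qed

text \<open>Signature \<open>(2,1)\<close> enters only through \<open>perp_pos\<close>: the orthogonal complement of a vector of negative norm is
positive definite.\<close>

locale lorentz_cone =
  fixes b :: "3 form" and P :: "(real^3) set"
  assumes form: "symmetric_form b"
    and perp_pos: "\<And>v w. b v v < 0 \<Longrightarrow> b v w = 0 \<Longrightarrow> w \<noteq> 0 \<Longrightarrow> b w w > 0"
    and cone: "neg_cone_component b P"
begin

sublocale B: bounded_bilinear b
  using form by (simp add: symmetric_form_def bilinear_conv_bounded_bilinear)

lemmas bil = B.add_left B.add_right B.diff_left B.diff_right B.minus_left B.minus_right
  B.scaleR_left B.scaleR_right

lemma sym: "b x y = b y x"
  using form by (simp add: symmetric_form_def)

lemma perp_nonneg: "b v v < 0 \<Longrightarrow> b v w = 0 \<Longrightarrow> b w w \<ge> 0"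
  using perp_pos[of v w] by (cases "w = 0") (auto simp: B.zero_left)

lemma cauchy_schwarz:
  assumes "b y y > 0" "b (b y y *\<^sub>R x - b x y *\<^sub>R y) (b y y *\<^sub>R x - b x y *\<^sub>R y) \<ge> 0"
  shows "(b x y)\<^sup>2 \<le> b x x * b y y"
proof -
  have "b (b y y *\<^sub>R x - b x y *\<^sub>R y) (b y y *\<^sub>R x - b x y *\<^sub>R y) = b y y * (b x x * b y y - (b x y)\<^sup>2)"
    by (simp add: bil sym[of y x] algebra_simps power2_eq_square)
  then show ?thesis using assms by (simp add: zero_le_mult_iff)
qed

lemma perp_cauchy_schwarz:
  assumes w: "b w w < 0" and x: "b w x = 0" and y: "b w y = 0"
  shows "(b x y)\<^sup>2 \<le> b x x * b y y"
proof (cases "y = 0")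
  case False
  then have "b y y > 0" using perp_pos w y by blast
  moreover have "b w (b y y *\<^sub>R x - b x y *\<^sub>R y) = 0" by (simp add: bil x y)
  ultimately show ?thesis using cauchy_schwarz perp_nonneg w by blast
qed (simp add: B.zero_right)

text \<open>Reversed Cauchy--Schwarz: after projecting \<open>x\<close> and \<open>y\<close> to the positive definite complement of \<open>w\<close>, the
ordinary Cauchy--Schwarz inequality bounds the spatial part of \<open>b x y\<close> by the time part.\<close>

lemma same_cone_neg:
  assumes w: "b w w < 0" and x: "b x x < 0" "b x w < 0" and y: "b y y < 0" "b y w < 0"
  shows "b x y < 0"
proof -
  \<comment> \<open>Multiplying the projections by \<open>u\<close> avoids division.\<close>
  define u where "u = - b w w"
  have u: "u > 0" and ww: "b w w = - u" using w by (simp_all add: u_def)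
  define x' where "x' = u *\<^sub>R x + b x w *\<^sub>R w"
  define y' where "y' = u *\<^sub>R y + b y w *\<^sub>R w"
  have px: "b w x' = 0" and py: "b w y' = 0"
    by (simp_all add: x'_def y'_def bil u_def sym[of w x] sym[of w y])
  have xx: "b x' x' = u\<^sup>2 * b x x + u * (b x w)\<^sup>2"
    and yy: "b y' y' = u\<^sup>2 * b y y + u * (b y w)\<^sup>2"
    and xy: "b x' y' = u\<^sup>2 * b x y + u * (b x w * b y w)"
    by (simp_all add: x'_def y'_def bil ww sym[of w x] sym[of w y] algebra_simps power2_eq_square)
  have le: "(b x' y')\<^sup>2 \<le> b x' x' * b y' y'" by (rule perp_cauchy_schwarz[OF w px py])
  have nx: "b x' x' \<ge> 0" and ny: "b y' y' \<ge> 0" using perp_nonneg[OF w] px py by auto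
  have "b x' x' < u * (b x w)\<^sup>2" using u x by (simp add: xx mult_pos_neg)
  moreover have "b y' y' < u * (b y w)\<^sup>2" using u y by (simp add: yy mult_pos_neg)
  ultimately have "b x' x' * b y' y' < (u * (b x w)\<^sup>2) * (u * (b y w)\<^sup>2)"
    using nx ny by (intro mult_strict_mono) auto
  then have "(b x' y')\<^sup>2 < (u * (b x w * b y w))\<^sup>2"
    using le by (simp add: power2_eq_square algebra_simps)
  moreover have "u * (b x w * b y w) \<ge> 0" using u x y by (simp add: mult_nonpos_nonpos)
  ultimately have "b x' y' < u * (b x w * b y w)" by (rule power2_less_imp_less)
  then show ?thesis using u by (simp add: xy mult_less_0_iff)
qed

lemma half_cone_convex:
  assumes w: "b w w < 0"
  shows "convex {v. b v v < 0 \<and> b v w < 0}"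
proof (rule convexI)
  fix x y and u v :: real
  assume x: "x \<in> {v. b v v < 0 \<and> b v w < 0}" and y: "y \<in> {v. b v v < 0 \<and> b v w < 0}"
    and uv: "u \<ge> 0" "v \<ge> 0" "u + v = 1"
  have xy: "b x y < 0" using same_cone_neg[OF w] x y by auto
  have "b (u *\<^sub>R x + v *\<^sub>R y) (u *\<^sub>R x + v *\<^sub>R y) = u * u * b x x + 2 * (u * v) * b x y + v * v * b y y"
    by (simp add: bil sym[of y x] algebra_simps)
  moreover have "u * u * b x x \<le> 0" "2 * (u * v) * b x y \<le> 0" "v * v * b y y \<le> 0"
    using x y xy uv by (auto intro!: mult_nonneg_nonpos)
  moreover have "u * u * b x x < 0 \<or> v * v * b y y < 0"
    using x y uv by (cases "u = 0") (auto simp: mult_less_0_iff zero_less_mult_iff)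
  moreover have "b (u *\<^sub>R x + v *\<^sub>R y) w = u * b x w + v * b y w" by (simp add: bil)
  moreover have "u * b x w \<le> 0" "v * b y w \<le> 0"
    using x y uv by (auto intro!: mult_nonneg_nonpos)
  moreover have "u * b x w < 0 \<or> v * b y w < 0"
    using x y uv by (cases "u = 0") (auto simp: mult_less_0_iff)
  ultimately show "u *\<^sub>R x + v *\<^sub>R y \<in> {v. b v v < 0 \<and> b v w < 0}" by (auto; linarith)
qed

lemma P_neg: "v \<in> P \<Longrightarrow> b v v < 0"
  using cone in_components_subset unfolding neg_cone_component_def by blast

lemma P_nonempty: "P \<noteq> {}"
  using cone in_components_nonempty unfolding neg_cone_component_def by blast

text \<open>The half of the cone given by the sign of \<open>b v w\<close> is convex, hence connected, and \<open>b v w\<close> cannot vanish on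
\<open>P\<close>. So the topological component is a half cone, which makes it accessible to algebra.\<close>

lemma P_iff:
  assumes w: "w \<in> P"
  shows "v \<in> P \<longleftrightarrow> b v v < 0 \<and> b v w < 0"
proof
  assume v: "v \<in> P"
  have "connected P" using cone in_components_connected unfolding neg_cone_component_def by blast
  then have conn: "connected ((\<lambda>v. b v w) ` P)"
    by (intro connected_continuous_image continuous_intros B.continuous_on)
  have "b v w < 0"
  proof (rule ccontr)
    assume "\<not> b v w < 0"
    then have "0 \<in> (\<lambda>v. b v w) ` P"
      using connectedD_interval[OF conn, of "b w w" "b v w" 0] P_neg[OF w] v w by auto
    then obtain x where x: "x \<in> P" "b x w = 0" by auto
    then have "w \<noteq> 0" using P_neg[OF w] by (auto simp: B.zero_left)
    then have "b w w > 0" using perp_pos x P_neg by blast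
    then show False using P_neg[OF w] by simp
  qed
  then show "b v v < 0 \<and> b v w < 0" using P_neg v by simp
next
  assume v: "b v v < 0 \<and> b v w < 0"
  let ?H = "{v. b v v < 0 \<and> b v w < 0}"
  have "w \<in> ?H \<inter> P" using w P_neg by auto
  moreover have "connected ?H" using half_cone_convex P_neg[OF w] convex_connected by blast
  ultimately have "?H \<subseteq> P"
    using components_maximal[of P "{v. b v v < 0}" ?H] cone
    unfolding neg_cone_component_def by blast
  then show "v \<in> P" using v by auto
qed

lemma P_prod_neg: "v \<in> P \<Longrightarrow> w \<in> P \<Longrightarrow> b v w < 0"
  using P_iff by blast

lemma P_or_minus:
  assumes "b v v < 0" shows "v \<in> P \<or> - v \<in> P"
proof -
  obtain w where w: "w \<in> P" using P_nonempty by blast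
  have "w \<noteq> 0" using P_neg[OF w] by (auto simp: B.zero_left)
  then have "b v w \<noteq> 0" using perp_pos[OF assms, of w] P_neg[OF w] by force
  then show ?thesis using assms P_iff[OF w, of v] P_iff[OF w, of "- v"] by (auto simp: bil)
qed

lemma P_scale: "v \<in> P \<Longrightarrow> c > 0 \<Longrightarrow> c *\<^sub>R v \<in> P"
proof -
  assume v: "v \<in> P" and c: "c > 0"
  then have "b (c *\<^sub>R v) (c *\<^sub>R v) < 0" "b (c *\<^sub>R v) v < 0"
    using P_neg[OF v] c by (auto simp: bil mult_pos_neg)
  then show ?thesis using P_iff[OF v] by blast
qed

lemma P_add: "v \<in> P \<Longrightarrow> w \<in> P \<Longrightarrow> v + w \<in> P"
proof -
  assume v: "v \<in> P" and w: "w \<in> P"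
  then have "b (v + w) (v + w) < 0" "b (v + w) v < 0"
    using P_neg[OF v] P_neg[OF w] P_prod_neg[OF v w] P_prod_neg[OF w v] by (auto simp: bil)
  then show ?thesis using P_iff[OF v] by blast
qed

lemma P_convex: "convex P"
  unfolding convex_alt
proof (intro ballI allI impI)
  fix x y and u :: real assume "x \<in> P" "y \<in> P" "0 \<le> u \<and> u \<le> 1"
  then show "(1 - u) *\<^sub>R x + u *\<^sub>R y \<in> P"
    using P_add[OF P_scale[of x "1 - u"] P_scale[of y u]]
    by (cases "u = 0"; cases "u = 1") auto
qed

lemma P_open: "open P"
proof -
  obtain w where w: "w \<in> P" using P_nonempty by blast
  have "P = {v. b v v < 0} \<inter> {v. b v w < 0}" using P_iff[OF w] by blast
  moreover have "open ({v. b v v < 0} \<inter> {v. b v w < 0})"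
    by (intro open_Int open_Collect_less continuous_intros B.continuous_on)
  ultimately show ?thesis by simp
qed

lemma P_nonzero: "v \<in> P \<Longrightarrow> v \<noteq> 0"
  using P_neg[of v] by (auto simp: B.zero_left)

lemma nondegenerate:
  assumes "\<And>y. b y z = 0" shows "z = 0"
proof -
  obtain w where w: "w \<in> P" using P_nonempty by blast
  show ?thesis using perp_pos[OF P_neg[OF w], of z] assms by force
qed

lemma halfspace_determines_normal:
  assumes r: "b r r > 0" and sub: "\<And>d. b d r < 0 \<Longrightarrow> b d t < 0"
  shows "\<exists>c>0. t = c *\<^sub>R r"
proof -
  have rt: "b r t > 0" using sub[of "- r"] r by (simp add: bil)
  have perp: "b y t = 0" if y: "b y r = 0" for y
  proof (rule ccontr)
    assume n: "b y t \<noteq> 0"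
    have "b (- r + (b r t / b y t) *\<^sub>R y) r < 0" using r y by (simp add: bil)
    from sub[OF this] show False using n by (simp add: bil)
  qed
  define c where "c = b r t / b r r"
  have "t - c *\<^sub>R r = 0"
  proof (rule nondegenerate)
    fix y
    have "b (y - (b y r / b r r) *\<^sub>R r) r = 0" using r by (simp add: bil)
    from perp[OF this] show "b y (t - c *\<^sub>R r) = 0" by (simp add: bil c_def field_simps)
  qed
  moreover have "c > 0" using r rt by (simp add: c_def)
  ultimately show ?thesis by auto
qed

lemma gram_kernel:
  assumes \<Delta>: "b r r * b s s - (b r s)\<^sup>2 \<noteq> 0"
    and r: "x * b r r + y * b r s = 0" and s: "x * b r s + y * b s s = 0"
  shows "x = 0" "y = 0"
proof -
  have "x * (b r r * b s s - (b r s)\<^sup>2) = (x * b r r + y * b r s) * b s s - (x * b r s + y * b s s) * b r s"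
    "y * (b r r * b s s - (b r s)\<^sup>2) = (x * b r s + y * b s s) * b r r - (x * b r r + y * b r s) * b r s"
    by (simp_all add: algebra_simps power2_eq_square)
  then show "x = 0" "y = 0" unfolding r s using \<Delta> by simp_all
qed

text \<open>In a linear relation the coefficient of \<open>p\<close> vanishes by orthogonality, and then the other two vanish because the Gram
matrix of \<open>r\<close> and \<open>s\<close> is invertible.\<close>

lemma corner_span:
  assumes \<Delta>: "b r r * b s s - (b r s)\<^sup>2 \<noteq> 0" and p: "b p p \<noteq> 0" "b p r = 0" "b p s = 0"
  shows "\<exists>x y z. t = x *\<^sub>R r + y *\<^sub>R s + z *\<^sub>R p"
proof (rule three_independent_span)
  fix x y z assume *: "x *\<^sub>R r + y *\<^sub>R s + z *\<^sub>R p = 0"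
  have "b (x *\<^sub>R r + y *\<^sub>R s + z *\<^sub>R p) u = 0" for u by (simp add: * B.zero_left)
  then have e: "x * b r u + y * b s u + z * b p u = 0" for u by (simp add: bil)
  have z: "z = 0" using e[of p] p by (simp add: sym[of r p] sym[of s p])
  have r: "x * b r r + y * b r s = 0" and s: "x * b r s + y * b s s = 0"
    using e[of r] e[of s] z by (simp_all add: sym[of s r])
  show "x = 0 \<and> y = 0 \<and> z = 0" using gram_kernel[OF \<Delta> r s] z by simp
qed

end

section \<open>Walls of a chamber\<close>

text \<open>Equivalence of roots as far as half spaces are concerned. Between primitive vectors of one lattice the factor is
automatically a positive unit.\<close>

definition pos_prop :: "real^3 \<Rightarrow> real^3 \<Rightarrow> bool" where
  "pos_prop r s \<longleftrightarrow> (\<exists>c>0. s = c *\<^sub>R r)"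

lemma pos_prop_sym: "pos_prop r s \<Longrightarrow> pos_prop s r"
  unfolding pos_prop_def
proof (elim exE conjE)
  fix c :: real assume "c > 0" "s = c *\<^sub>R r"
  then show "\<exists>c>0. r = c *\<^sub>R s" by (intro exI[of _ "inverse c"]) simp
qed

lemma pos_prop_trans: "pos_prop r s \<Longrightarrow> pos_prop s t \<Longrightarrow> pos_prop r t"
  unfolding pos_prop_def
proof (elim exE conjE)
  fix c d :: real assume "c > 0" "s = c *\<^sub>R r" "d > 0" "t = d *\<^sub>R s"
  then show "\<exists>c>0. t = c *\<^sub>R r" by (intro exI[of _ "d * c"]) simp
qed

lemma pos_prop_linear: "linear f \<Longrightarrow> pos_prop r s \<Longrightarrow> pos_prop (f r) (f s)"
  unfolding pos_prop_def by (auto simp: linear_cmul)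

text \<open>All that the geometry of chambers uses of the roots is that they are stable under their reflections and
that their mirrors are locally finite.\<close>

locale root_geometry = lorentz_cone b P for b :: "3 form" and P +
  fixes R :: "(real^3) set"
  assumes root_pos: "r \<in> R \<Longrightarrow> b r r > 0"
    and reflect_root: "r \<in> R \<Longrightarrow> s \<in> R \<Longrightarrow> reflection b r s \<in> R"
    and locally_finite: "q \<in> P \<Longrightarrow>
      \<exists>U. open U \<and> q \<in> U \<and> (\<forall>t\<in>R. \<forall>u\<in>U. b u t = 0 \<longrightarrow> b q t = 0)"
begin

lemma segment_sign:
  assumes "convex K" "u \<in> K" "v \<in> K" "b u t < 0" "\<And>x. x \<in> K \<Longrightarrow> b x t \<noteq> 0"
  shows "b v t < 0"
proof (rule ccontr)
  assume n: "\<not> b v t < 0"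
  have "connected ((\<lambda>v. b v t) ` K)" using assms(1)
    by (intro connected_continuous_image continuous_intros B.continuous_on convex_connected)
  then have "0 \<in> (\<lambda>v. b v t) ` K"
    using connectedD_interval[of _ "b u t" "b v t" 0] assms n by auto
  then show False using assms(5) by force
qed

lemma local_ball:
  assumes q: "q \<in> P"
  obtains \<epsilon> where "\<epsilon> > 0" "ball q \<epsilon> \<subseteq> P"
    "\<And>t u. t \<in> R \<Longrightarrow> b q t < 0 \<Longrightarrow> u \<in> ball q \<epsilon> \<Longrightarrow> b u t < 0"
    "\<And>t u. t \<in> R \<Longrightarrow> u \<in> ball q \<epsilon> \<Longrightarrow> b u t = 0 \<Longrightarrow> b q t = 0"
proof -
  obtain U where U: "open U" "q \<in> U" "\<forall>t\<in>R. \<forall>u\<in>U. b u t = 0 \<longrightarrow> b q t = 0"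
    using locally_finite[OF q] by blast
  have "open (U \<inter> P)" "q \<in> U \<inter> P" using U P_open q by auto
  then obtain \<epsilon> where e: "\<epsilon> > 0" "ball q \<epsilon> \<subseteq> U \<inter> P" using open_contains_ball by metis
  have z: "b q t = 0" if "t \<in> R" "u \<in> ball q \<epsilon>" "b u t = 0" for t u
    using that U e by blast
  have "b u t < 0" if t: "t \<in> R" "b q t < 0" "u \<in> ball q \<epsilon>" for t u
    using segment_sign[of "ball q \<epsilon>" q u t] t z e(1) by force
  then show ?thesis using that e z by blast
qed

text \<open>A simple system without the requirement that \<open>C\<close> be a topological component: it only has to be nonempty
and to avoid all mirrors. In this form the notion is visibly transported by isometries.\<close>

definition chamber_system :: "(real^3) set \<Rightarrow> (real^3) set \<Rightarrow> bool" where
  "chamber_system C S \<longleftrightarrow> S \<subseteq> R \<and> C \<noteq> {} \<and> C = P \<inter> (\<Inter>r\<in>S. neg_half b r) \<and>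
     (\<forall>r\<in>S. C \<noteq> P \<inter> (\<Inter>r'\<in>S - {r}. neg_half b r')) \<and> (\<forall>t\<in>R. C \<inter> mirror b t = {})"

definition wall :: "(real^3) set \<Rightarrow> real^3 \<Rightarrow> bool" where
  "wall C r \<longleftrightarrow> (\<exists>S. chamber_system C S \<and> r \<in> S)"

lemma
  assumes "chamber_system C S"
  shows system_roots: "s \<in> S \<Longrightarrow> s \<in> R"
    and system_nonempty: "\<exists>w. w \<in> C"
    and system_avoids: "t \<in> R \<Longrightarrow> w \<in> C \<Longrightarrow> b w t \<noteq> 0"
    and system_eq: "C = P \<inter> (\<Inter>r\<in>S. neg_half b r)"
    and system_irredundant: "r \<in> S \<Longrightarrow> C \<noteq> P \<inter> (\<Inter>r'\<in>S - {r}. neg_half b r')"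
proof -
  note D = assms[unfolded chamber_system_def]
  have *: "S \<subseteq> R" "C \<noteq> {}" "\<forall>r\<in>S. C \<noteq> P \<inter> (\<Inter>r'\<in>S - {r}. neg_half b r')"
      "\<forall>t\<in>R. C \<inter> mirror b t = {}"
    by (rule D[THEN conjunct1] D[THEN conjunct2, THEN conjunct1]
        D[THEN conjunct2, THEN conjunct2, THEN conjunct2, THEN conjunct1]
        D[THEN conjunct2, THEN conjunct2, THEN conjunct2, THEN conjunct2])+
  have eq: "C = P \<inter> (\<Inter>r\<in>S. neg_half b r)"
    by (rule D[THEN conjunct2, THEN conjunct2, THEN conjunct1])
  show "s \<in> S \<Longrightarrow> s \<in> R" using *(1) by blast
  show "\<exists>w. w \<in> C" using *(2) by blast
  show "b w t \<noteq> 0" if "t \<in> R" "w \<in> C"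
  proof -
    have "w \<notin> mirror b t" using *(4) that by blast
    then show ?thesis by (simp add: mirror_def)
  qed
  show "C = P \<inter> (\<Inter>r\<in>S. neg_half b r)" by (rule eq)
  show "r \<in> S \<Longrightarrow> C \<noteq> P \<inter> (\<Inter>r'\<in>S - {r}. neg_half b r')" using *(3) by blast
qed

lemma system_mem: assumes "chamber_system C S" shows "v \<in> C \<longleftrightarrow> v \<in> P \<and> (\<forall>s\<in>S. b v s < 0)"
  by (subst system_eq[OF assms]) (auto simp: neg_half_def)

lemma system_convex: assumes "chamber_system C S" shows "convex C"
proof -
  have "convex (neg_half b r)" for r
  proof -
    have "linear (\<lambda>v. b v r)" by (rule bounded_linear.linear[OF B.bounded_linear_left])
    then have "convex ((\<lambda>v. b v r) -` {..<0})" by (rule convex_linear_vimage) (rule convex_real_interval)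
    then show ?thesis by (simp add: neg_half_def vimage_def)
  qed
  then have "convex (P \<inter> (\<Inter>r\<in>S. neg_half b r))"
    by (intro convex_Int P_convex convex_INT)
  then show ?thesis by (subst system_eq[OF assms])
qed

lemma wall_root: "wall C r \<Longrightarrow> r \<in> R"
  unfolding wall_def using system_roots by blast

lemma wall_pos: "wall C r \<Longrightarrow> b r r > 0"
  using wall_root root_pos by blast

lemma wall_neg: "wall C r \<Longrightarrow> w \<in> C \<Longrightarrow> b w r < 0"
  unfolding wall_def using system_mem by blast

lemma wall_nonempty: "wall C r \<Longrightarrow> \<exists>w. w \<in> C"
  unfolding wall_def using system_nonempty by blast

lemma wall_subset: "wall C r \<Longrightarrow> w \<in> C \<Longrightarrow> w \<in> P"
  unfolding wall_def using system_mem by blast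

lemma system_root_sign:
  assumes "chamber_system C S" "t \<in> R" "u \<in> C" "b u t < 0" "v \<in> C"
  shows "b v t < 0"
proof (rule segment_sign[OF system_convex[OF assms(1)]])
  show "b x t \<noteq> 0" if "x \<in> C" for x
    using system_avoids[OF assms(1,2) that] .
qed (use assms in auto)

lemma closure_nonpos:
  assumes "\<And>w. w \<in> C \<Longrightarrow> b w t \<le> 0" "q \<in> closure C"
  shows "b q t \<le> 0"
proof -
  have "closed {v. b v t \<le> 0}" by (intro closed_Collect_le continuous_intros B.continuous_on)
  then have "closure C \<subseteq> {v. b v t \<le> 0}" using assms(1) by (intro closure_minimal) auto
  then show ?thesis using assms(2) by auto
qed

lemma wall_closure_nonpos: "wall C t \<Longrightarrow> q \<in> closure C \<Longrightarrow> b q t \<le> 0"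
  using closure_nonpos wall_neg by (meson less_imp_le)

lemma in_closure_system:
  assumes S: "chamber_system C S" and q: "q \<in> P" "\<And>s. s \<in> S \<Longrightarrow> b q s \<le> 0"
  shows "q \<in> closure C"
proof -
  obtain w where w: "w \<in> C" using system_nonempty[OF S] by blast
  have wP: "w \<in> P" using S w system_mem by blast
  have "(\<lambda>n. q + (1 / real (Suc n)) *\<^sub>R w) \<longlonglongrightarrow> q + 0 *\<^sub>R w"
    by (intro tendsto_intros LIMSEQ_Suc[OF lim_1_over_n])
  moreover have "q + (1 / real (Suc n)) *\<^sub>R w \<in> C" for n
  proof -
    have "b (q + (1 / real (Suc n)) *\<^sub>R w) s < 0" if "s \<in> S" for s
    proof -
      have "b w s < 0" using system_mem[OF S] w that by blast
      then have "(1 / real (Suc n)) * b w s < 0" by (simp add: divide_neg_pos)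
      then show ?thesis using q(2)[OF that] by (simp add: bil)
    qed
    moreover have "q + (1 / real (Suc n)) *\<^sub>R w \<in> P"
      by (rule P_add[OF q(1) P_scale[OF wP]]) simp
    ultimately show ?thesis using system_mem[OF S] by blast
  qed
  ultimately show ?thesis unfolding closure_sequential
    by (intro exI[of _ "\<lambda>n. q + (1 / real (Suc n)) *\<^sub>R w"]) auto
qed

text \<open>Irredundance gives a point violating only the inequality of \<open>r\<close>; the segment from it to a point of \<open>C\<close>
crosses the mirror of \<open>r\<close> where all other inequalities are strict. By local finiteness they stay strict
nearby, so close to this point \<open>C\<close> is just a half ball.\<close>

lemma wall_point:
  assumes r: "wall C r"
  obtains q \<epsilon> where "q \<in> closure C" "b q r = 0" "\<epsilon> > 0"
    "\<And>u. u \<in> ball q \<epsilon> \<Longrightarrow> b u r < 0 \<Longrightarrow> u \<in> C"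
proof -
  obtain S where S: "chamber_system C S" "r \<in> S" using r unfolding wall_def by blast
  have "P \<inter> (\<Inter>r\<in>S. neg_half b r) \<noteq> P \<inter> (\<Inter>r'\<in>S - {r}. neg_half b r')"
    using system_irredundant[OF S] system_eq[OF S(1)] by metis
  then obtain v where v: "v \<in> P" "\<And>s. s \<in> S - {r} \<Longrightarrow> b v s < 0" "\<not> b v r < 0"
    unfolding neg_half_def by blast
  obtain w where w: "w \<in> C" using system_nonempty[OF S(1)] by blast
  have wS: "w \<in> P" "\<And>s. s \<in> S \<Longrightarrow> b w s < 0" using S w system_mem by blast+
  \<comment> \<open>The weights for which the combination lies on the mirror.\<close>
  define x where "x = b v r" define y where "y = - b w r"
  have xy: "x \<ge> 0" "y > 0" using v(3) wS(2)[OF S(2)] by (auto simp: x_def y_def)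
  define q where "q = y *\<^sub>R v + x *\<^sub>R w"
  have q: "q \<in> P" using xy v(1) wS(1) P_add[OF P_scale[of v y] P_scale[of w x]] P_scale[of v y]
    by (cases "x = 0") (auto simp: q_def)
  have qr: "b q r = 0" by (simp add: q_def bil x_def y_def)
  have qs: "b q s < 0" if "s \<in> S - {r}" for s
  proof -
    have "y * b v s < 0" using v(2)[OF that] xy by (simp add: mult_pos_neg)
    moreover have "x * b w s \<le> 0" using wS(2)[of s] that xy by (intro mult_nonneg_nonpos) auto
    ultimately show ?thesis by (simp add: q_def bil)
  qed
  obtain \<epsilon> where e: "\<epsilon> > 0" "ball q \<epsilon> \<subseteq> P"
    "\<And>t u. t \<in> R \<Longrightarrow> b q t < 0 \<Longrightarrow> u \<in> ball q \<epsilon> \<Longrightarrow> b u t < 0" using local_ball[OF q] by metis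
  have "u \<in> C" if u: "u \<in> ball q \<epsilon>" "b u r < 0" for u
  proof -
    have "b u s < 0" if "s \<in> S" for s
    proof (cases "s = r")
      case False
      then show ?thesis using e(3)[of s u] qs[of s] u(1) system_roots[OF S(1) that] that by blast
    qed (use u in auto)
    then show ?thesis using system_mem[OF S(1)] u e(2) by blast
  qed
  moreover have "q \<in> closure C"
    by (rule in_closure_system[OF S(1) q]) (metis qs qr Diff_iff less_imp_le order_refl singletonD)
  ultimately show ?thesis using that qr e(1) by blast
qed

lemma wall_point_move:
  assumes "\<epsilon> > 0" "\<And>u. u \<in> ball q \<epsilon> \<Longrightarrow> b u r < 0 \<Longrightarrow> u \<in> C" "b q r = 0" "b d r < 0"
  shows "\<exists>\<delta>0>0. \<forall>\<delta>. 0 < \<delta> \<longrightarrow> \<delta> < \<delta>0 \<longrightarrow> q + \<delta> *\<^sub>R d \<in> C"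
proof -
  have d: "d \<noteq> 0" using assms(4) by (auto simp: B.zero_left)
  have "q + \<delta> *\<^sub>R d \<in> C" if "0 < \<delta>" "\<delta> < \<epsilon> / norm d" for \<delta>
  proof (rule assms(2))
    have "\<delta> * norm d < \<epsilon>" using that d by (simp add: field_simps)
    then show "q + \<delta> *\<^sub>R d \<in> ball q \<epsilon>" using that by (simp add: dist_norm)
    show "b (q + \<delta> *\<^sub>R d) r < 0" using assms(3,4) that by (simp add: bil mult_pos_neg)
  qed
  then show ?thesis using d assms(1) by (intro exI[of _ "\<epsilon> / norm d"]) auto
qed

text \<open>Near such a point \<open>C\<close> fills a half ball, so a linear form negative on \<open>C\<close> and vanishing there is negative
on the whole half space of \<open>r\<close>.\<close>

lemma wall_point_unique:
  assumes r: "b r r > 0" and e: "\<epsilon> > 0" "\<And>u. u \<in> ball q \<epsilon> \<Longrightarrow> b u r < 0 \<Longrightarrow> u \<in> C" "b q r = 0"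
    and t: "\<And>w. w \<in> C \<Longrightarrow> b w t < 0" "b q t \<ge> 0"
  shows "pos_prop r t"
  unfolding pos_prop_def
proof (rule halfspace_determines_normal[OF r])
  fix d assume d: "b d r < 0"
  obtain \<delta>0 where "\<delta>0 > 0" "\<forall>\<delta>. 0 < \<delta> \<longrightarrow> \<delta> < \<delta>0 \<longrightarrow> q + \<delta> *\<^sub>R d \<in> C"
    using wall_point_move[OF e d] by blast
  then have "q + (\<delta>0 / 2) *\<^sub>R d \<in> C" "\<delta>0 > 0" by auto
  from t(1)[OF this(1)] this(2) t(2) have "\<delta>0 * b d t < 0" by (simp add: bil)
  then show "b d t < 0" using \<open>\<delta>0 > 0\<close> by (simp add: mult_less_0_iff)
qed

text \<open>If \<open>b r s > 0\<close>, the root \<open>s'\<close> obtained by reflecting \<open>s\<close> in \<open>r\<close> is negative at an interior point of the side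
of \<open>r\<close>, hence on all of \<open>C\<close>. But at an interior point of the side of \<open>s\<close> it equals a negative multiple of
\<open>b p r < 0\<close>, which is positive.\<close>

lemma walls_obtuse:
  assumes r: "wall C r" and s: "wall C s" and n: "\<not> pos_prop r s"
  shows "b r s \<le> 0"
proof (rule ccontr)
  assume pos: "\<not> b r s \<le> 0"
  obtain S where S: "chamber_system C S" using r unfolding wall_def by blast
  have rp: "b r r > 0" and sp: "b s s > 0" using r s wall_pos by auto
  obtain q \<epsilon> where q: "q \<in> closure C" "b q r = 0" and e: "\<epsilon> > 0" "\<And>u. u \<in> ball q \<epsilon> \<Longrightarrow> b u r < 0 \<Longrightarrow> u \<in> C"
    using wall_point[OF r] by metis
  obtain p \<epsilon>' where p: "p \<in> closure C" "b p s = 0" and e': "\<epsilon>' > 0" "\<And>u. u \<in> ball p \<epsilon>' \<Longrightarrow> b u s < 0 \<Longrightarrow> u \<in> C"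
    using wall_point[OF s] by metis
  have qs: "b q s < 0" using wall_point_unique[OF rp e q(2)] wall_neg[OF s] n by force
  have pr: "b p r < 0" using wall_point_unique[OF sp e' p(2)] wall_neg[OF r] n pos_prop_sym by force
  define s' where "s' = reflection b r s"
  have s'R: "s' \<in> R" unfolding s'_def using reflect_root r s wall_root by blast
  have bs': "b v s' = b v s - (2 * b r s / b r r) * b v r" for v
    by (simp add: s'_def reflection_def bil)
  obtain \<delta>0 where d: "\<delta>0 > 0" "\<And>\<delta>. 0 < \<delta> \<Longrightarrow> \<delta> < \<delta>0 \<Longrightarrow> q + \<delta> *\<^sub>R (- r) \<in> C"
    using wall_point_move[OF e q(2), of "- r"] rp by (auto simp: bil)
  define \<delta> where "\<delta> = min (\<delta>0 / 2) (- b q s / (2 * b r s))"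
  have dl: "\<delta> > 0" "\<delta> < \<delta>0" using d(1) qs pos by (auto simp: \<delta>_def divide_neg_pos)
  have "\<delta> * b r s < - b q s"
  proof -
    have "\<delta> * b r s \<le> (- b q s / (2 * b r s)) * b r s"
      using pos by (intro mult_right_mono) (auto simp: \<delta>_def)
    then show ?thesis using pos qs by simp
  qed
  then have "b (q + \<delta> *\<^sub>R (- r)) s' < 0"
    using rp by (simp add: bs' bil q(2))
  then have neg: "b w s' < 0" if "w \<in> C" for w
    using system_root_sign[OF S s'R d(2)[OF dl]] that by blast
  have "b p s' \<le> 0" by (rule closure_nonpos[OF _ p(1)]) (use neg in force)
  moreover have "b p s' > 0" using pr pos rp p(2) by (simp add: bs' mult_pos_neg divide_neg_pos)
  ultimately show False by simp
qed

end

section \<open>Corners of a chamber\<close>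

context root_geometry
begin

text \<open>The projection of \<open>s\<close> off \<open>r\<close> lies in the positive definite complement of the corner; it does not vanish,
since opposite roots could not both be negative on \<open>C\<close>.\<close>

lemma walls_gram_pos:
  assumes r: "wall C r" and s: "wall C s" and n: "\<not> pos_prop r s"
    and p: "p \<in> P" "b p r = 0" "b p s = 0"
  shows "b r r * b s s - (b r s)\<^sup>2 > 0"
proof -
  define z where "z = b r r *\<^sub>R s - b r s *\<^sub>R r"
  have rp: "b r r > 0" using wall_pos[OF r] .
  have "z \<noteq> 0"
  proof
    assume "z = 0"
    then have eq: "b r r *\<^sub>R s = b r s *\<^sub>R r" by (simp add: z_def)
    obtain w where w: "w \<in> C" using wall_nonempty[OF r] by blast
    have "b r r * b w s = b r s * b w r" using arg_cong[OF eq, of "b w"] by (simp add: bil)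
    moreover have "b r r * b w s < 0" using rp wall_neg[OF s w] by (simp add: mult_pos_neg)
    moreover have "b r s * b w r \<ge> 0"
      using walls_obtuse[OF r s n] wall_neg[OF r w] by (simp add: mult_nonpos_nonpos)
    ultimately show False by simp
  qed
  moreover have "b p z = 0" by (simp add: z_def bil p)
  ultimately have "b z z > 0" using perp_pos[OF P_neg[OF p(1)]] by blast
  moreover have "b z z = b r r * (b r r * b s s - (b r s)\<^sup>2)"
    by (simp add: z_def bil sym[of s r] algebra_simps power2_eq_square)
  ultimately show ?thesis using rp by (simp add: zero_less_mult_iff)
qed

text \<open>In \<open>t = x r + y s + d p\<close> the coefficients \<open>x\<close>, \<open>y\<close> are non-positive, because \<open>t\<close> has non-positive product with
\<open>r\<close> and \<open>s\<close> and the inverse of their Gram matrix has non-negative entries. If also \<open>d \<le> 0\<close>, then \<open>t\<close> could not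
be negative on \<open>C\<close>.\<close>

lemma corner_other_walls:
  assumes r: "wall C r" and s: "wall C s" and n: "\<not> pos_prop r s"
    and p: "p \<in> P" "b p r = 0" "b p s = 0"
    and t: "wall C t" "\<not> pos_prop r t" "\<not> pos_prop s t"
  shows "b p t < 0"
proof (rule ccontr)
  assume nn: "\<not> b p t < 0"
  have \<Delta>: "b r r * b s s - (b r s)\<^sup>2 > 0" by (rule walls_gram_pos[OF r s n p])
  have rp: "b r r > 0" and sp: "b s s > 0" using r s wall_pos by auto
  have pp: "b p p < 0" using P_neg[OF p(1)] .
  obtain x y d where t_eq: "t = x *\<^sub>R r + y *\<^sub>R s + d *\<^sub>R p"
    using corner_span[of r s p t] \<Delta> pp p by auto
  have d: "d \<le> 0" using nn pp by (simp add: t_eq bil p not_less zero_le_mult_iff)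
  have tr: "x * b r r + y * b r s \<le> 0" and ts: "x * b r s + y * b s s \<le> 0"
    using walls_obtuse[OF r t(1,2)] walls_obtuse[OF s t(1,3)]
    by (simp_all add: t_eq bil p sym[of s r] sym[of r p] sym[of s p])
  have rs: "b r s \<le> 0" by (rule walls_obtuse[OF r s n])
  have "x * (b r r * b s s - (b r s)\<^sup>2) = (x * b r r + y * b r s) * b s s - (x * b r s + y * b s s) * b r s"
    "y * (b r r * b s s - (b r s)\<^sup>2) = (x * b r s + y * b s s) * b r r - (x * b r r + y * b r s) * b r s"
    by (simp_all add: algebra_simps power2_eq_square)
  moreover have "(x * b r r + y * b r s) * b s s \<le> 0" "(x * b r s + y * b s s) * b r s \<ge> 0"
    "(x * b r s + y * b s s) * b r r \<le> 0" "(x * b r r + y * b r s) * b r s \<ge> 0"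
    using tr ts rs rp sp by (simp_all add: mult_nonpos_nonneg mult_nonpos_nonpos)
  ultimately have "x * (b r r * b s s - (b r s)\<^sup>2) \<le> 0" "y * (b r r * b s s - (b r s)\<^sup>2) \<le> 0"
    by linarith+
  then have xy: "x \<le> 0" "y \<le> 0" using \<Delta> by (simp_all add: mult_le_0_iff)
  obtain w where w: "w \<in> C" using wall_nonempty[OF r] by blast
  have "b w r < 0" "b w s < 0" "b w p < 0" "b w t < 0"
    using wall_neg[OF r w] wall_neg[OF s w] wall_neg[OF t(1) w] P_prod_neg[OF wall_subset[OF r w] p(1)]
    by auto
  moreover have "b w t = x * b w r + y * b w s + d * b w p" by (simp add: t_eq bil)
  ultimately show False using xy d
    by (smt (verit) mult_nonpos_nonpos)
qed

lemma pos_prop_prod_zero: "pos_prop r t \<Longrightarrow> b p r = 0 \<Longrightarrow> b p t = 0"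
  by (auto simp: pos_prop_def bil)

lemma corner_walls_nonpos:
  assumes "wall C r" "wall C s" "\<not> pos_prop r s" "p \<in> P" "b p r = 0" "b p s = 0" "wall C t"
  shows "b p t \<le> 0"
  using corner_other_walls[OF assms] pos_prop_prod_zero[of r t p] pos_prop_prod_zero[of s t p] assms(5,6)
  by fastforce

lemma corner_in_closure:
  assumes "wall C r" "wall C s" "\<not> pos_prop r s" "p \<in> P" "b p r = 0" "b p s = 0"
  shows "p \<in> closure C"
proof -
  obtain S where S: "chamber_system C S" using assms(1) unfolding wall_def by blast
  show ?thesis
    using in_closure_system[OF S assms(4)] corner_walls_nonpos[OF assms] S unfolding wall_def by blast
qed

text \<open>If a point of \<open>C'\<close> were outside \<open>C\<close>, some wall \<open>t\<close> of \<open>C\<close> would be positive on \<open>C'\<close>. The common corner lies in both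
closures, so \<open>t\<close> vanishes there and must be \<open>r\<close> or \<open>s\<close>, which are negative on \<open>C'\<close>.\<close>

lemma chamber_subset:
  assumes r: "wall C r" "wall C' r" and s: "wall C s" "wall C' s" and n: "\<not> pos_prop r s"
    and p: "p \<in> P" "b p r = 0" "b p s = 0"
  shows "C' \<subseteq> C"
proof
  fix w assume w: "w \<in> C'"
  obtain S where S: "chamber_system C S" using r(1) unfolding wall_def by blast
  obtain S' where S': "chamber_system C' S'" using r(2) unfolding wall_def by blast
  show "w \<in> C"
  proof (rule ccontr)
    assume "w \<notin> C"
    then obtain t where t: "t \<in> S" "\<not> b w t < 0"
      using system_mem[OF S] wall_subset[OF r(2) w] by blast
    have tC: "wall C t" using S t unfolding wall_def by blast
    have tR: "t \<in> R" using wall_root[OF tC] .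
    have pos: "b v t \<ge> 0" if v: "v \<in> C'" for v
      using system_root_sign[OF S' tR v _ w] t(2) by fastforce
    have "b p (- t) \<le> 0"
      using closure_nonpos[of C' "- t" p] pos corner_in_closure[OF r(2) s(2) n p] by (simp add: bil)
    then have "\<not> b p t < 0" by (simp add: bil)
    then have "pos_prop r t \<or> pos_prop s t" using corner_other_walls[OF r(1) s(1) n p tC] by blast
    then have "b w t < 0" using wall_neg[OF r(2) w] wall_neg[OF s(2) w]
      by (auto simp: pos_prop_def bil mult_pos_neg)
    then show False using t(2) by simp
  qed
qed

lemma chamber_determined:
  assumes "wall C r" "wall C' r" "wall C s" "wall C' s" "\<not> pos_prop r s"
    "p \<in> P" "b p r = 0" "b p s = 0"
  shows "C' = C"
  using chamber_subset[OF assms] chamber_subset[OF assms(2,1,4,3,5-8)] by blast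

lemma wall_scale:
  assumes r: "wall C r" and rs: "pos_prop r s" and s: "s \<in> R"
  shows "wall C s"
proof -
  obtain S where S: "chamber_system C S" "r \<in> S" using r unfolding wall_def by blast
  have N: "neg_half b s = neg_half b r"
    using rs by (auto simp: pos_prop_def neg_half_def bil mult_less_0_iff)
  show ?thesis
  proof (cases "s \<in> S")
    case False
    have eq1: "(\<Inter>x\<in>insert s (S - {r}). neg_half b x) = (\<Inter>x\<in>S. neg_half b x)" using N S(2) by auto
    have "C \<noteq> P \<inter> (\<Inter>x\<in>insert s (S - {r}) - {t}. neg_half b x)" if t: "t \<in> insert s (S - {r})" for t
    proof (cases "t = s")
      case True
      then have "insert s (S - {r}) - {t} = S - {r}" using False by auto
      then show ?thesis using system_irredundant[OF S] by simp
    next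
      case ts: False
      then have "insert s (S - {r}) - {t} = insert s (S - {t} - {r})" "r \<in> S - {t}" using t S(2) by auto
      then have "(\<Inter>x\<in>insert s (S - {r}) - {t}. neg_half b x) = (\<Inter>x\<in>S - {t}. neg_half b x)"
        using N by auto
      then show ?thesis using system_irredundant[OF S(1), of t] t ts by simp
    qed
    moreover have "insert s (S - {r}) \<subseteq> R" using s system_roots[OF S(1)] by auto
    moreover have "C \<noteq> {}" using system_nonempty[OF S(1)] by blast
    moreover have "C \<inter> mirror b t = {}" if "t \<in> R" for t
      using system_avoids[OF S(1) that] by (auto simp: mirror_def)
    moreover have "C = P \<inter> (\<Inter>x\<in>insert s (S - {r}). neg_half b x)"
      unfolding eq1 by (rule system_eq[OF S(1)])
    ultimately have "chamber_system C (insert s (S - {r}))" unfolding chamber_system_def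
      by (intro conjI ballI)
    then show ?thesis unfolding wall_def by blast
  qed (use S in \<open>auto simp: wall_def\<close>)
qed

lemma system_image:
  assumes f: "bij f" "\<And>x y. b (f x) (f y) = b x y" "f ` P = P" "f ` R = R"
    and S: "chamber_system C S"
  shows "chamber_system (f ` C) (f ` S)"
proof -
  have inj: "inj f" using f(1) bij_is_inj by blast
  have img: "f ` (P \<inter> (\<Inter>x\<in>A. neg_half b x)) = P \<inter> (\<Inter>x\<in>f ` A. neg_half b x)" for A
  proof -
    have "f v \<in> P \<longleftrightarrow> v \<in> P" for v using f(3) inj by (metis inj_image_mem_iff)
    then have "f v \<in> P \<inter> (\<Inter>x\<in>f ` A. neg_half b x) \<longleftrightarrow> v \<in> P \<inter> (\<Inter>x\<in>A. neg_half b x)" for v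
      by (simp add: neg_half_def f(2))
    then have "u \<in> f ` (P \<inter> (\<Inter>x\<in>A. neg_half b x)) \<longleftrightarrow> u \<in> P \<inter> (\<Inter>x\<in>f ` A. neg_half b x)" for u
      using bij_is_surj[OF f(1)] inj_image_mem_iff[OF inj] by (metis surjD)
    then show ?thesis by blast
  qed
  have "f ` C = P \<inter> (\<Inter>x\<in>f ` S. neg_half b x)"
    using img[of S] system_eq[OF S] by simp
  moreover have "f ` C \<noteq> P \<inter> (\<Inter>x\<in>f ` S - {r'}. neg_half b x)" if r': "r' \<in> f ` S" for r'
  proof -
    obtain r where r: "r \<in> S" "r' = f r" using r' by blast
    have "f ` S - {r'} = f ` (S - {r})" using inj r by (auto simp: inj_def)
    then show ?thesis
      using img[of "S - {r}"] system_irredundant[OF S r(1)] inj_image_eq_iff[OF inj] by metis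
  qed
  moreover have "f ` S \<subseteq> R" using system_roots[OF S] f(4) by blast
  moreover have "f ` C \<noteq> {}" using system_nonempty[OF S] by blast
  moreover have "f ` C \<inter> mirror b t = {}" if t: "t \<in> R" for t
  proof -
    obtain u where u: "u \<in> R" "t = f u" using t f(4) by blast
    then show ?thesis using system_avoids[OF S u(1)] by (auto simp: mirror_def f(2))
  qed
  ultimately show ?thesis unfolding chamber_system_def by (intro conjI ballI)
qed

lemma wall_image:
  assumes "bij f" "\<And>x y. b (f x) (f y) = b x y" "f ` P = P" "f ` R = R" "wall C r"
  shows "wall (f ` C) (f r)"
  using assms(5) system_image[OF assms(1-4)] unfolding wall_def by blast

end

section \<open>Sides and boundary components\<close>

lemma clopen_connected_is_component:
  fixes A X :: "'a::metric_space set"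
  assumes A: "A \<noteq> {}" "A \<subseteq> X" "connected A"
    and op: "\<And>q. q \<in> A \<Longrightarrow> \<exists>\<epsilon>>0. ball q \<epsilon> \<inter> X \<subseteq> A"
    and cl: "\<And>q. q \<in> X - A \<Longrightarrow> \<exists>\<epsilon>>0. ball q \<epsilon> \<inter> A = {}"
  shows "A \<in> components X"
  unfolding in_components_maximal
proof (intro conjI allI impI)
  fix D assume D: "D \<noteq> {} \<and> A \<subseteq> D \<and> D \<subseteq> X \<and> connected D"
  have "openin (top_of_set D) A"
    unfolding openin_euclidean_subtopology_iff
  proof (intro conjI ballI)
    fix q assume "q \<in> A"
    then obtain \<epsilon> where e: "\<epsilon> > 0" "ball q \<epsilon> \<inter> X \<subseteq> A" using op by blast
    have "v \<in> A" if "v \<in> D" "dist v q < \<epsilon>" for v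
    proof -
      have "v \<in> ball q \<epsilon> \<inter> X" using that D by (auto simp: dist_commute)
      then show ?thesis using e(2) by blast
    qed
    then show "\<exists>e>0. \<forall>x'\<in>D. dist x' q < e \<longrightarrow> x' \<in> A" using e(1) by blast
  qed (use D in auto)
  moreover have "openin (top_of_set D) (D - A)"
    unfolding openin_euclidean_subtopology_iff
  proof (intro conjI ballI)
    fix q assume q: "q \<in> D - A"
    then obtain \<epsilon> where e: "\<epsilon> > 0" "ball q \<epsilon> \<inter> A = {}" using cl D by blast
    have "v \<in> D - A" if "v \<in> D" "dist v q < \<epsilon>" for v
      using that e(2) by (auto simp: dist_commute)
    then show "\<exists>e>0. \<forall>x'\<in>D. dist x' q < e \<longrightarrow> x' \<in> D - A" using e(1) by blast
  qed auto
  then have "closedin (top_of_set D) A" using D by (simp add: closedin_def)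
  ultimately have "A = {} \<or> A = D" using D connected_clopen by blast
  then show "D = A" using A(1) by blast
qed (use A in auto)

context root_geometry
begin

definition adjacent :: "(real^3) set \<Rightarrow> real^3 \<Rightarrow> real^3 \<Rightarrow> bool" where
  "adjacent C r s \<longleftrightarrow> wall C r \<and> wall C s \<and> \<not> pos_prop r s \<and> (\<exists>p\<in>P. b p r = 0 \<and> b p s = 0)"

lemma adjacent_sym: "adjacent C r s \<Longrightarrow> adjacent C s r"
  unfolding adjacent_def using pos_prop_sym by blast

lemma adjacent_corner:
  assumes "adjacent C r s"
  obtains p where "p \<in> side b P C r" "p \<in> side b P C s"
  using assms corner_in_closure[of C r s] unfolding adjacent_def side_def mirror_def by blast

lemma pos_prop_side: "pos_prop r t \<Longrightarrow> side b P C t = side b P C r"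
  by (auto simp: pos_prop_def side_def mirror_def bil)

text \<open>The corners \<open>p\<close> and \<open>p'\<close> of the side of \<open>r\<close> span its mirror, and the inequalities of \<open>s\<close> and \<open>s'\<close> force
every point of the side to be a non-negative combination of them. A further wall is strictly negative at
both corners, hence on the side.\<close>

lemma side_two_neighbours:
  assumes s: "adjacent C r s" and s': "adjacent C r s'" and n: "\<not> pos_prop s s'"
    and t: "wall C t" and v: "v \<in> side b P C r" "b v t = 0"
  shows "pos_prop r t \<or> pos_prop s t \<or> pos_prop s' t"
proof (rule ccontr)
  assume nt: "\<not> ?thesis"
  have W: "wall C r" "wall C s" "wall C s'" "\<not> pos_prop r s" "\<not> pos_prop r s'"
    using s s' unfolding adjacent_def by auto
  obtain p where p: "p \<in> P" "b p r = 0" "b p s = 0" using s unfolding adjacent_def by blast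
  obtain p' where p': "p' \<in> P" "b p' r = 0" "b p' s' = 0" using s' unfolding adjacent_def by blast
  have vv: "v \<in> P" "v \<in> closure C" "b v r = 0" using v(1) by (auto simp: side_def mirror_def)
  have ps': "b p s' < 0" by (rule corner_other_walls[OF W(1,2,4) p W(3,5) n])
  have p's: "b p' s < 0"
    using corner_other_walls[OF W(1,3,5) p' W(2,4)] n pos_prop_sym by blast
  have pt: "b p t < 0" using corner_other_walls[OF W(1,2,4) p t] nt by blast
  have p't: "b p' t < 0" using corner_other_walls[OF W(1,3,5) p' t] nt by blast
  have rp: "b r r > 0" using wall_pos[OF W(1)] .
  have "\<exists>x y z. v = x *\<^sub>R r + y *\<^sub>R p + z *\<^sub>R p'"
  proof (rule three_independent_span)
    fix x y z assume e: "x *\<^sub>R r + y *\<^sub>R p + z *\<^sub>R p' = 0"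
    have "b (x *\<^sub>R r + y *\<^sub>R p + z *\<^sub>R p') u = 0" for u by (simp add: e B.zero_left)
    then have *: "x * b r u + y * b p u + z * b p' u = 0" for u by (simp add: bil)
    have x: "x = 0" using *[of r] p(2) p'(2) rp by simp
    have z: "z = 0" using *[of s] p(3) p's x by simp
    have "y = 0" using *[of s'] p'(3) ps' x z by simp
    then show "x = 0 \<and> y = 0 \<and> z = 0" using x z by simp
  qed
  then obtain x y z where v_eq: "v = x *\<^sub>R r + y *\<^sub>R p + z *\<^sub>R p'" by blast
  have bv: "b v u = x * b r u + y * b p u + z * b p' u" for u by (simp add: v_eq bil)
  have x: "x = 0" using bv[of r] vv(3) p(2) p'(2) rp by simp
  have "z * b p' s \<le> 0" "y * b p s' \<le> 0"
    using wall_closure_nonpos[OF W(2) vv(2)] wall_closure_nonpos[OF W(3) vv(2)]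
      bv[of s] bv[of s'] x p(3) p'(3) by auto
  then have yz: "y \<ge> 0" "z \<ge> 0" using p's ps' by (simp_all add: mult_le_0_iff)
  have "y * b p t + z * b p' t = 0" using bv[of t] v(2) x by simp
  moreover have "y * b p t \<le> 0" "z * b p' t \<le> 0"
    using yz pt p't by (simp_all add: mult_nonneg_nonpos)
  ultimately have "y * b p t = 0" "z * b p' t = 0" by linarith+
  then have "v = 0" using pt p't x by (simp add: v_eq)
  then show False using P_nonzero[OF vv(1)] by simp
qed

lemma third_neighbour:
  assumes "adjacent C r s" "adjacent C r s'" "\<not> pos_prop s s'" "adjacent C r t"
  shows "pos_prop s t \<or> pos_prop s' t"
proof -
  obtain p where "p \<in> side b P C r" "p \<in> side b P C t" using adjacent_corner[OF assms(4)] by blast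
  then have "pos_prop r t \<or> pos_prop s t \<or> pos_prop s' t"
    using side_two_neighbours[OF assms(1-3), of t p] assms(4)
    by (auto simp: adjacent_def side_def mirror_def)
  then show ?thesis using assms(4) by (simp add: adjacent_def)
qed

lemma system_open: assumes S: "chamber_system C S" shows "open C"
  unfolding open_contains_ball
proof
  fix v assume v: "v \<in> C"
  then have vP: "v \<in> P" using system_mem[OF S] by blast
  obtain \<epsilon> where e: "\<epsilon> > 0" "ball v \<epsilon> \<subseteq> P"
    "\<And>t u. t \<in> R \<Longrightarrow> b v t < 0 \<Longrightarrow> u \<in> ball v \<epsilon> \<Longrightarrow> b u t < 0" using local_ball[OF vP] by metis
  have "ball v \<epsilon> \<subseteq> C"
    using e(2) e(3) system_mem[OF S] v system_roots[OF S] by blast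
  then show "\<exists>e>0. ball v e \<subseteq> C" using e(1) by blast
qed

lemma frontier_point:
  assumes S: "chamber_system C S" and v: "v \<in> P \<inter> frontier C"
  obtains t where "wall C t" "v \<in> side b P C t"
proof -
  have vC: "v \<in> closure C" "v \<notin> C" using v interior_open[OF system_open[OF S]] by (auto simp: frontier_def)
  then obtain t where t: "t \<in> S" "\<not> b v t < 0" using system_mem[OF S] v by blast
  have w: "wall C t" using S t unfolding wall_def by blast
  then have "b v t = 0" using wall_closure_nonpos[OF w vC(1)] t(2) by simp
  then show ?thesis using that w v vC by (auto simp: side_def mirror_def)
qed

lemma side_subset_frontier:
  assumes r: "wall C r" shows "side b P C r \<subseteq> P \<inter> frontier C"
proof
  fix v assume v: "v \<in> side b P C r"
  have "v \<notin> C" using wall_neg[OF r] v by (fastforce simp: side_def mirror_def)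
  then have "v \<notin> interior C" using interior_subset by blast
  then show "v \<in> P \<inter> frontier C" using v by (auto simp: side_def frontier_def)
qed

lemma side_convex:
  assumes r: "wall C r" shows "convex (side b P C r)"
proof -
  obtain S where S: "chamber_system C S" using r unfolding wall_def by blast
  have "linear (\<lambda>v. b v r)" by (rule bounded_linear.linear[OF B.bounded_linear_left])
  then have "convex ((\<lambda>v. b v r) -` {0})" by (rule convex_linear_vimage) simp
  then have "convex (mirror b r)" by (simp add: mirror_def vimage_def)
  then show ?thesis unfolding side_def
    by (intro convex_Int P_convex convex_closure system_convex[OF S])
qed

definition linked :: "(real^3) set \<Rightarrow> (real^3) set \<Rightarrow> ((real^3) \<times> (real^3)) set" where
  "linked C \<Phi> = {(r, s). r \<in> \<Phi> \<and> s \<in> \<Phi> \<and> side b P C r \<inter> side b P C s \<noteq> {}}"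

lemma linkedI: "v \<in> side b P C r \<Longrightarrow> v \<in> side b P C s \<Longrightarrow> r \<in> \<Phi> \<Longrightarrow> s \<in> \<Phi> \<Longrightarrow> (r, s) \<in> linked C \<Phi>"
  unfolding linked_def by blast

lemma linked_along:
  fixes x :: "int \<Rightarrow> real^3"
  assumes "\<And>j. m \<le> j \<Longrightarrow> j < n \<Longrightarrow> adjacent C (x j) (x (j + 1))" "\<And>j. m \<le> j \<Longrightarrow> j \<le> n \<Longrightarrow> x j \<in> \<Phi>"
  shows "m \<le> j \<Longrightarrow> j \<le> n \<Longrightarrow> (x m, x j) \<in> (linked C \<Phi>)\<^sup>*"
proof (induction j rule: int_ge_induct)
  case (step j)
  obtain v where "v \<in> side b P C (x j)" "v \<in> side b P C (x (j + 1))"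
    using adjacent_corner[OF assms(1)[of j]] step by auto
  then have "(x j, x (j + 1)) \<in> linked C \<Phi>" using assms(2)[of j] assms(2)[of "j + 1"] step by (auto intro: linkedI)
  moreover have "(x m, x j) \<in> (linked C \<Phi>)\<^sup>*" using step by simp
  ultimately show ?case by (rule rtrancl_into_rtrancl[rotated])
qed simp

text \<open>The union of the sides is connected by hypothesis \<open>reach\<close>. It is open in the boundary because near a point
of a side only mirrors through that point matter, and these belong to the root of the side or its two
neighbours. It is closed because a side passing close enough to a boundary point has its mirror through that point.\<close>

lemma sides_form_component:
  assumes W: "\<And>r. r \<in> \<Phi> \<Longrightarrow> wall C r" and r0: "r0 \<in> \<Phi>"
    and reach: "\<And>r. r \<in> \<Phi> \<Longrightarrow> (r0, r) \<in> (linked C \<Phi>)\<^sup>*"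
    and two: "\<And>r. r \<in> \<Phi> \<Longrightarrow> \<exists>s\<in>\<Phi>. \<exists>s'\<in>\<Phi>. adjacent C r s \<and> adjacent C r s' \<and> \<not> pos_prop s s'"
  shows "(\<Union>r\<in>\<Phi>. side b P C r) \<in> components (P \<inter> frontier C)"
proof -
  define A where "A = (\<Union>r\<in>\<Phi>. side b P C r)"
  obtain S where S: "chamber_system C S" using W[OF r0] unfolding wall_def by blast
  obtain v0 where v0: "v0 \<in> side b P C r0" using two[OF r0] adjacent_corner by blast
  have sub: "side b P C r \<subseteq> connected_component_set A v0" if "r \<in> \<Phi>" for r
    using reach[OF that]
  proof (induction rule: rtrancl_induct)
    case base
    show ?case using v0 convex_connected[OF side_convex[OF W[OF r0]]] r0
      by (intro connected_component_maximal) (auto simp: A_def)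
  next
    case (step y z)
    then have y: "y \<in> \<Phi>" "z \<in> \<Phi>" "side b P C y \<inter> side b P C z \<noteq> {}" by (auto simp: linked_def)
    then obtain v where v: "v \<in> side b P C y" "v \<in> side b P C z" by blast
    have "side b P C z \<subseteq> connected_component_set A v"
      using v convex_connected[OF side_convex[OF W[OF y(2)]]] y
      by (intro connected_component_maximal) (auto simp: A_def)
    moreover have "connected_component_set A v = connected_component_set A v0"
      using step.IH v by (metis connected_component_eq subsetD)
    ultimately show ?case by simp
  qed
  then have "A = connected_component_set A v0"
    using connected_component_subset[of A v0] unfolding A_def by blast
  then have conn: "connected A" using connected_connected_component by metis
  have "A \<in> components (P \<inter> frontier C)"
  proof (rule clopen_connected_is_component)
    show "A \<noteq> {}" using v0 r0 unfolding A_def by blast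
    show "A \<subseteq> P \<inter> frontier C" using side_subset_frontier W unfolding A_def by blast
    show "connected A" by (rule conn)
  next
    fix q assume "q \<in> A"
    then obtain r where r: "r \<in> \<Phi>" "q \<in> side b P C r" unfolding A_def by blast
    then have qP: "q \<in> P" by (auto simp: side_def)
    obtain \<epsilon> where e: "\<epsilon> > 0" "\<And>t u. t \<in> R \<Longrightarrow> u \<in> ball q \<epsilon> \<Longrightarrow> b u t = 0 \<Longrightarrow> b q t = 0"
      using local_ball[OF qP] by metis
    obtain s s' where s: "s \<in> \<Phi>" "s' \<in> \<Phi>" "adjacent C r s" "adjacent C r s'" "\<not> pos_prop s s'"
      using two[OF r(1)] by blast
    have "v \<in> A" if v: "v \<in> ball q \<epsilon> \<inter> (P \<inter> frontier C)" for v
    proof -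
      obtain t where t: "wall C t" "v \<in> side b P C t" using frontier_point[OF S] v by blast
      have "b q t = 0" using e(2)[OF wall_root[OF t(1)]] v t(2) by (auto simp: side_def mirror_def)
      then have "pos_prop r t \<or> pos_prop s t \<or> pos_prop s' t"
        using side_two_neighbours[OF s(3-5) t(1) r(2)] by blast
      then have "v \<in> side b P C r \<or> v \<in> side b P C s \<or> v \<in> side b P C s'"
        using t(2) pos_prop_side by blast
      then show ?thesis using r s unfolding A_def by blast
    qed
    then show "\<exists>\<epsilon>>0. ball q \<epsilon> \<inter> (P \<inter> frontier C) \<subseteq> A" using e(1) by blast
  next
    fix q assume q: "q \<in> P \<inter> frontier C - A"
    then have qP: "q \<in> P" and qC: "q \<in> closure C" by (auto simp: frontier_def)
    obtain \<epsilon> where e: "\<epsilon> > 0" "\<And>t u. t \<in> R \<Longrightarrow> u \<in> ball q \<epsilon> \<Longrightarrow> b u t = 0 \<Longrightarrow> b q t = 0"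
      using local_ball[OF qP] by metis
    have False if v: "v \<in> ball q \<epsilon>" "v \<in> A" for v
    proof -
      obtain t where t: "t \<in> \<Phi>" "v \<in> side b P C t" using v(2) unfolding A_def by blast
      have "b q t = 0" using e(2)[OF wall_root[OF W[OF t(1)]] v(1)] t(2) by (auto simp: side_def mirror_def)
      then have "q \<in> A" using t(1) qP qC unfolding A_def by (auto simp: side_def mirror_def)
      then show False using q by blast
    qed
    then show "\<exists>\<epsilon>>0. ball q \<epsilon> \<inter> A = {}" using e(1) by blast
  qed
  then show ?thesis unfolding A_def .
qed

end

section \<open>Arithmetic of the ring of integers\<close>

lemma sqrt2_irrational: "sqrt 2 \<noteq> of_rat q"
proof
  assume "sqrt 2 = of_rat q"
  then have "sqrt 2 \<in> \<rat>" by simp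
  then obtain m n :: nat where n: "n \<noteq> 0" and eq: "\<bar>sqrt 2\<bar> = real m / real n" and co: "coprime m n"
    by (rule Rats_abs_nat_div_natE)
  have "real m = sqrt 2 * real n" using eq n by simp
  then have "(real m)\<^sup>2 = 2 * (real n)\<^sup>2" by (simp add: power_mult_distrib)
  then have e: "m\<^sup>2 = 2 * n\<^sup>2" by (metis of_nat_eq_iff of_nat_mult of_nat_numeral of_nat_power)
  then have "even m" by (metis dvd_triv_left even_power zero_less_numeral)
  then obtain k where k: "m = 2 * k" by blast
  then have "n\<^sup>2 = 2 * k\<^sup>2" using e by (simp add: power2_eq_square)
  then have "even n" by (metis dvd_triv_left even_power zero_less_numeral)
  from gcd_greatest[OF \<open>even m\<close> this] show False using co by simp
qed

lemma sqrt2_coeffs: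
  assumes "of_rat a + of_rat b * sqrt 2 = (of_rat c + of_rat d * sqrt 2 :: real)"
  shows "a = c \<and> b = d"
proof -
  have e: "of_rat (b - d) * sqrt 2 = (of_rat (c - a) :: real)"
    using assms by (simp add: of_rat_diff algebra_simps)
  have "b = d"
  proof (rule ccontr)
    assume "b \<noteq> d"
    then have "sqrt 2 = of_rat ((c - a) / (b - d))"
      using e by (simp add: of_rat_divide field_simps)
    then show False using sqrt2_irrational by blast
  qed
  then show ?thesis using e by simp
qed

text \<open>The definite description in the definition of conjugation is legitimate since \<open>1\<close> and \<open>\<surd>2\<close> are linearly
independent over the rationals.\<close>

lemma gal_eq: "gal (of_rat a + of_rat b * sqrt 2) = of_rat a - of_rat b * sqrt 2"
  unfolding gal_def
  by (rule the_equality) (use sqrt2_coeffs in blast)+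

lemma F_cases:
  assumes "x \<in> F_field"
  obtains a b where "x = of_rat a + of_rat b * sqrt 2" "gal x = of_rat a - of_rat b * sqrt 2"
  using assms gal_eq unfolding F_field_def by blast

lemma F_I: "of_rat a + of_rat b * sqrt 2 \<in> F_field"
  unfolding F_field_def by blast

lemma F_add: assumes "x \<in> F_field" "y \<in> F_field"
  shows "x + y \<in> F_field" "gal (x + y) = gal x + gal y"
proof -
  obtain a b c d where *: "x = of_rat a + of_rat b * sqrt 2" "gal x = of_rat a - of_rat b * sqrt 2"
    "y = of_rat c + of_rat d * sqrt 2" "gal y = of_rat c - of_rat d * sqrt 2"
    using assms F_cases by metis
  have e: "x + y = of_rat (a + c) + of_rat (b + d) * sqrt 2" by (simp add: * of_rat_add algebra_simps)
  show "x + y \<in> F_field" unfolding e by (rule F_I)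
  show "gal (x + y) = gal x + gal y" unfolding e gal_eq by (simp add: *(1,3) gal_eq of_rat_add algebra_simps)
qed

lemma F_mult: assumes "x \<in> F_field" "y \<in> F_field"
  shows "x * y \<in> F_field" "gal (x * y) = gal x * gal y"
proof -
  obtain a b c d where *: "x = of_rat a + of_rat b * sqrt 2" "gal x = of_rat a - of_rat b * sqrt 2"
    "y = of_rat c + of_rat d * sqrt 2" "gal y = of_rat c - of_rat d * sqrt 2"
    using assms F_cases by metis
  have e: "x * y = of_rat (a * c + 2 * b * d) + of_rat (a * d + b * c) * sqrt 2"
    by (simp add: * of_rat_add of_rat_mult algebra_simps)
  show "x * y \<in> F_field" unfolding e by (rule F_I)
  show "gal (x * y) = gal x * gal y"
    unfolding e gal_eq by (simp add: *(1,3) gal_eq of_rat_add of_rat_mult algebra_simps)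
qed

lemma F_of_rat: "of_rat a \<in> F_field" "gal (of_rat a) = of_rat a"
  using F_I[of a 0] gal_eq[of a 0] by simp_all

lemma F_numeral [simp]: "0 \<in> F_field" "1 \<in> F_field" "numeral n \<in> F_field"
    "gal 0 = 0" "gal 1 = 1" "gal (numeral n) = numeral n"
  using F_of_rat[of 0] F_of_rat[of 1] F_of_rat[of "numeral n"] by simp_all

lemma F_minus: assumes "x \<in> F_field" shows "- x \<in> F_field" "gal (- x) = - gal x"
proof -
  obtain a b where *: "x = of_rat a + of_rat b * sqrt 2" "gal x = of_rat a - of_rat b * sqrt 2"
    using assms F_cases by metis
  have e: "- x = of_rat (- a) + of_rat (- b) * sqrt 2" by (simp add: * of_rat_minus)
  show "- x \<in> F_field" unfolding e by (rule F_I)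
  show "gal (- x) = - gal x" unfolding e gal_eq by (simp add: *(1) gal_eq of_rat_minus)
qed

lemma F_diff: assumes "x \<in> F_field" "y \<in> F_field"
  shows "x - y \<in> F_field" "gal (x - y) = gal x - gal y"
  using F_add[OF assms(1) F_minus(1)[OF assms(2)]] F_minus[OF assms(2)] by simp_all

lemma F_norm_rat: assumes "x \<in> F_field" shows "\<exists>q. x * gal x = of_rat q"
proof -
  obtain a b where *: "x = of_rat a + of_rat b * sqrt 2" "gal x = of_rat a - of_rat b * sqrt 2"
    using assms F_cases by metis
  have "x * gal x = of_rat (a * a - 2 * b * b)"
    by (simp add: *(1) gal_eq of_rat_diff of_rat_mult algebra_simps)
  then show ?thesis by blast
qed

lemma gal_nonzero: assumes "x \<in> F_field" "x \<noteq> 0" shows "gal x \<noteq> 0"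
proof
  assume "gal x = 0"
  obtain a b where *: "x = of_rat a + of_rat b * sqrt 2" "gal x = of_rat a - of_rat b * sqrt 2"
    using assms(1) F_cases by metis
  then have "of_rat a + of_rat b * sqrt 2 = (of_rat 0 + of_rat (2 * b) * sqrt 2 :: real)"
    using \<open>gal x = 0\<close> by (simp add: of_rat_mult)
  from sqrt2_coeffs[OF this] have "a = 0" "b = 0" by auto
  then show False using * assms(2) by simp
qed

lemma F_inverse: assumes "x \<in> F_field" shows "inverse x \<in> F_field" "gal (inverse x) = inverse (gal x)"
proof -
  have "inverse x \<in> F_field \<and> gal (inverse x) = inverse (gal x)"
  proof (cases "x = 0")
    case False
    obtain q where q: "x * gal x = of_rat q" using F_norm_rat[OF assms] by blast
    have q0: "q \<noteq> 0" using q False gal_nonzero[OF assms] by auto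
    obtain a b where "gal x = of_rat a - of_rat b * sqrt 2" using assms F_cases by metis
    then have "gal x = of_rat a + of_rat (- b) * sqrt 2" by (simp add: of_rat_minus)
    then have gF: "gal x \<in> F_field" using F_I by metis
    have "x * (of_rat (inverse q) * gal x) = of_rat (inverse q) * (x * gal x)" by simp
    also have "\<dots> = 1" unfolding q using q0 by (simp flip: of_rat_mult)
    finally have e: "inverse x = of_rat (inverse q) * gal x" by (rule inverse_unique)
    have "inverse x \<in> F_field" unfolding e by (rule F_mult(1)[OF F_of_rat(1) gF])
    moreover have "gal x * gal (inverse x) = 1"
      using F_mult(2)[OF assms \<open>inverse x \<in> F_field\<close>] False by simp
    ultimately show ?thesis using inverse_unique[of "gal x" "gal (inverse x)"] by simp
  qed auto
  then show "inverse x \<in> F_field" "gal (inverse x) = inverse (gal x)" by auto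
qed

lemma F_divide: assumes "x \<in> F_field" "y \<in> F_field"
  shows "x / y \<in> F_field" "gal (x / y) = gal x / gal y"
  using F_mult[OF assms(1) F_inverse(1)[OF assms(2)]] F_inverse[OF assms(2)]
  by (simp_all add: divide_inverse)

lemma O_I: "of_int a + of_int b * sqrt 2 \<in> O_ring"
  unfolding O_ring_def by blast

lemma gal_int: "gal (of_int a + of_int b * sqrt 2) = of_int a - of_int b * sqrt 2"
  using gal_eq[of "of_int a" "of_int b"] by simp

lemma O_cases:
  assumes "x \<in> O_ring"
  obtains a b where "x = of_int a + of_int b * sqrt 2" "gal x = of_int a - of_int b * sqrt 2"
  using assms gal_int unfolding O_ring_def by blast

lemma O_F: "x \<in> O_ring \<Longrightarrow> x \<in> F_field"
  using F_I[of "of_int _" "of_int _"] by (auto elim!: O_cases)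

lemma
  assumes "x \<in> O_ring" "y \<in> O_ring"
  shows O_add: "x + y \<in> O_ring" and O_mult: "x * y \<in> O_ring" and O_diff: "x - y \<in> O_ring"
proof -
  obtain a b c d where *: "x = of_int a + of_int b * sqrt 2" "y = of_int c + of_int d * sqrt 2"
    using assms O_cases by metis
  have e: "x + y = of_int (a + c) + of_int (b + d) * sqrt 2"
    "x * y = of_int (a * c + 2 * b * d) + of_int (a * d + b * c) * sqrt 2"
    "x - y = of_int (a - c) + of_int (b - d) * sqrt 2"
    by (simp_all add: * algebra_simps)
  show "x + y \<in> O_ring" "x * y \<in> O_ring" "x - y \<in> O_ring"
    unfolding e by (rule O_I)+
qed

lemma
  assumes "x \<in> O_ring"
  shows O_minus: "- x \<in> O_ring" and O_gal: "gal x \<in> O_ring"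
proof -
  obtain a b where *: "x = of_int a + of_int b * sqrt 2" "gal x = of_int a - of_int b * sqrt 2"
    using assms O_cases by metis
  have e: "- x = of_int (- a) + of_int (- b) * sqrt 2" "gal x = of_int a + of_int (- b) * sqrt 2"
    by (simp_all add: *(1) gal_int)
  show "- x \<in> O_ring" "gal x \<in> O_ring" unfolding e by (rule O_I)+
qed

lemma O_int [simp]: "of_int n \<in> O_ring" "0 \<in> O_ring" "1 \<in> O_ring" "numeral k \<in> O_ring"
  using O_I[of n 0] O_I[of 0 0] O_I[of 1 0] O_I[of "numeral k" 0] by simp_all

abbreviation absnorm :: "real \<Rightarrow> real" where "absnorm x \<equiv> \<bar>x * gal x\<bar>"

lemma O_norm_int: assumes "x \<in> O_ring" shows "\<exists>n. x * gal x = of_int n"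
proof -
  obtain a b where *: "x = of_int a + of_int b * sqrt 2" "gal x = of_int a - of_int b * sqrt 2"
    using assms O_cases by metis
  have "x * gal x = of_int (a * a - 2 * b * b)" by (simp add: *(1) gal_int algebra_simps)
  then show ?thesis by blast
qed

lemma O_norm_ge_1: assumes "x \<in> O_ring" "x \<noteq> 0" shows "absnorm x \<ge> 1"
proof -
  obtain n where n: "x * gal x = of_int n" using O_norm_int[OF assms(1)] by blast
  have "n \<noteq> 0" using n assms gal_nonzero O_F by force
  then show ?thesis unfolding n by linarith
qed

text \<open>The norm \<open>x * gal x\<close> is multiplicative with integral values, so it is \<open>\<plusminus> 1\<close> on units; conversely an element of
norm \<open>\<plusminus> 1\<close> is inverted by its conjugate up to sign.\<close>

lemma O_unit_iff: "O_unit u \<longleftrightarrow> u \<in> O_ring \<and> absnorm u = 1"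
proof
  assume "O_unit u"
  then obtain v where uv: "u \<in> O_ring" "v \<in> O_ring" "u * v = 1" unfolding O_unit_def by blast
  have "gal u * gal v = 1" using F_mult(2)[of u v] uv O_F by simp
  then have "absnorm u * absnorm v = 1" using uv(3)
    by (metis abs_mult abs_one mult.assoc mult.left_commute mult.right_neutral)
  moreover have "absnorm u \<ge> 1" "absnorm v \<ge> 1" using uv by (auto intro!: O_norm_ge_1)
  ultimately have "absnorm u \<le> 1"
    by (metis dual_order.trans mult_left_mono mult.right_neutral abs_ge_zero)
  then show "u \<in> O_ring \<and> absnorm u = 1" using uv \<open>absnorm u \<ge> 1\<close> by simp
next
  assume u: "u \<in> O_ring \<and> absnorm u = 1"
  then have "u * gal u = 1 \<or> u * (- gal u) = 1" by (auto simp: abs_if split: if_splits)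
  then show "O_unit u" unfolding O_unit_def using u O_gal O_minus by blast
qed

lemma unit_mult: assumes "O_unit x" "O_unit y" shows "O_unit (x * y)"
proof -
  have *: "x \<in> O_ring" "y \<in> O_ring" "absnorm x = 1" "absnorm y = 1"
    using assms by (auto simp: O_unit_iff)
  have "x * y * gal (x * y) = (x * gal x) * (y * gal y)" using * O_F by (simp add: F_mult)
  then have "\<bar>x * y * gal (x * y)\<bar> = 1" using *(3,4) by (simp only: abs_mult mult_1)
  then show ?thesis using * O_mult by (simp add: O_unit_iff)
qed

lemma unit_inv: assumes "O_unit x" shows "O_unit (inverse x)"
proof -
  obtain y where y: "x \<in> O_ring" "y \<in> O_ring" "x * y = 1" using assms unfolding O_unit_def by blast
  then have "inverse x = y" by (simp add: inverse_unique)
  then show ?thesis using y unfolding O_unit_def by (auto simp: mult.commute)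
qed

lemma unit_nonzero: "O_unit x \<Longrightarrow> x \<noteq> 0"
  by (auto simp: O_unit_def)

text \<open>Integral elements are dense in \<open>\<real>\<close>; only bounding both conjugates makes them discrete.\<close>

lemma O_bounded_finite: "finite {x \<in> O_ring. \<bar>x\<bar> \<le> B \<and> \<bar>gal x\<bar> \<le> B}"
proof -
  define N where "N = \<lceil>\<bar>B\<bar>\<rceil>"
  have N: "real_of_int N \<ge> \<bar>B\<bar>" unfolding N_def by linarith
  have "{x \<in> O_ring. \<bar>x\<bar> \<le> B \<and> \<bar>gal x\<bar> \<le> B} \<subseteq>
      (\<lambda>(a, b). of_int a + of_int b * sqrt 2) ` ({- N..N} \<times> {- N..N})"
  proof
    fix x assume x: "x \<in> {x \<in> O_ring. \<bar>x\<bar> \<le> B \<and> \<bar>gal x\<bar> \<le> B}"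
    then obtain a b where ab: "x = of_int a + of_int b * sqrt 2" "gal x = of_int a - of_int b * sqrt 2"
      using O_cases by blast
    have "\<bar>real_of_int a\<bar> \<le> B" "\<bar>real_of_int b * sqrt 2\<bar> \<le> B" using x ab by auto
    moreover have "\<bar>real_of_int b\<bar> * 1 \<le> \<bar>real_of_int b\<bar> * sqrt 2" by (intro mult_left_mono) auto
    ultimately have "\<bar>real_of_int a\<bar> \<le> N" "\<bar>real_of_int b\<bar> \<le> N" using N by (auto simp: abs_mult)
    then have "a \<in> {- N..N}" "b \<in> {- N..N}" by auto
    then show "x \<in> (\<lambda>(a, b). of_int a + of_int b * sqrt 2) ` ({- N..N} \<times> {- N..N})"
      using ab(1) by force
  qed
  then show ?thesis by (rule finite_subset) simp
qed

text \<open>Rounding both coordinates leaves a remainder \<open>c + d \<surd>2\<close> with \<open>|c|, |d| \<le> 1/2\<close>, whose norm \<open>c\<^sup>2 - 2 d\<^sup>2\<close> has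
absolute value at most \<open>1/2\<close>.\<close>

lemma O_euclid: assumes "x \<in> F_field" shows "\<exists>z\<in>O_ring. absnorm (x - z) < 1"
proof -
  obtain a b where *: "x = of_rat a + of_rat b * sqrt 2" using assms F_cases by metis
  define z :: real where "z = of_int (round a) + of_int (round b) * sqrt 2"
  define c d where "c = a - of_int (round a)" and "d = b - of_int (round b)"
  have cd: "\<bar>c\<bar> \<le> 1/2" "\<bar>d\<bar> \<le> 1/2"
    using of_int_round_abs_le[of a] of_int_round_abs_le[of b] by (auto simp: c_def d_def abs_minus_commute)
  have e: "x - z = of_rat c + of_rat d * sqrt 2" by (simp add: * z_def c_def d_def of_rat_diff algebra_simps)
  have n: "(x - z) * gal (x - z) = of_rat (c * c - 2 * (d * d))"
    unfolding e gal_eq by (simp add: of_rat_diff of_rat_mult algebra_simps)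
  have "c * c \<le> 1/4" "d * d \<le> 1/4" "c * c \<ge> 0" "d * d \<ge> 0"
    using cd abs_le_square_iff[of c "1/2"] abs_le_square_iff[of d "1/2"] by (auto simp: power2_eq_square)
  then have "\<bar>c * c - 2 * (d * d)\<bar> < 1" by linarith
  then have "absnorm (x - z) < 1"
    unfolding n abs_less_iff of_rat_minus[symmetric] by simp
  then show ?thesis using O_I[of "round a" "round b"] unfolding z_def by blast
qed

text \<open>The powers of the unit \<open>h = 1 + \<surd>2\<close> form a geometric progression; the squares have ratio \<open>h\<^sup>2 = 3 + 2 \<surd>2 < 6\<close>.\<close>

lemma O_unit_normalize:
  assumes t: "t > 0"
  shows "\<exists>u>0. O_unit u \<and> 1 \<le> u\<^sup>2 * t \<and> u\<^sup>2 * t < 6"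
proof -
  define h where "h = 1 + sqrt (2::real)"
  have h1: "h > 1" by (simp add: h_def)
  have hh: "h\<^sup>2 < 6"
  proof -
    have "sqrt 2 < 3 / (2::real)" by (rule real_less_lsqrt) (auto simp: power2_eq_square)
    moreover have "h\<^sup>2 = 3 + 2 * sqrt 2" by (simp add: h_def power2_eq_square algebra_simps)
    ultimately show ?thesis by simp
  qed
  have "gal h = 1 - sqrt 2" "h \<in> O_ring" using gal_int[of 1 1] O_I[of 1 1] by (simp_all add: h_def)
  moreover have "h * (1 - sqrt 2) = - 1" by (simp add: h_def algebra_simps)
  ultimately have unit_h: "O_unit h" by (simp add: O_unit_iff)
  have unit_pow: "O_unit (x ^ n)" if "O_unit x" for x n
    by (induction n) (use that unit_mult in \<open>auto simp: O_unit_def\<close>)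
  have unit_powi: "O_unit (h powi k)" for k
    by (cases "k \<ge> 0") (auto simp: power_int_def unit_h unit_pow unit_inv)
  define m where "m = \<lfloor>log (h\<^sup>2) t\<rfloor>"
  have h2: "h\<^sup>2 > 1" using h1 by (simp add: one_less_power)
  have "(h\<^sup>2) powr of_int m \<le> t \<and> t < (h\<^sup>2) powr (of_int m + 1)"
    using floor_log_eq_powr_iff[OF t h2, of m] by (auto simp: m_def)
  moreover have "(h\<^sup>2) powr of_int m = (h powi m)\<^sup>2"
  proof -
    have "(h\<^sup>2) powr of_int m = (h\<^sup>2) powi m" using powr_real_of_int[of "h\<^sup>2" m] h1
      by (simp add: power_int_def power_inverse)
    also have "\<dots> = (h powi m)\<^sup>2" by (simp add: power2_eq_square power_int_mult_distrib)
    finally show ?thesis .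
  qed
  moreover have "(h\<^sup>2) powr (of_int m + 1) = (h powi m)\<^sup>2 * h\<^sup>2"
    using h2 calculation(2) by (simp add: powr_add)
  ultimately have b: "(h powi m)\<^sup>2 \<le> t" "t < (h powi m)\<^sup>2 * h\<^sup>2" by auto
  have p: "h powi m > 0" using h1 by simp
  define v where "v = h powi m"
  have v: "v > 0" "v\<^sup>2 \<le> t" "t < v\<^sup>2 * h\<^sup>2" using p b by (simp_all add: v_def)
  define u where "u = inverse v"
  have "u > 0" "O_unit u" using p unit_powi unit_inv by (auto simp: u_def v_def)
  moreover have "1 \<le> u\<^sup>2 * t" using v by (simp add: u_def power_inverse field_simps)
  moreover have "u\<^sup>2 * t < h\<^sup>2" using v by (simp add: u_def power_inverse field_simps)
  ultimately show ?thesis using hh by (intro exI[of _ u]) auto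
qed

lemma O_residue_map:
  assumes "m > 0"
  shows "\<exists>\<rho> :: real \<Rightarrow> int \<times> int. finite (range \<rho>) \<and>
    (\<forall>x\<in>O_ring. \<forall>y\<in>O_ring. \<rho> x = \<rho> y \<longrightarrow> (\<exists>z\<in>O_ring. x - y = of_int m * z))"
proof -
  have "\<forall>x. \<exists>a b. x \<in> O_ring \<longrightarrow> x = of_int a + of_int b * sqrt 2" unfolding O_ring_def by blast
  then obtain f g where fg: "\<And>x. x \<in> O_ring \<Longrightarrow> x = of_int (f x) + of_int (g x) * sqrt 2" by metis
  define \<rho> where "\<rho> x = (f x mod m, g x mod m)" for x :: real
  have "range \<rho> \<subseteq> {0..<m} \<times> {0..<m}" using assms by (auto simp: \<rho>_def)
  then have "finite (range \<rho>)" by (rule finite_subset) simp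
  moreover have "\<exists>z\<in>O_ring. x - y = of_int m * z"
    if xy: "x \<in> O_ring" "y \<in> O_ring" "\<rho> x = \<rho> y" for x y
  proof -
    have "m dvd f x - f y" "m dvd g x - g y" using xy(3) by (auto simp: \<rho>_def mod_eq_dvd_iff)
    then obtain k l where kl: "f x - f y = m * k" "g x - g y = m * l" by (auto elim!: dvdE)
    have "x - y = of_int (f x - f y) + of_int (g x - g y) * sqrt 2"
      using fg[OF xy(1)] fg[OF xy(2)] by (simp add: algebra_simps)
    also have "\<dots> = of_int m * (of_int k + of_int l * sqrt 2)" unfolding kl by (simp add: algebra_simps)
    finally show ?thesis using O_I by blast
  qed
  ultimately show ?thesis by blast
qed

section \<open>Lattices with positive definite conjugate\<close>

lemma
  fixes A :: "real^'n^'n"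
  assumes "invertible A"
  shows matrix_inv_right: "A ** matrix_inv A = mat 1" and matrix_inv_left: "matrix_inv A ** A = mat 1"
  using someI_ex[OF assms[unfolded invertible_def]] unfolding matrix_inv_def by blast+

lemma homogeneous_coercive:
  fixes f :: "real^3 \<Rightarrow> real"
  assumes cont: "continuous_on UNIV f" and hom: "\<And>a x. f (a *\<^sub>R x) = a\<^sup>2 * f x"
    and pos: "\<And>x. x \<noteq> 0 \<Longrightarrow> f x > 0"
  shows "\<exists>c>0. \<forall>x. c * (norm x)\<^sup>2 \<le> f x"
proof -
  have "\<exists>x\<in>sphere 0 1. \<forall>y\<in>sphere 0 1. f x \<le> f y"
    by (rule continuous_attains_inf) (auto intro: continuous_on_subset[OF cont])
  then obtain x where x: "norm x = 1" "\<And>y. norm y = 1 \<Longrightarrow> f x \<le> f y" by auto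
  have "f x > 0" using pos[of x] x(1) by force
  moreover have "f x * (norm y)\<^sup>2 \<le> f y" for y
  proof (cases "y = 0")
    case False
    then have "f x \<le> f (inverse (norm y) *\<^sub>R y)" by (intro x(2)) simp
    then show ?thesis using False by (simp add: hom power_inverse field_simps)
  next
    case True
    then show ?thesis using hom[of 0 0] by simp
  qed
  ultimately show ?thesis by blast
qed

text \<open>The arithmetic input to all finiteness results: in the basis given by the rows of \<open>e\<close> the Gram matrix is integral
and its conjugate is positive definite.\<close>

locale arith_lattice = lorentz_cone b P for b :: "3 form" and P +
  fixes L :: "(real^3) set" and e :: "real^3^3"
  assumes basis: "O_basis L e"
    and gram_integral: "b (e $ i) (e $ j) \<in> O_ring"
    and conj_pos_def: "pos_def (\<chi> i j. gal (gram b e $ i $ j))"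
begin

definition coords :: "real^3 \<Rightarrow> real^3" where
  "coords v = matrix_inv (transpose e) *v v"

lemma inv_e: "invertible e" "invertible (transpose e)"
  using basis by (auto simp: O_basis_def transpose_invertible)

lemma transpose_e: "transpose e *v x = (\<Sum>i\<in>UNIV. x $ i *\<^sub>R e $ i)"
  by (simp add: vec_eq_iff matrix_vector_mult_def transpose_def mult.commute)

lemma coords_expand: "v = (\<Sum>i\<in>UNIV. coords v $ i *\<^sub>R e $ i)"
  by (simp flip: transpose_e add: coords_def matrix_vector_mul_assoc matrix_inv_right inv_e)

lemma coords_sum: "coords (\<Sum>i\<in>UNIV. x $ i *\<^sub>R e $ i) = x"
  by (simp only: coords_def transpose_e[symmetric] matrix_vector_mul_assoc matrix_inv_left[OF inv_e(2)]
      matrix_vector_mul_lid)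

lemma coords_lin: "coords (v + w) = coords v + coords w" "coords (v - w) = coords v - coords w" "coords (a *\<^sub>R v) = a *\<^sub>R coords v"
  by (simp_all add: coords_def matrix_vector_right_distrib matrix_vector_mult_diff_distrib
      matrix_vector_mult_scaleR)

lemma coords_eq_0: "coords v = 0 \<longleftrightarrow> v = 0"
  using coords_expand[of v] by (auto simp: coords_def)

lemma L_iff: "v \<in> L \<longleftrightarrow> (\<forall>i. coords v $ i \<in> O_ring)"
proof
  assume "v \<in> L"
  then obtain a where a: "v = (\<Sum>i\<in>UNIV. a i *\<^sub>R e $ i)" "range a \<subseteq> O_ring"
    using basis unfolding O_basis_def by blast
  then have "coords v = (\<chi> i. a i)" using coords_sum[of "\<chi> i. a i"] by simp
  then show "\<forall>i. coords v $ i \<in> O_ring" using a(2) by auto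
next
  assume "\<forall>i. coords v $ i \<in> O_ring"
  then show "v \<in> L" using coords_expand[of v] basis unfolding O_basis_def
    by (auto intro!: exI[of _ "\<lambda>i. coords v $ i"])
qed

lemma
  assumes "v \<in> L" "w \<in> L" "a \<in> O_ring"
  shows L_add: "v + w \<in> L" and L_diff: "v - w \<in> L" and L_scale: "a *\<^sub>R v \<in> L"
  using assms by (auto simp: L_iff coords_lin O_add O_diff O_mult)

lemma e_L: "e $ i \<in> L"
proof -
  have "(\<Sum>j\<in>UNIV. (axis i 1 :: real^3) $ j *\<^sub>R e $ j) = e $ i"
    by (simp add: axis_def if_distrib[of "\<lambda>x. x *\<^sub>R _"] sum.delta cong: if_cong)
  then have "coords (e $ i) = axis i 1" using coords_sum[of "axis i 1"] by simp
  then show ?thesis by (auto simp: L_iff axis_def)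
qed

lemma b_expand: "b v w = (\<Sum>i\<in>UNIV. \<Sum>j\<in>UNIV. coords v $ i * coords w $ j * b (e $ i) (e $ j))"
proof -
  have "b v w = (\<Sum>i\<in>UNIV. coords v $ i * b (e $ i) w)"
    by (subst coords_expand[of v]) (simp add: B.sum_left bil)
  moreover have "b (e $ i) w = (\<Sum>j\<in>UNIV. coords w $ j * b (e $ i) (e $ j))" for i
    by (subst coords_expand[of w]) (simp add: B.sum_right bil)
  ultimately show ?thesis by (simp add: sum_distrib_left mult.assoc)
qed

lemma b_integral: assumes "v \<in> L" "w \<in> L" shows "b v w \<in> O_ring"
  using assms gram_integral unfolding b_expand[of v w] L_iff
  by (auto simp: sum_3 intro!: O_add O_mult)

text \<open>The second real embedding: the conjugate form lives on conjugated coordinates and is positive definite there.\<close>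

definition conj_coords :: "real^3 \<Rightarrow> real^3" where
  "conj_coords v = (\<chi> i. gal (coords v $ i))"

abbreviation conj_gram :: "real^3^3" where
  "conj_gram \<equiv> (\<chi> i j. gal (gram b e $ i $ j))"

lemma gal_norm: assumes v: "v \<in> L" shows "gal (b v v) = conj_coords v \<bullet> (conj_gram *v conj_coords v)"
proof -
  have c: "coords v $ i \<in> O_ring" for i using v by (simp add: L_iff)
  show ?thesis unfolding b_expand[of v v]
    by (simp add: sum_3 inner_vec_def matrix_vector_mult_def gram_def conj_coords_def F_add F_mult
        O_F c gram_integral O_add O_mult algebra_simps)
qed

lemma conj_pos: assumes "v \<in> L" "v \<noteq> 0" shows "gal (b v v) > 0"
proof -
  have "coords v \<noteq> 0" using assms coords_eq_0 by simp
  then obtain i where i: "coords v $ i \<noteq> 0" by (auto simp: vec_eq_iff)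
  then have "conj_coords v $ i \<noteq> 0" using assms(1) gal_nonzero O_F by (simp add: conj_coords_def L_iff)
  then have "conj_coords v \<noteq> 0" by auto
  then show ?thesis using conj_pos_def gal_norm[OF assms(1)] unfolding pos_def_def by simp
qed

lemma anisotropic: "v \<in> L \<Longrightarrow> b v v = 0 \<Longrightarrow> v = 0"
  using conj_pos[of v] by force

lemma conj_cauchy_schwarz:
  assumes v: "v \<in> L" and w: "w \<in> L"
  shows "(gal (b v w))\<^sup>2 \<le> gal (b v v) * gal (b w w)"
proof (cases "w = 0")
  case False
  define z where "z = b w w *\<^sub>R v - b v w *\<^sub>R w"
  have i: "b v v \<in> O_ring" "b v w \<in> O_ring" "b w w \<in> O_ring" using b_integral v w by auto
  have z: "z \<in> L" unfolding z_def using i v w by (intro L_diff L_scale) auto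
  have "b z z = b w w * (b v v * b w w - b v w * b v w)"
    by (simp add: z_def bil sym[of w v] algebra_simps)
  then have "gal (b z z) = gal (b w w) * (gal (b v v) * gal (b w w) - gal (b v w) * gal (b v w))"
    using i by (simp add: F_mult F_diff O_F O_mult O_diff)
  moreover have "gal (b z z) \<ge> 0" using conj_pos[OF z] by (cases "z = 0") (auto simp: B.zero_left)
  ultimately show ?thesis using conj_pos[OF w False] by (simp add: zero_le_mult_iff power2_eq_square)
qed (simp add: B.zero_right)

lemma conj_coercive: "\<exists>c>0. \<forall>v\<in>L. c * (norm (conj_coords v))\<^sup>2 \<le> gal (b v v)"
proof -
  have "\<exists>c>0. \<forall>x. c * (norm x)\<^sup>2 \<le> x \<bullet> (conj_gram *v x)"
    using conj_pos_def unfolding pos_def_def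
    by (intro homogeneous_coercive)
      (auto intro!: continuous_intros matrix_vector_mult_linear_continuous_on
        simp: matrix_vector_mult_scaleR power2_eq_square)
  then show ?thesis using gal_norm by metis
qed

lemma bounded_finite: "finite {v \<in> L. norm v \<le> K \<and> gal (b v v) \<le> K}"
proof -
  obtain c where c: "c > 0" "\<And>v. v \<in> L \<Longrightarrow> c * (norm (conj_coords v))\<^sup>2 \<le> gal (b v v)"
    using conj_coercive by blast
  have "bounded_linear coords" unfolding coords_def by (rule matrix_vector_mul_bounded_linear)
  then obtain d where d: "\<And>v. norm (coords v) \<le> norm v * d" using bounded_linear.bounded by blast
  \<comment> \<open>Bounds for the coordinates and for their conjugates.\<close>
  define M where "M = max (K * \<bar>d\<bar>) (sqrt (\<bar>K\<bar> / c))"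
  define S where "S = {x \<in> O_ring. \<bar>x\<bar> \<le> M \<and> \<bar>gal x\<bar> \<le> M}"
  have "coords v \<in> (\<lambda>(x, y, z). vector [x, y, z]) ` (S \<times> S \<times> S)" if v: "v \<in> L" "norm v \<le> K" "gal (b v v) \<le> K" for v
  proof -
    have "coords v $ i \<in> S" for i
    proof -
      have "\<bar>coords v $ i\<bar> \<le> norm (coords v)" by (rule component_le_norm_cart)
      also have "\<dots> \<le> norm v * d" by (rule d)
      also have "\<dots> \<le> norm v * \<bar>d\<bar>" by (intro mult_left_mono) auto
      also have "\<dots> \<le> K * \<bar>d\<bar>" using v(2) by (intro mult_right_mono) auto
      finally have 1: "\<bar>coords v $ i\<bar> \<le> M" by (simp add: M_def)
      have "(norm (conj_coords v))\<^sup>2 \<le> \<bar>K\<bar> / c" using c(2)[OF v(1)] v(3) c(1) by (simp add: field_simps)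
      then have "norm (conj_coords v) \<le> sqrt (\<bar>K\<bar> / c)" by (rule real_le_rsqrt)
      then have "\<bar>gal (coords v $ i)\<bar> \<le> M"
        using component_le_norm_cart[of "conj_coords v" i] by (simp add: conj_coords_def M_def)
      then show ?thesis using 1 v(1) by (simp add: S_def L_iff)
    qed
    moreover have "coords v = vector [coords v $ 1, coords v $ 2, coords v $ 3]" by (simp add: vec_eq_iff forall_3)
    ultimately show ?thesis by (intro image_eqI[of _ _ "(coords v $ 1, coords v $ 2, coords v $ 3)"]) auto
  qed
  then have "coords ` {v \<in> L. norm v \<le> K \<and> gal (b v v) \<le> K} \<subseteq> (\<lambda>(x, y, z). vector [x, y, z]) ` (S \<times> S \<times> S)"
    by blast
  moreover have "finite S" unfolding S_def by (rule O_bounded_finite)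
  ultimately have "finite (coords ` {v \<in> L. norm v \<le> K \<and> gal (b v v) \<le> K})"
    by (meson finite_SigmaI finite_imageI finite_subset)
  moreover have "inj_on coords A" for A by (rule inj_onI) (metis coords_expand)
  ultimately show ?thesis by (rule finite_imageD)
qed

text \<open>This is where the class number one of the ring is used. The scalars \<open>a\<close> with \<open>a v \<in> L\<close> form a module over the
ring; one of least norm generates it by Euclidean division, and primitivity forces the generator to be a unit.\<close>

lemma primitive_scalar:
  assumes v: "primitive L v" and c: "c \<in> F_field" "c *\<^sub>R v \<in> L"
  shows "c \<in> O_ring"
proof -
  have vL: "v \<in> L" using v by (simp add: primitive_def)
  have "v \<noteq> 0"
  proof
    assume "v = 0"
    then have "v = 0 *\<^sub>R v" "\<not> O_unit 0" by (auto simp: O_unit_def)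
    then show False using v vL O_int(2) unfolding primitive_def by blast
  qed
  then obtain i where i: "coords v $ i \<noteq> 0" using coords_eq_0[of v] by (auto simp: vec_eq_iff)
  define x where "x = coords v $ i"
  have x: "x \<in> O_ring" "x \<noteq> 0" using vL i by (auto simp: x_def L_iff)
  define Q where "Q a \<longleftrightarrow> a \<in> F_field \<and> a *\<^sub>R v \<in> L \<and> a \<noteq> 0" for a
  define N where "N a = nat \<lfloor>absnorm (a * x)\<rfloor>" for a
  have N: "real (N a) = absnorm a * absnorm x" if "a \<in> F_field" "a *\<^sub>R v \<in> L" for a
  proof -
    have "a * x \<in> O_ring" using that(2) by (auto simp: L_iff coords_lin x_def)
    then obtain n where n: "(a * x) * gal (a * x) = of_int n" using O_norm_int by blast
    have "real (N a) = absnorm (a * x)" unfolding N_def n by simp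
    then show ?thesis using F_mult(2)[OF that(1) O_F[OF x(1)]] by (simp add: abs_mult)
  qed
  have x1: "absnorm x > 0" using O_norm_ge_1[OF x] by linarith
  have "Q 1" using vL \<open>v \<noteq> 0\<close> by (simp add: Q_def)
  then obtain a where a: "Q a" "\<And>a'. Q a' \<Longrightarrow> N a \<le> N a'" using ex_has_least_nat[of Q 1 N] by blast
  have aF: "a \<in> F_field" "a *\<^sub>R v \<in> L" "a \<noteq> 0" using a(1) by (auto simp: Q_def)
  have mult: "\<exists>z\<in>O_ring. a' = z * a" if a': "a' \<in> F_field" "a' *\<^sub>R v \<in> L" for a'
  proof -
    have F: "a' / a \<in> F_field" by (rule F_divide[OF a'(1) aF(1)])
    obtain z where z: "z \<in> O_ring" "absnorm (a' / a - z) < 1" using O_euclid[OF F] by blast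
    define d where "d = a' - z * a"
    have dF: "d \<in> F_field" unfolding d_def using a' aF z O_F by (intro F_diff F_mult) auto
    have dL: "d *\<^sub>R v \<in> L" using L_diff[OF a'(2) L_scale[OF aF(2) aF(2) z(1)] z(1)]
      by (simp add: d_def scaleR_diff_left)
    have dq: "d = (a' / a - z) * a" using aF(3) by (simp add: d_def field_simps)
    have qF: "a' / a - z \<in> F_field" using F z O_F F_diff by blast
    have "d = 0"
    proof (rule ccontr)
      assume "d \<noteq> 0"
      then have "N a \<le> N d" using a(2) dF dL by (simp add: Q_def)
      then have "real (N a) \<le> real (N d)" by simp
      then have "absnorm a * absnorm x \<le> absnorm d * absnorm x"
        using N[OF aF(1,2)] N[OF dF dL] by simp
      then have "absnorm a \<le> absnorm d" using x1 by simp
      moreover have "d * gal d = ((a' / a - z) * gal (a' / a - z)) * (a * gal a)"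
        unfolding dq F_mult(2)[OF qF aF(1)] by (simp add: mult_ac)
      then have "absnorm d = absnorm (a' / a - z) * absnorm a"
        by (simp only: abs_mult)
      moreover have "absnorm a > 0" using aF gal_nonzero by simp
      ultimately show False using z(2) by (simp add: not_less mult_le_cancel_right1)
    qed
    then show ?thesis using z(1) d_def by auto
  qed
  obtain z where z: "z \<in> O_ring" "1 = z * a" using mult[of 1] vL by auto
  have "v = z *\<^sub>R (a *\<^sub>R v)" using z(2) by (simp flip: z(2))
  then have "O_unit z" using v z(1) aF(2) unfolding primitive_def by blast
  then obtain y where y: "y \<in> O_ring" "z * y = 1" unfolding O_unit_def by blast
  have "a = y" using z(2) y(2) by (metis mult.assoc mult.commute mult_1)
  then have "a \<in> O_ring" using y(1) by simp
  moreover obtain w where "w \<in> O_ring" "c = w * a" using mult[OF c] by blast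
  ultimately show ?thesis using O_mult by blast
qed

end

section \<open>Finiteness of roots\<close>

context arith_lattice
begin

abbreviation D :: real where "D \<equiv> det (gram b e)"

lemma b_basis: "b y v = (\<Sum>i\<in>UNIV. coords y $ i * b (e $ i) v)"
  by (subst coords_expand[of y]) (simp add: B.sum_left bil)

lemma gram_co: "gram b e *v coords v = (\<chi> i. b (e $ i) v)"
proof -
  have "b (e $ i) v = (\<Sum>j\<in>UNIV. coords v $ j * b (e $ i) (e $ j))" for i
    by (subst coords_expand[of v]) (simp add: B.sum_right bil)
  then show ?thesis by (simp add: vec_eq_iff matrix_vector_mult_def gram_def mult.commute)
qed

lemma D_nonzero: "D \<noteq> 0"
proof
  assume "D = 0"
  then have "\<not> invertible (gram b e)" by (simp add: invertible_det_nz)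
  then obtain x where x: "gram b e *v x = 0" "x \<noteq> 0"
    using matrix_left_invertible_ker[of "gram b e"] invertible_left_inverse[of "gram b e"] by blast
  define v where "v = (\<Sum>i\<in>UNIV. x $ i *\<^sub>R e $ i)"
  have cv: "coords v = x" by (simp add: v_def coords_sum)
  have "b (e $ i) v = 0" for i using gram_co[of v] x(1) cv by (simp add: vec_eq_iff)
  then have "v = 0" by (intro nondegenerate) (subst b_basis, simp)
  then show False using cv x(2) coords_eq_0[of v] by simp
qed

lemma det_integral: "(\<And>i j. A $ i $ j \<in> O_ring) \<Longrightarrow> det (A :: real^3^3) \<in> O_ring"
  unfolding det_3 by (intro O_add O_diff O_mult)

lemma D_integral: "D \<in> O_ring"
  by (rule det_integral) (simp add: gram_def gram_integral)

lemma root_L: "root b L t \<Longrightarrow> t \<in> L"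
  by (simp add: root_def primitive_def)

lemma root_divides:
  assumes t: "root b L t" and v: "v \<in> L"
  shows "2 * b t v / b t t \<in> O_ring"
proof (rule primitive_scalar)
  show "primitive L t" using t by (simp add: root_def)
  have tL: "t \<in> L" using root_L[OF t] .
  show "2 * b t v / b t t \<in> F_field"
    using b_integral[OF tL v] b_integral[OF tL tL] by (intro F_divide F_mult O_F) auto
  have "reflection b t v \<in> L" using t v by (auto simp: root_def)
  then have "v - reflection b t v \<in> L" using L_diff[OF v _ O_int(2)] by blast
  then show "(2 * b t v / b t t) *\<^sub>R t \<in> L" by (simp add: reflection_def)
qed

text \<open>The products \<open>2 b t v / b t t\<close> are integral, so Cramer's rule shows that \<open>(2 D / b t t) t\<close> has integral coordinates.\<close>

lemma root_norm_divides:
  assumes t: "root b L t" shows "2 * D / b t t \<in> O_ring"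
proof (rule primitive_scalar)
  have tL: "t \<in> L" using root_L[OF t] .
  have pos: "b t t > 0" using t by (simp add: root_def)
  show "primitive L t" using t by (simp add: root_def)
  show "2 * D / b t t \<in> F_field"
    using b_integral[OF tL tL] D_integral by (intro F_divide F_mult O_F) auto
  define c where "c i = 2 * b t (e $ i) / b t t" for i
  have c: "c i \<in> O_ring" for i unfolding c_def by (rule root_divides[OF t e_L])
  have "coords t $ k * D = (b t t / 2) * det (\<chi> i j. if j = k then c i else gram b e $ i $ j)" for k
  proof -
    have "b (e $ i) t = (b t t / 2) * c i" for i using pos by (simp add: c_def sym)
    then have g: "gram b e *v coords t = (b t t / 2) *\<^sub>R (\<chi> i. c i)" by (simp add: gram_co vec_eq_iff)
    have "det (\<chi> i j. if j = k then ((b t t / 2) *\<^sub>R (\<chi> i. c i)) $ i else gram b e $ i $ j)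
        = (b t t / 2) * det (\<chi> i j. if j = k then c i else gram b e $ i $ j)"
      using exhaust_3[of k] by (auto simp: det_3 algebra_simps)
    then show ?thesis using cramer_lemma[of k "gram b e" "coords t", unfolded g] by (simp only:)
  qed
  then have "2 * D / b t t * coords t $ k = det (\<chi> i j. if j = k then c i else gram b e $ i $ j)" for k
    using pos by (simp add: field_simps)
  moreover have "det (\<chi> i j. if j = k then c i else gram b e $ i $ j) \<in> O_ring" for k :: 3
    by (rule det_integral) (simp add: c gram_def gram_integral)
  ultimately show "(2 * D / b t t) *\<^sub>R t \<in> L" by (simp add: L_iff coords_lin)
qed

definition norm_bound :: real where "norm_bound = 4 * absnorm D"

text \<open>Every root has such a multiple by a positive unit, and both real embeddings of its norm are bounded.\<close>

definition normal_root :: "real^3 \<Rightarrow> bool" where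
  "normal_root t \<longleftrightarrow> root b L t \<and> b t t < 6 \<and> gal (b t t) \<le> norm_bound"

lemma root_norm_bound:
  assumes t: "root b L t" shows "b t t * gal (b t t) \<le> norm_bound"
proof -
  have tL: "t \<in> L" using root_L[OF t] .
  have pos: "b t t > 0" using t by (simp add: root_def)
  define z where "z = 2 * D / b t t"
  have z: "z \<in> O_ring" "z \<noteq> 0" using root_norm_divides[OF t] D_nonzero pos by (auto simp: z_def)
  have i: "b t t \<in> O_ring" using b_integral tL by blast
  have "b t t * z = 2 * D" using pos by (simp add: z_def)
  then have "gal (b t t) * gal z = 2 * gal D"
    using F_mult(2)[OF O_F[OF i] O_F[OF z(1)]] F_mult(2)[OF F_numeral(3) O_F[OF D_integral]] by simp
  then have "(b t t * gal (b t t)) * (z * gal z) = 4 * (D * gal D)"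
  proof -
    have "(b t t * gal (b t t)) * (z * gal z) = (b t t * z) * (gal (b t t) * gal z)"
      by (simp only: mult_ac)
    then show ?thesis unfolding \<open>b t t * z = 2 * D\<close> \<open>gal (b t t) * gal z = 2 * gal D\<close> by simp
  qed
  then have "\<bar>(b t t * gal (b t t)) * (z * gal z)\<bar> = \<bar>4 * (D * gal D)\<bar>" by (rule arg_cong)
  also have "\<dots> = norm_bound" unfolding norm_bound_def abs_mult[of 4] by (simp only: abs_numeral)
  finally have "absnorm (b t t) * absnorm z = norm_bound" unfolding abs_mult[of "b t t * gal (b t t)"] .
  moreover have "absnorm (b t t) * 1 \<le> absnorm (b t t) * absnorm z"
    using O_norm_ge_1[OF z] by (intro mult_left_mono) auto
  ultimately show ?thesis by linarith
qed

lemma reflection_scale: "u \<noteq> 0 \<Longrightarrow> reflection b (u *\<^sub>R t) v = reflection b t v"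
  by (simp add: reflection_def bil)

lemma root_unit_scale:
  assumes t: "root b L t" and u: "O_unit u"
  shows "root b L (u *\<^sub>R t)"
proof -
  have u0: "u \<noteq> 0" using unit_nonzero[OF u] .
  have uO: "u \<in> O_ring" "inverse u \<in> O_ring" using u unit_inv[OF u] by (auto simp: O_unit_iff)
  have tL: "t \<in> L" using root_L[OF t] .
  have "primitive L (u *\<^sub>R t)"
    unfolding primitive_def
  proof (intro conjI notI)
    show "u *\<^sub>R t \<in> L" by (rule L_scale[OF tL tL uO(1)])
    assume "\<exists>a\<in>O_ring. \<not> O_unit a \<and> (\<exists>w\<in>L. u *\<^sub>R t = a *\<^sub>R w)"
    then obtain a w where a: "a \<in> O_ring" "\<not> O_unit a" "w \<in> L" "u *\<^sub>R t = a *\<^sub>R w" by blast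
    have "t = inverse u *\<^sub>R (u *\<^sub>R t)" using u0 by simp
    also have "\<dots> = a *\<^sub>R (inverse u *\<^sub>R w)" unfolding a(4) by simp
    finally show False using t a L_scale[OF a(3) a(3) uO(2)] unfolding root_def primitive_def by blast
  qed
  moreover have "b (u *\<^sub>R t) (u *\<^sub>R t) > 0" 
  proof -
    have "b (u *\<^sub>R t) (u *\<^sub>R t) = u\<^sup>2 * b t t" by (simp add: bil power2_eq_square)
    then show ?thesis using t u0 by (simp add: root_def)
  qed
  moreover have "reflection b (u *\<^sub>R t) = reflection b t" using reflection_scale[OF u0] by blast
  ultimately show ?thesis using t by (simp add: root_def)
qed

lemma exists_normal_root:
  assumes t: "root b L t" shows "\<exists>u>0. O_unit u \<and> normal_root (u *\<^sub>R t)"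
proof -
  have tL: "t \<in> L" using root_L[OF t] .
  have pos: "b t t > 0" using t by (simp add: root_def)
  obtain u where u: "u > 0" "O_unit u" "1 \<le> u\<^sup>2 * b t t" "u\<^sup>2 * b t t < 6"
    using O_unit_normalize[OF pos] by blast
  let ?n = "b (u *\<^sub>R t) (u *\<^sub>R t)"
  have r: "root b L (u *\<^sub>R t)" by (rule root_unit_scale[OF t u(2)])
  have n: "?n = u\<^sup>2 * b t t" by (simp add: bil power2_eq_square)
  have "gal ?n > 0" by (rule conj_pos[OF root_L[OF r]]) (use r in \<open>auto simp: root_def B.zero_left\<close>)
  then have "1 * gal ?n \<le> ?n * gal ?n" using u(3) n by (intro mult_right_mono) auto
  then have "gal ?n \<le> norm_bound" using root_norm_bound[OF r] by simp
  then show ?thesis using u n r unfolding normal_root_def by auto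
qed

text \<open>Up to a positive factor this is the form with the sign changed on the line through \<open>q\<close>, which is positive definite.\<close>

lemma coercive_at:
  assumes q: "q \<in> P"
  shows "\<exists>c>0. \<forall>t. c * (norm t)\<^sup>2 \<le> b t t * (- b q q) + 2 * (b t q)\<^sup>2"
proof -
  have qq: "b q q < 0" using P_neg[OF q] .
  let ?f = "\<lambda>t. b t t * (- b q q) + 2 * (b t q)\<^sup>2"
  have pos: "?f t > 0" if t: "t \<noteq> 0" for t
  proof -
    define z where "z = (- b q q) *\<^sub>R t + b t q *\<^sub>R q"
    have z: "b q z = 0" by (simp add: z_def bil sym[of q t])
    have zz: "b z z = (- b q q) * (b t t * (- b q q) + (b t q)\<^sup>2)"
      by (simp add: z_def bil sym[of q t] algebra_simps power2_eq_square)
    show ?thesis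
    proof (cases "b t q = 0")
      case True
      then have "b t t > 0" using perp_pos[OF qq _ t] sym by metis
      then show ?thesis using True qq by (simp add: mult_pos_neg)
    next
      case False
      have "b z z \<ge> 0" using perp_nonneg[OF qq z] .
      then have "b t t * (- b q q) + (b t q)\<^sup>2 \<ge> 0" using qq unfolding zz by (simp add: zero_le_mult_iff mult_le_0_iff)
      moreover have "(b t q)\<^sup>2 > 0" using False by simp
      ultimately show ?thesis by linarith
    qed
  qed
  show ?thesis
  proof (rule homogeneous_coercive[OF _ _ pos])
    show "continuous_on UNIV ?f" by (intro continuous_intros B.continuous_on)
    show "?f (a *\<^sub>R x) = a\<^sup>2 * ?f x" for a x by (simp add: bil algebra_simps power2_eq_square)
  qed
qed

text \<open>If the mirror of \<open>t\<close> passes near \<open>q\<close>, then \<open>b t q\<close> is small compared to the length of \<open>t\<close>, so the definite form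
of \<open>coercive_at\<close> is almost a multiple of \<open>b t t\<close> and bounds that length. The conjugate coordinates are bounded by the
conjugate norm.\<close>

lemma normal_roots_near_finite:
  assumes q: "q \<in> P"
  shows "\<exists>\<epsilon>>0. finite {t. normal_root t \<and> (\<exists>u\<in>ball q \<epsilon>. b u t = 0)}"
proof -
  have qq: "b q q < 0" using P_neg[OF q] .
  obtain c where c: "c > 0" "\<And>t. c * (norm t)\<^sup>2 \<le> b t t * (- b q q) + 2 * (b t q)\<^sup>2"
    using coercive_at[OF q] by blast
  obtain k where k: "k > 0" "\<And>x y. norm (b x y) \<le> norm x * norm y * k"
    using B.pos_bounded by blast
  \<comment> \<open>Chosen so that twice the square of the product with \<open>q\<close> is at most half of the coercivity bound.\<close>
  define \<epsilon> where "\<epsilon> = sqrt c / (2 * k)"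
  have e: "\<epsilon> > 0" using c k by (simp add: \<epsilon>_def)
  define K where "K = max norm_bound (sqrt (2 * (6 * (- b q q)) / c))"
  have "t \<in> {v \<in> L. norm v \<le> K \<and> gal (b v v) \<le> K}"
    if t: "normal_root t" and u: "u \<in> ball q \<epsilon>" "b u t = 0" for t u
  proof -
    have "b t q = b t (q - u)" using u(2) by (simp add: bil sym[of t u])
    then have "\<bar>b t q\<bar> \<le> norm t * norm (q - u) * k" using k(2)[of t "q - u"] by simp
    also have "\<dots> \<le> norm t * \<epsilon> * k"
      using u(1) k(1) by (intro mult_right_mono mult_left_mono) (auto simp: dist_norm)
    also have "\<dots> = norm t * (sqrt c / 2)" using k(1) by (simp add: \<epsilon>_def)
    finally have "(b t q)\<^sup>2 \<le> (norm t * (sqrt c / 2))\<^sup>2"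
      using power_mono[of "\<bar>b t q\<bar>" _ 2] by simp
    also have "\<dots> = (norm t)\<^sup>2 * c / 4" using c(1) by (simp add: power_mult_distrib power_divide)
    finally have "2 * (b t q)\<^sup>2 \<le> (norm t)\<^sup>2 * c / 2" by simp
    moreover have "b t t * (- b q q) \<le> 6 * (- b q q)"
      using t qq unfolding normal_root_def by (intro mult_right_mono) auto
    ultimately have "c * (norm t)\<^sup>2 \<le> 6 * (- b q q) + (norm t)\<^sup>2 * c / 2" using c(2)[of t] by linarith
    then have "(norm t)\<^sup>2 \<le> 2 * (6 * (- b q q)) / c" using c(1) by (simp add: field_simps)
    then have "norm t \<le> K" unfolding K_def using real_le_rsqrt by fastforce
    then show ?thesis using t root_L unfolding normal_root_def K_def by auto
  qed
  then have "{t. normal_root t \<and> (\<exists>u\<in>ball q \<epsilon>. b u t = 0)} \<subseteq> {v \<in> L. norm v \<le> K \<and> gal (b v v) \<le> K}"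
    by blast
  then show ?thesis using e bounded_finite finite_subset by blast
qed

lemma roots_locally_finite:
  assumes q: "q \<in> P"
  shows "\<exists>U. open U \<and> q \<in> U \<and> (\<forall>t\<in>{r. root b L r}. \<forall>u\<in>U. b u t = 0 \<longrightarrow> b q t = 0)"
proof -
  obtain \<epsilon> where e: "\<epsilon> > 0" "finite {t. normal_root t \<and> (\<exists>u\<in>ball q \<epsilon>. b u t = 0)}"
    using normal_roots_near_finite[OF q] by blast
  define Z where "Z = {t. normal_root t \<and> (\<exists>u\<in>ball q \<epsilon>. b u t = 0) \<and> b q t \<noteq> 0}"
  have "finite Z" using e(2) by (rule rev_finite_subset) (auto simp: Z_def)
  \<comment> \<open>Remove the finitely many mirrors that come close to but miss the point.\<close>
  define U where "U = ball q \<epsilon> \<inter> (\<Inter>t\<in>Z. {u. b u t \<noteq> 0})"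
  have "open {u. b u t \<noteq> 0}" for t
    by (intro open_Collect_neq continuous_intros B.continuous_on)
  then have "open U" unfolding U_def using \<open>finite Z\<close> by (intro open_Int open_INT) auto
  moreover have "q \<in> U" using e(1) by (auto simp: U_def Z_def)
  moreover have "b q t = 0" if t: "root b L t" "u \<in> U" "b u t = 0" for t u
  proof (rule ccontr)
    assume n: "b q t \<noteq> 0"
    obtain a where a: "a > 0" "normal_root (a *\<^sub>R t)" using exists_normal_root[OF t(1)] by blast
    have "a *\<^sub>R t \<in> Z" using a t n by (auto simp: Z_def U_def bil)
    then have "b u (a *\<^sub>R t) \<noteq> 0" using t(2) by (auto simp: U_def)
    then show False using t(3) by (simp add: bil)
  qed
  ultimately show ?thesis by blast
qed

lemma primitive_image:
  assumes f: "linear f" "inj f" "f ` L = L" and s: "primitive L s"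
  shows "primitive L (f s)"
  unfolding primitive_def
proof (intro conjI notI)
  show "f s \<in> L" using s f(3) unfolding primitive_def by blast
  assume "\<exists>a\<in>O_ring. \<not> O_unit a \<and> (\<exists>w\<in>L. f s = a *\<^sub>R w)"
  then obtain a w where a: "a \<in> O_ring" "\<not> O_unit a" "w \<in> L" "f s = a *\<^sub>R w" by blast
  obtain w' where w': "w' \<in> L" "w = f w'" using a(3) f(3) by blast
  have "f s = f (a *\<^sub>R w')" using a(4) w'(2) linear_cmul[OF f(1)] by simp
  then have "s = a *\<^sub>R w'" using f(2) by (simp add: inj_eq)
  then show False using s a w' unfolding primitive_def by blast
qed

lemma root_image:
  assumes f: "linear f" "bij f" "f ` L = L" "\<And>x y. b (f x) (f y) = b x y" and s: "root b L s"
  shows "root b L (f s)"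
proof -
  have "primitive L (f s)"
    using primitive_image[OF f(1) bij_is_inj[OF f(2)] f(3)] s by (simp add: root_def)
  moreover have "b (f s) (f s) > 0" using s f(4) by (simp add: root_def)
  moreover have "reflection b (f s) ` L = L"
  proof -
    have r: "reflection b (f s) (f v) = f (reflection b s v)" for v
      by (simp add: reflection_def f(4) linear_diff[OF f(1)] linear_cmul[OF f(1)])
    have "reflection b (f s) ` L = reflection b (f s) ` f ` L" using f(3) by simp
    also have "\<dots> = f ` reflection b s ` L" by (simp add: image_image r)
    also have "\<dots> = L" using s f(3) by (simp add: root_def)
    finally show ?thesis .
  qed
  ultimately show ?thesis by (simp add: root_def)
qed

lemma reflection_root:
  assumes r: "root b L r" and s: "root b L s"
  shows "root b L (reflection b r s)"
proof (rule root_image[OF _ _ _ _ s])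
  have pos: "b r r \<noteq> 0" using r by (simp add: root_def)
  show lin: "linear (reflection b r)"
    by (rule linearI) (simp_all add: reflection_def bil algebra_simps add_divide_distrib scaleR_add_left)
  have inv: "reflection b r (reflection b r v) = v" for v
    using pos by (simp add: reflection_def bil algebra_simps flip: scaleR_add_left)
  then show "bij (reflection b r)" by (rule involuntory_imp_bij)
  show "reflection b r ` L = L" using r by (simp add: root_def)
  show "b (reflection b r x) (reflection b r y) = b x y" for x y
    using pos by (simp add: reflection_def bil sym[of x r] sym[of y r] field_simps)
qed

end

sublocale arith_lattice \<subseteq> root_geometry b P "{r. root b L r}"
proof
  show "r \<in> {r. root b L r} \<Longrightarrow> b r r > 0" for r by (simp add: root_def)
  show "r \<in> {r. root b L r} \<Longrightarrow> s \<in> {r. root b L r} \<Longrightarrow> reflection b r s \<in> {r. root b L r}" for r s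
    using reflection_root by simp
qed (rule roots_locally_finite)

section \<open>Isometries carrying one corner to another\<close>

abbreviation det3 :: "real^3 \<Rightarrow> real^3 \<Rightarrow> real^3 \<Rightarrow> real" where
  "det3 r s p \<equiv> det (vector [r, s, p] :: real^3^3)"

lemma det_linear_image:
  assumes f: "linear f"
  shows "det3 (f r) (f s) (f p) = det (matrix f) * det3 r s p"
proof -
  have m: "matrix f *v v = f v" for v using matrix_vector_mul(2)[OF f] by metis
  have "(\<Sum>k\<in>UNIV. v $ k * transpose (matrix f) $ k $ j) = f v $ j" for v j
    by (simp flip: m add: matrix_vector_mult_def transpose_def mult.commute)
  then have "(vector [f r, f s, f p] :: real^3^3) = vector [r, s, p] ** transpose (matrix f)"
    by (simp add: vec_eq_iff forall_3 matrix_matrix_mult_def)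
  then show ?thesis by (simp add: det_mul)
qed

context arith_lattice
begin

definition gram2 :: "real^3 \<Rightarrow> real^3 \<Rightarrow> real" where
  "gram2 r s = b r r * b s s - (b r s)\<^sup>2"

text \<open>The cross product of the linear forms \<open>b r\<close> and \<open>b s\<close>, written in the basis \<open>e\<close>: an integral vector orthogonal to
\<open>r\<close> and \<open>s\<close> which depends polynomially on their coordinates.\<close>

definition corner_vec :: "real^3 \<Rightarrow> real^3 \<Rightarrow> real^3" where
  "corner_vec r s = (\<Sum>i\<in>UNIV. cross3 (gram b e *v coords r) (gram b e *v coords s) $ i *\<^sub>R e $ i)"

lemma coords_corner_vec: "coords (corner_vec r s) = cross3 (gram b e *v coords r) (gram b e *v coords s)"
  by (simp add: corner_vec_def coords_sum)

lemma b_inner: "b v w = coords v \<bullet> (gram b e *v coords w)"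
  unfolding gram_co by (subst b_basis) (simp add: inner_vec_def)

lemma transpose_gram: "transpose (gram b e) = gram b e"
  by (simp add: transpose_def gram_def vec_eq_iff sym)

lemma b_corner_vec: "b v (corner_vec r s) = D * (coords v \<bullet> cross3 (coords r) (coords s))"
  using cross_matrix_mult[of "gram b e" "coords r" "coords s"]
  by (simp add: b_inner coords_corner_vec transpose_gram)

lemma corner_vec_perp: "b (corner_vec r s) r = 0" "b (corner_vec r s) s = 0"
  using b_corner_vec[of r r s] b_corner_vec[of s r s]
  by (simp_all add: sym[of "corner_vec r s"] dot_cross_self)

lemma corner_vec_triple: "coords (corner_vec r s) \<bullet> cross3 (coords r) (coords s) = gram2 r s"
  unfolding coords_corner_vec dot_cross gram2_def
  by (simp add: b_inner[symmetric] inner_commute[of "gram b e *v _"] power2_eq_square sym[of s r])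

lemma corner_vec_norm: "b (corner_vec r s) (corner_vec r s) = D * gram2 r s"
  by (simp add: b_corner_vec corner_vec_triple)

lemma gram_mv_integral: assumes "v \<in> L" shows "(gram b e *v coords v) $ i \<in> O_ring"
  using b_integral[OF e_L assms] by (simp add: gram_co)

lemma cross_integral:
  assumes "\<And>i. x $ i \<in> O_ring" "\<And>i. y $ i \<in> O_ring" shows "cross3 x y $ i \<in> O_ring"
  using exhaust_3[of i] by (auto simp: cross3_def intro!: O_diff O_mult assms)

lemma corner_vec_L: "r \<in> L \<Longrightarrow> s \<in> L \<Longrightarrow> corner_vec r s \<in> L"
  unfolding L_iff coords_corner_vec by (intro allI cross_integral gram_mv_integral) (simp_all add: L_iff)

lemma gram2_integral: "r \<in> L \<Longrightarrow> s \<in> L \<Longrightarrow> gram2 r s \<in> O_ring"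
  unfolding gram2_def power2_eq_square by (intro O_diff O_mult b_integral)

lemma det_corner_vec: "det3 r s (corner_vec r s) = gram2 r s * det e"
proof -
  have m: "vector [r, s, t] = (vector [coords r, coords s, coords t] :: real^3^3) ** e" for t
  proof -
    have row: "(\<Sum>k\<in>UNIV. coords v $ k * e $ k $ j) = v $ j" for v j
      by (subst (2) coords_expand[of v]) simp
    show ?thesis by (simp add: vec_eq_iff forall_3 matrix_matrix_mult_def row)
  qed
  have "det3 (coords r) (coords s) (coords (corner_vec r s))
      = coords (corner_vec r s) \<bullet> cross3 (coords r) (coords s)"
    unfolding dot_cross_det by (simp add: det_3 algebra_simps)
  then show ?thesis by (simp add: m det_mul corner_vec_triple)
qed

text \<open>The denominator \<open>D * gram2 r s\<close> depends only on the Gram matrix of \<open>r\<close> and \<open>s\<close>, and all three coefficients are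
integral if \<open>r\<close>, \<open>s\<close> and \<open>v\<close> are in \<open>L\<close>.\<close>

lemma corner_expand:
  assumes \<Delta>: "gram2 r s \<noteq> 0"
  shows "(D * gram2 r s) *\<^sub>R v = (D * (b v r * b s s - b v s * b r s)) *\<^sub>R r
    + (D * (b v s * b r r - b v r * b r s)) *\<^sub>R s + b v (corner_vec r s) *\<^sub>R corner_vec r s"
proof -
  let ?p = "corner_vec r s"
  have "\<exists>x y z. v = x *\<^sub>R r + y *\<^sub>R s + z *\<^sub>R ?p"
    using \<Delta> D_nonzero by (intro corner_span) (auto simp: gram2_def[symmetric] corner_vec_norm corner_vec_perp)
  then obtain x y z where v: "v = x *\<^sub>R r + y *\<^sub>R s + z *\<^sub>R ?p" by blast
  have "b v r * b s s - b v s * b r s = x * gram2 r s" "b v s * b r r - b v r * b r s = y * gram2 r s"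
    by (simp_all add: v bil corner_vec_perp sym[of s r] gram2_def algebra_simps power2_eq_square)
  moreover have "b v ?p = z * (D * gram2 r s)"
    by (simp add: v bil corner_vec_norm sym[of r ?p] sym[of s ?p] corner_vec_perp)
  ultimately show ?thesis by (simp add: v scaleR_add_right mult_ac)
qed

text \<open>The expansion \<open>corner_expand\<close> with \<open>r\<close>, \<open>s\<close> and \<open>corner_vec r s\<close> replaced by \<open>r'\<close>, \<open>s'\<close> and \<open>corner_vec r' s'\<close>.\<close>

definition corner_map :: "real^3 \<Rightarrow> real^3 \<Rightarrow> real^3 \<Rightarrow> real^3 \<Rightarrow> real^3 \<Rightarrow> real^3" where
  "corner_map r s r' s' v = inverse (D * gram2 r s) *\<^sub>R
    ((D * (b v r * b s s - b v s * b r s)) *\<^sub>R r'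
    + (D * (b v s * b r r - b v r * b r s)) *\<^sub>R s' + b v (corner_vec r s) *\<^sub>R corner_vec r' s')"

lemma corner_map_linear: "linear (corner_map r s r' s')"
  by (rule linearI) (simp_all add: corner_map_def bil algebra_simps)

lemma corner_map_id: assumes "gram2 r s \<noteq> 0" shows "corner_map r s r s v = v"
proof -
  have "D * gram2 r s \<noteq> 0" using assms D_nonzero by simp
  from left_inverse[OF this] show ?thesis
    unfolding corner_map_def corner_expand[OF assms, symmetric] by (simp only: scaleR_scaleR scaleR_one)
qed

text \<open>The map moves \<open>v\<close> by a combination of \<open>r' - r\<close>, \<open>s' - s\<close> and \<open>corner_vec r' s' - corner_vec r s\<close>. All three are
divisible by the denominator of the coefficients, the third because the cross product respects congruences.\<close>

lemma corner_map_lattice: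
  assumes L: "r \<in> L" "s \<in> L" "r' \<in> L" "s' \<in> L" and \<Delta>: "gram2 r s \<noteq> 0"
    and cong: "r' - r = (D * gram2 r s) *\<^sub>R l" "s' - s = (D * gram2 r s) *\<^sub>R l'" "l \<in> L" "l' \<in> L"
    and v: "v \<in> L"
  shows "corner_map r s r' s' v \<in> L"
proof -
  let ?q = "D * gram2 r s" and ?G = "gram b e"
  have q: "?q \<noteq> 0" using \<Delta> D_nonzero by simp
  \<comment> \<open>The quotient of the difference of the two corner vectors by the modulus.\<close>
  define l3 where "l3 = (\<Sum>i\<in>UNIV. (cross3 (?G *v coords l) (?G *v coords s') + cross3 (?G *v coords r) (?G *v coords l')) $ i *\<^sub>R e $ i)"
  have l3: "l3 \<in> L"
    unfolding L_iff l3_def coords_sum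
    using L cong by (auto intro!: O_add cross_integral gram_mv_integral)
  have "coords (corner_vec r' s') - coords (corner_vec r s)
      = cross3 (?G *v (coords r' - coords r)) (?G *v coords s') + cross3 (?G *v coords r) (?G *v (coords s' - coords s))"
    by (simp add: coords_corner_vec matrix_vector_mult_diff_distrib cross3_simps forall_3)
  also have "\<dots> = ?q *\<^sub>R coords l3"
    unfolding coords_lin(2)[symmetric] cong(1,2) coords_lin(3) l3_def coords_sum
    by (simp add: matrix_vector_mult_scaleR cross_mult_left cross_mult_right scaleR_add_right)
  finally have "coords (corner_vec r' s' - corner_vec r s - ?q *\<^sub>R l3) = 0" by (simp add: coords_lin)
  then have p: "corner_vec r' s' - corner_vec r s = ?q *\<^sub>R l3" by (simp add: coords_eq_0)
  define x y z where "x = D * (b v r * b s s - b v s * b r s)"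
    and "y = D * (b v s * b r r - b v r * b r s)" and "z = b v (corner_vec r s)"
  have O: "x \<in> O_ring" "y \<in> O_ring" "z \<in> O_ring"
    unfolding x_def y_def z_def using L v corner_vec_L D_integral
    by (auto intro!: O_mult O_diff b_integral)
  have "corner_map r s r' s' v - v = corner_map r s r' s' v - corner_map r s r s v"
    using corner_map_id[OF \<Delta>] by simp
  also have "\<dots> = inverse ?q *\<^sub>R (x *\<^sub>R (r' - r) + y *\<^sub>R (s' - s) + z *\<^sub>R (corner_vec r' s' - corner_vec r s))"
    by (simp add: corner_map_def x_def y_def z_def algebra_simps)
  also have "\<dots> = x *\<^sub>R l + y *\<^sub>R l' + z *\<^sub>R l3"
    unfolding cong(1,2) p using q by (simp add: scaleR_add_right mult_ac)
  finally have "corner_map r s r' s' v = v + (x *\<^sub>R l + y *\<^sub>R l' + z *\<^sub>R l3)" by (simp add: algebra_simps)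
  then show ?thesis using O v cong l3 L_add[OF _ _ O_int(2)] L_scale by (metis (full_types))
qed

lemma corner_map_on_corner:
  assumes \<Delta>: "gram2 r s \<noteq> 0"
  shows "corner_map r s r' s' r = r'" "corner_map r s r' s' s = s'"
    "corner_map r s r' s' (corner_vec r s) = corner_vec r' s'"
proof -
  have q: "D * gram2 r s \<noteq> 0" using \<Delta> D_nonzero by simp
  have "b r r * b s s - b r s * b r s = gram2 r s" by (simp add: gram2_def power2_eq_square)
  moreover have "inverse D * inverse (gram2 r s) * (D * gram2 r s) = 1"
    using \<Delta> D_nonzero by (simp add: field_simps)
  ultimately show "corner_map r s r' s' r = r'" "corner_map r s r' s' s = s'"
    "corner_map r s r' s' (corner_vec r s) = corner_vec r' s'"
    using q by (simp_all add: corner_map_def sym[of s r] sym[of r "corner_vec r s"] sym[of s "corner_vec r s"]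
        corner_vec_perp corner_vec_norm mult.commute[of "b s s"])
qed

lemma corner_map_isometry:
  assumes \<Delta>: "gram2 r s \<noteq> 0" and g: "b r' r' = b r r" "b s' s' = b s s" "b r' s' = b r s"
  shows "b (corner_map r s r' s' v) (corner_map r s r' s' w) = b v w"
proof -
  have g2: "gram2 r' s' = gram2 r s" by (simp add: gram2_def g)
  have "b (corner_map r s r' s' v) (corner_map r s r' s' w)
      = b (corner_map r s r s v) (corner_map r s r s w)"
    by (simp add: corner_map_def bil g g2 corner_vec_norm corner_vec_perp sym[of s r] sym[of s' r']
        sym[of r "corner_vec r s"] sym[of s "corner_vec r s"]
        sym[of r' "corner_vec r' s'"] sym[of s' "corner_vec r' s'"])
  then show ?thesis by (simp add: corner_map_id[OF \<Delta>])
qed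

lemma corner_map_inverse:
  assumes \<Delta>: "gram2 r s \<noteq> 0" and g: "b r' r' = b r r" "b s' s' = b s s" "b r' s' = b r s"
  shows "corner_map r' s' r s (corner_map r s r' s' v) = v"
proof -
  let ?f = "corner_map r s r' s'"
  have "b (?f v) r' = b v r" "b (?f v) s' = b v s" "b (?f v) (corner_vec r' s') = b v (corner_vec r s)"
    using corner_map_isometry[OF \<Delta> g, of v r] corner_map_isometry[OF \<Delta> g, of v s]
      corner_map_isometry[OF \<Delta> g, of v "corner_vec r s"] corner_map_on_corner[OF \<Delta>, of r' s'] by simp_all
  moreover have "gram2 r' s' = gram2 r s" by (simp add: gram2_def g)
  ultimately have "corner_map r' s' r s (?f v) = corner_map r s r s v"
    by (simp add: corner_map_def[of r' s'] corner_map_def[of r s r s] g)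
  then show ?thesis using corner_map_id[OF \<Delta>] by simp
qed

lemma corner_map_det:
  assumes \<Delta>: "gram2 r s \<noteq> 0" and g: "b r' r' = b r r" "b s' s' = b s s" "b r' s' = b r s"
  shows "det (matrix (corner_map r s r' s')) = 1"
proof -
  let ?f = "corner_map r s r' s'"
  from det_linear_image[OF corner_map_linear, of r s r' s' r s "corner_vec r s"]
  have "gram2 r' s' * det e = gram2 r s * det e * det (matrix ?f)"
    by (simp add: corner_map_on_corner[OF \<Delta>] det_corner_vec mult.commute)
  moreover have "gram2 r' s' = gram2 r s" by (simp add: gram2_def g)
  moreover have "det e \<noteq> 0" using inv_e(1) by (simp add: invertible_det_nz)
  ultimately show ?thesis using \<Delta> by simp
qed

lemma corner_automorphism:
  assumes L: "r \<in> L" "s \<in> L" "r' \<in> L" "s' \<in> L" and \<Delta>: "gram2 r s \<noteq> 0"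
    and g: "b r' r' = b r r" "b s' s' = b s s" "b r' s' = b r s"
    and cong: "r' - r = (D * gram2 r s) *\<^sub>R l" "s' - s = (D * gram2 r s) *\<^sub>R l'" "l \<in> L" "l' \<in> L"
    and cone: "(corner_vec r s \<in> P \<and> corner_vec r' s' \<in> P) \<or> (- corner_vec r s \<in> P \<and> - corner_vec r' s' \<in> P)"
  shows "automorphism b P L (corner_map r s r' s')"
proof -
  let ?f = "corner_map r s r' s'" and ?h = "corner_map r' s' r s"
  have g2: "gram2 r' s' = gram2 r s" by (simp add: gram2_def g)
  then have \<Delta>': "gram2 r' s' \<noteq> 0" using \<Delta> by simp
  have hf: "?h (?f v) = v" for v by (rule corner_map_inverse[OF \<Delta> g])
  have fh: "?f (?h v) = v" for v by (rule corner_map_inverse[OF \<Delta>' g[symmetric]])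
  have bij: "bij ?f" by (rule o_bij[of ?h]) (auto simp: hf fh)
  have lin: "linear ?f" by (rule corner_map_linear)
  have iso: "b (?f x) (?f y) = b x y" for x y by (rule corner_map_isometry[OF \<Delta> g])
  have iso': "b (?h x) (?h y) = b x y" for x y by (rule corner_map_isometry[OF \<Delta>' g[symmetric]])
  have fL: "?f v \<in> L" if "v \<in> L" for v by (rule corner_map_lattice[OF L \<Delta> cong that])
  have hL: "?h v \<in> L" if "v \<in> L" for v
  proof (rule corner_map_lattice[OF L(3,4,1,2) \<Delta>' _ _ _ _ that])
    show "r - r' = (D * gram2 r' s') *\<^sub>R (- l)" "s - s' = (D * gram2 r' s') *\<^sub>R (- l')"
      by (simp_all only: g2 scaleR_minus_right cong(1,2)[symmetric]) simp_all
    show "- l \<in> L" "- l' \<in> L" using L_scale[OF cong(3,3), of "- 1"] L_scale[OF cong(4,4), of "- 1"]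
      O_minus[OF O_int(3)] by simp_all
  qed
  have "?f ` L = L" using fL hL fh by (metis image_subset_iff image_iff subsetI subset_antisym)
  moreover obtain p where p: "p \<in> P" "?f p \<in> P"
    using cone corner_map_on_corner(3)[OF \<Delta>, of r' s'] linear_neg[OF lin, of "corner_vec r s"] by metis
  have P: "?f v \<in> P \<longleftrightarrow> v \<in> P" for v
    using P_iff[OF p(1), of v] P_iff[OF p(2), of "?f v"] iso by simp
  then have "?f ` P = P" using fh by (metis image_subset_iff image_iff subsetI subset_antisym)
  ultimately show ?thesis unfolding automorphism_def using lin bij iso by blast
qed

lemma gram2_pos_corner_vec:
  assumes \<Delta>: "gram2 r s > 0" and p: "p \<in> P" "b p r = 0" "b p s = 0"
  shows "\<exists>z. z \<noteq> 0 \<and> corner_vec r s = z *\<^sub>R p"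
proof -
  have pp: "b p p < 0" using P_neg[OF p(1)] .
  have \<Delta>': "b r r * b s s - (b r s)\<^sup>2 \<noteq> 0" using \<Delta> by (simp add: gram2_def)
  obtain x y z where v: "corner_vec r s = x *\<^sub>R r + y *\<^sub>R s + z *\<^sub>R p"
    using corner_span[OF \<Delta>' _ p(2,3)] pp by fastforce
  have "b (corner_vec r s) r = x * b r r + y * b r s" "b (corner_vec r s) s = x * b r s + y * b s s"
    by (simp_all add: v bil p sym[of s r])
  then have e: "x * b r r + y * b r s = 0" "x * b r s + y * b s s = 0" by (simp_all add: corner_vec_perp)
  from gram_kernel[OF \<Delta>' e] have "x = 0" "y = 0" .
  moreover have "corner_vec r s \<noteq> 0"
  proof
    assume "corner_vec r s = 0"
    then show False using corner_vec_norm[of r s] \<Delta> D_nonzero by (simp add: B.zero_left)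
  qed
  ultimately show ?thesis using v by auto
qed

text \<open>Dividing by a non-unit strictly lowers the absolute norm of \<open>b w w\<close>, a positive integer, so a multiple of least
norm is primitive.\<close>

lemma primitive_on_line:
  assumes v: "v \<in> L" "v \<noteq> 0"
  shows "\<exists>p. primitive L p \<and> (\<exists>a. a \<noteq> 0 \<and> p = a *\<^sub>R v)"
proof -
  define Q where "Q w \<longleftrightarrow> w \<in> L \<and> (\<exists>a. a \<noteq> 0 \<and> w = a *\<^sub>R v)" for w
  define N where "N w = nat \<lfloor>absnorm (b w w)\<rfloor>" for w
  have N: "real (N w) = absnorm (b w w)" if "w \<in> L" for w
  proof -
    obtain n where n: "b w w * gal (b w w) = of_int n" using O_norm_int b_integral \<open>w \<in> L\<close> by blast
    show ?thesis unfolding N_def n by simp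
  qed
  have "Q v" unfolding Q_def using v(1) by (auto intro!: exI[of _ 1])
  then obtain p where p: "Q p" "\<And>w. Q w \<Longrightarrow> N p \<le> N w" using ex_has_least_nat[of Q v N] by blast
  then obtain a where pL: "p \<in> L" and a: "a \<noteq> 0" "p = a *\<^sub>R v" unfolding Q_def by blast
  have "primitive L p"
    unfolding primitive_def
  proof (intro conjI notI)
    show "p \<in> L" by (rule pL)
    assume "\<exists>c\<in>O_ring. \<not> O_unit c \<and> (\<exists>w\<in>L. p = c *\<^sub>R w)"
    then obtain c w where c: "c \<in> O_ring" "\<not> O_unit c" and w: "w \<in> L" "p = c *\<^sub>R w" by blast
    have p0: "p \<noteq> 0" using a v(2) by simp
    then have c0: "c \<noteq> 0" and w0: "w \<noteq> 0" using w(2) by auto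
    have "w = (inverse c * a) *\<^sub>R v" using w(2) a(2) c0 by (metis scaleR_scaleR left_inverse scaleR_one)
    then have "Q w" unfolding Q_def using w(1) a(1) c0 by (metis mult_eq_0_iff nonzero_imp_inverse_nonzero)
    then have "real (N p) \<le> real (N w)" using p(2) by simp
    then have le: "absnorm (b p p) \<le> absnorm (b w w)" using N pL w(1) by simp
    have i: "b w w \<in> F_field" using b_integral w(1) O_F by blast
    have "b p p = c * (c * b w w)" by (simp add: w(2) bil)
    then have "b p p * gal (b p p) = (c * gal c) * (c * gal c) * (b w w * gal (b w w))"
      using i O_F[OF c(1)] by (simp add: F_mult mult_ac)
    then have eq: "absnorm (b p p) = absnorm c * absnorm c * absnorm (b w w)"
      by (simp only: abs_mult)
    have c1: "absnorm c > 1" using O_norm_ge_1[OF c(1) c0] c O_unit_iff by force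
    have "b w w \<noteq> 0" using anisotropic w(1) w0 by blast
    then have w1: "absnorm (b w w) > 0" using gal_nonzero i by simp
    have "1 * 1 < absnorm c * absnorm c" using c1 by (intro mult_strict_mono) auto
    then have "1 * absnorm (b w w) < absnorm c * absnorm c * absnorm (b w w)"
      using w1 by (intro mult_strict_right_mono) auto
    then show False using le eq by simp
  qed
  then show ?thesis using a by blast
qed

text \<open>First the Gram matrix of consecutive vectors is made constant: its entries are integral and bounded in both
embeddings. The modulus \<open>D * gram2\<close> is then fixed, and the coordinates fall into finitely many residue classes.\<close>

lemma corner_pigeonhole:
  fixes y :: "nat \<Rightarrow> real^3"
  assumes y: "\<And>n. normal_root (y n)" and pos: "\<And>n. gram2 (y n) (y (Suc n)) > 0"
  shows "\<exists>i m l l'. i < m \<and> K \<le> m \<and> b (y m) (y m) = b (y i) (y i) \<and>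
    b (y (Suc m)) (y (Suc m)) = b (y (Suc i)) (y (Suc i)) \<and> b (y m) (y (Suc m)) = b (y i) (y (Suc i)) \<and>
    l \<in> L \<and> l' \<in> L \<and> y m - y i = (D * gram2 (y i) (y (Suc i))) *\<^sub>R l \<and>
    y (Suc m) - y (Suc i) = (D * gram2 (y i) (y (Suc i))) *\<^sub>R l'"
proof -
  have yL: "y n \<in> L" for n using y root_L unfolding normal_root_def by blast
  have yp: "b (y n) (y n) > 0" "b (y n) (y n) < 6" "gal (b (y n) (y n)) \<le> norm_bound" for n
    using y[of n] unfolding normal_root_def root_def by auto
  have yg: "gal (b (y n) (y n)) > 0" for n
    by (rule conj_pos[OF yL]) (use yp(1)[of n] in \<open>auto simp: B.zero_left\<close>)
  define M where "M = max 6 norm_bound"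
  define S where "S = {x \<in> O_ring. \<bar>x\<bar> \<le> M \<and> \<bar>gal x\<bar> \<le> M}"
  have finS: "finite S" unfolding S_def by (rule O_bounded_finite)
  have S1: "b (y n) (y n) \<in> S" for n
    using yp[of n] yg[of n] b_integral[OF yL yL, of n n] unfolding S_def M_def by auto
  have S2: "b (y n) (y (Suc n)) \<in> S" for n
  proof -
    have "(b (y n) (y (Suc n)))\<^sup>2 \<le> b (y n) (y n) * b (y (Suc n)) (y (Suc n))"
      using pos[of n] by (simp add: gram2_def)
    also have "\<dots> \<le> 6 * 6" using yp[of n] yp[of "Suc n"] by (intro mult_mono) auto
    finally have "\<bar>b (y n) (y (Suc n))\<bar> \<le> 6" using abs_le_square_iff[of _ "6::real"] by (simp add: power2_eq_square)
    moreover have "(gal (b (y n) (y (Suc n))))\<^sup>2 \<le> norm_bound * norm_bound"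
      using order_trans[OF conj_cauchy_schwarz[OF yL yL] mult_mono[OF yp(3) yp(3)]]
        yg less_imp_le order_trans[OF less_imp_le[OF yg] yp(3)] by blast
    then have "\<bar>gal (b (y n) (y (Suc n)))\<bar> \<le> norm_bound"
      using abs_le_square_iff[of _ "norm_bound"] yp(3)[of 0] yg[of 0] by (simp add: power2_eq_square)
    ultimately show ?thesis using b_integral[OF yL yL, of n "Suc n"] unfolding S_def M_def by auto
  qed
  define g where "g n = (b (y n) (y n), b (y (Suc n)) (y (Suc n)), b (y n) (y (Suc n)))" for n
  have "range g \<subseteq> S \<times> S \<times> S" using S1 S2 by (auto simp: g_def)
  then have "finite (range g)" using finS finite_subset by blast
  then obtain n0 where n0: "infinite {n. g n = g n0}" using pigeonhole_infinite[of UNIV g] by auto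
  define J where "J = {n. g n = g n0}"
  define q where "q = D * gram2 (y n0) (y (Suc n0))"
  have gJ: "gram2 (y n) (y (Suc n)) = gram2 (y n0) (y (Suc n0))" if "n \<in> J" for n
    using that by (simp add: J_def g_def gram2_def)
  have q: "q \<in> O_ring" "q \<noteq> 0" unfolding q_def using pos[of n0] D_nonzero D_integral gram2_integral yL
    by (auto intro: O_mult)
  obtain k where k: "q * gal q = of_int k" using O_norm_int[OF q(1)] by blast
  have k0: "k \<noteq> 0" using k q gal_nonzero[OF O_F[OF q(1)]] by auto
  have dq: "\<exists>z'\<in>O_ring. of_int \<bar>k\<bar> * z = q * z'" if "z \<in> O_ring" for z
  proof -
    have "of_int \<bar>k\<bar> * z = q * (gal q * (of_int (sgn k) * z))"
      using k by (simp add: abs_sgn[of k])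
    then show ?thesis using O_mult O_gal[OF q(1)] that O_int(1) by blast
  qed
  obtain \<rho> :: "real \<Rightarrow> int \<times> int" where \<rho>: "finite (range \<rho>)"
    "\<And>x y. x \<in> O_ring \<Longrightarrow> y \<in> O_ring \<Longrightarrow> \<rho> x = \<rho> y \<Longrightarrow> \<exists>z\<in>O_ring. x - y = of_int \<bar>k\<bar> * z"
    using O_residue_map[of "\<bar>k\<bar>"] k0 by auto
  have cong: "\<exists>l\<in>L. v - w = q *\<^sub>R l" if v: "v \<in> L" "w \<in> L" "\<And>i. \<rho> (coords v $ i) = \<rho> (coords w $ i)" for v w
  proof -
    have "\<forall>i. \<exists>z. z \<in> O_ring \<and> coords v $ i - coords w $ i = q * z"
      using \<rho>(2) dq v unfolding L_iff by metis
    then obtain z where z: "\<And>i. z i \<in> O_ring" "\<And>i. coords v $ i - coords w $ i = q * z i" by metis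
    define l where "l = inverse q *\<^sub>R (v - w)"
    have "coords l $ i = z i" for i using z(2)[of i] q(2) by (simp add: l_def coords_lin field_simps)
    then show ?thesis using z(1) q(2) by (intro bexI[of _ l]) (auto simp: L_iff l_def)
  qed
  define h where "h n = (\<rho> (coords (y n) $ 1), \<rho> (coords (y n) $ 2), \<rho> (coords (y n) $ 3),
    \<rho> (coords (y (Suc n)) $ 1), \<rho> (coords (y (Suc n)) $ 2), \<rho> (coords (y (Suc n)) $ 3))" for n
  let ?R = "range \<rho>"
  have "h ` J \<subseteq> ?R \<times> ?R \<times> ?R \<times> ?R \<times> ?R \<times> ?R" by (auto simp: h_def)
  then have "finite (h ` J)" using \<rho>(1) by (meson finite_SigmaI finite_subset)
  then obtain i where i: "i \<in> J" "infinite {n \<in> J. h n = h i}"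
    using pigeonhole_infinite[of J h] n0 unfolding J_def by blast
  obtain m where m: "m \<in> J" "h m = h i" "m > max i K"
    using i(2) unfolding infinite_nat_iff_unbounded by blast
  have "\<rho> (coords (y m) $ j) = \<rho> (coords (y i) $ j)"
    "\<rho> (coords (y (Suc m)) $ j) = \<rho> (coords (y (Suc i)) $ j)" for j
    using m(2) exhaust_3[of j] by (auto simp: h_def)
  then obtain l l' where l: "l \<in> L" "y m - y i = q *\<^sub>R l"
    and l': "l' \<in> L" "y (Suc m) - y (Suc i) = q *\<^sub>R l'"
    using cong[OF yL yL] by metis
  have "g m = g i" using m(1) i(1) by (simp add: J_def)
  moreover have "q = D * gram2 (y i) (y (Suc i))" unfolding q_def gJ[OF i(1)] ..
  ultimately show ?thesis using m(3) l l'
    by (intro exI[of _ i] exI[of _ m] exI[of _ l] exI[of _ l']) (simp add: g_def)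
qed

end

section \<open>Neighbouring walls\<close>

context arith_lattice
begin

lemma bounds_iff_wall:
  assumes "chamber b P L C" shows "bounds b P L C r \<longleftrightarrow> wall C r"
proof -
  have ne: "C \<noteq> {}" using assms in_components_nonempty unfolding chamber_def by blast
  have "C \<subseteq> P - (\<Union>r\<in>{r. root b L r}. mirror b r)"
    using assms in_components_subset unfolding chamber_def by blast
  then have av: "\<forall>t\<in>{r. root b L r}. C \<inter> mirror b t = {}" by blast
  have "simple_system b P L C S \<longleftrightarrow> chamber_system C S" for S
    unfolding simple_system_def chamber_system_def using assms ne av
    by (simp only: subset_iff mem_Collect_eq Ball_def) auto
  then show ?thesis unfolding bounds_def wall_def by simp
qed

lemma bounds_chamber: "bounds b P L C r \<Longrightarrow> chamber b P L C"
  unfolding bounds_def simple_system_def by blast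

lemma nonpos_not_pos_prop: "b r r > 0 \<Longrightarrow> b r s \<le> 0 \<Longrightarrow> \<not> pos_prop r s"
  by (auto simp: pos_prop_def bil mult_le_0_iff)

text \<open>The Gram determinant is non-negative by the bound on the normalized product. If it vanished, the lattice
vector \<open>(b s s) r - (b r s) s\<close> would be isotropic, hence zero, and \<open>r\<close>, \<open>s\<close> would be opposite. Once it is positive,
\<open>r\<close> and \<open>s\<close> span a definite plane, so the orthogonal vector \<open>corner_vec r s\<close> must carry the negative direction.\<close>

lemma neighbours_meet:
  assumes r: "wall C r" and s: "wall C s" and rs: "b r s \<le> 0" and np: "normalized_product b r s \<ge> -1"
  shows "gram2 r s > 0" "adjacent C r s"
proof -
  have rp: "b r r > 0" and sp: "b s s > 0" using r s wall_pos by auto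
  have rL: "r \<in> L" and sL: "s \<in> L" using wall_root[OF r] wall_root[OF s] root_L by auto
  have "- sqrt (b r r * b s s) \<le> b r s"
    using np rp sp by (simp add: normalized_product_def pos_le_divide_eq)
  then have "\<bar>b r s\<bar> \<le> sqrt (b r r * b s s)" using rs by simp
  then have "(b r s)\<^sup>2 \<le> (sqrt (b r r * b s s))\<^sup>2" using power_mono[of "\<bar>b r s\<bar>" _ 2] by simp
  then have ge: "gram2 r s \<ge> 0" using rp sp by (simp add: gram2_def)
  have "gram2 r s \<noteq> 0"
  proof
    assume g: "gram2 r s = 0"
    define z where "z = b s s *\<^sub>R r - b r s *\<^sub>R s"
    have zL: "z \<in> L" unfolding z_def using L_diff[OF L_scale L_scale] b_integral rL sL O_int(2) by metis
    have "b z z = b s s * gram2 r s"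
      by (simp add: z_def bil sym[of s r] gram2_def algebra_simps power2_eq_square)
    then have "z = 0" using anisotropic zL g by simp
    obtain w where w: "w \<in> C" using wall_nonempty[OF r] by blast
    have "b w z = b s s * b w r - b r s * b w s" by (simp add: z_def bil)
    moreover have "b s s * b w r < 0" using sp wall_neg[OF r w] by (simp add: mult_pos_neg)
    moreover have "b r s * b w s \<ge> 0" using rs wall_neg[OF s w] by (simp add: mult_nonpos_nonpos)
    ultimately show False using \<open>z = 0\<close> by (simp add: B.zero_right)
  qed
  then show g: "gram2 r s > 0" using ge by simp
  let ?p = "corner_vec r s"
  have p0: "b ?p ?p \<noteq> 0" using g D_nonzero by (simp add: corner_vec_norm)
  have "b ?p ?p < 0"
  proof (rule ccontr)
    assume "\<not> b ?p ?p < 0"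
    then have pp: "b ?p ?p > 0" using p0 by simp
    obtain w where w: "w \<in> P" using P_nonempty by blast
    obtain x y z where v: "w = x *\<^sub>R r + y *\<^sub>R s + z *\<^sub>R ?p"
      using corner_span[of r s ?p w] g p0 corner_vec_perp by (auto simp: gram2_def)
    have "b w w = (x * x * b r r + 2 * x * y * b r s + y * y * b s s) + z * z * b ?p ?p"
      by (simp add: v bil corner_vec_perp sym[of r ?p] sym[of s ?p] sym[of s r] algebra_simps)
    moreover have "b r r * (x * x * b r r + 2 * x * y * b r s + y * y * b s s) = (x * b r r + y * b r s)\<^sup>2 + y\<^sup>2 * gram2 r s"
      by (simp add: gram2_def algebra_simps power2_eq_square)
    moreover have "(x * b r r + y * b r s)\<^sup>2 + y\<^sup>2 * gram2 r s \<ge> 0" using g by simp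
    ultimately have "b w w \<ge> 0" using rp pp by (metis add_nonneg_nonneg less_imp_le mult_nonneg_nonneg zero_le_mult_iff zero_le_square not_le)
    then show False using P_neg[OF w] by simp
  qed
  then have "?p \<in> P \<or> - ?p \<in> P" by (rule P_or_minus)
  then have "\<exists>p\<in>P. b p r = 0 \<and> b p s = 0"
    using corner_vec_perp[of r s] by (metis B.minus_left neg_0_equal_iff_equal)
  then show "adjacent C r s" unfolding adjacent_def using r s nonpos_not_pos_prop[OF rp rs] by blast
qed

lemma adjacent_scale:
  assumes "adjacent C r s" "pos_prop r r'" "root b L r'"
  shows "adjacent C r' s"
proof -
  have "wall C r'" using assms wall_scale unfolding adjacent_def by blast
  moreover have "\<not> pos_prop r' s" using assms pos_prop_trans unfolding adjacent_def by blast
  ultimately show ?thesis using assms(1) pos_prop_prod_zero[OF assms(2)] unfolding adjacent_def by blast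
qed

section \<open>Automorphisms of the lattice\<close>

lemma
  assumes "automorphism b P L f"
  shows automorphism_linear: "linear f" and automorphism_bij: "bij f" and automorphism_L: "f ` L = L"
    and automorphism_isometry: "b (f x) (f y) = b x y" and automorphism_P: "f ` P = P"
  using assms unfolding automorphism_def by auto

lemma automorphism_inv:
  assumes "automorphism b P L f" shows "automorphism b P L (inv f)"
proof -
  note f = automorphism_linear[OF assms] automorphism_bij[OF assms] automorphism_L[OF assms]
    automorphism_P[OF assms]
  have ff: "f (inv f x) = x" "inv f (f x) = x" for x
    using f(2) by (simp_all add: bij_is_surj surj_f_inv_f bij_is_inj)
  have "linear (inv f)" by (rule inj_linear_imp_inv_linear[OF f(1) bij_is_inj[OF f(2)]])
  moreover have "inv f ` L = L" "inv f ` P = P"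
    using f(3,4) image_inv_f_f[OF bij_is_inj[OF f(2)]] by metis+
  moreover have "b (inv f x) (inv f y) = b x y" for x y
    using automorphism_isometry[OF assms, of "inv f x" "inv f y"] by (simp add: ff)
  ultimately show ?thesis unfolding automorphism_def using bij_imp_bij_inv[OF f(2)] by simp
qed

lemma automorphism_root: "automorphism b P L f \<Longrightarrow> root b L s \<Longrightarrow> root b L (f s)"
  by (rule root_image) (auto simp: automorphism_def)

lemma automorphism_roots:
  assumes "automorphism b P L f" shows "f ` {r. root b L r} = {r. root b L r}"
proof -
  have "f (inv f x) = x" for x
    using automorphism_bij[OF assms] by (simp add: bij_is_surj surj_f_inv_f)
  then show ?thesis
    using automorphism_root[OF assms] automorphism_root[OF automorphism_inv[OF assms]]
    by (metis (mono_tags, lifting) image_iff mem_Collect_eq subsetI subset_antisym image_subset_iff)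
qed

lemma automorphism_wall:
  assumes "automorphism b P L f" "wall C r" shows "wall (f ` C) (f r)"
  by (rule wall_image) (fact automorphism_bij[OF assms(1)] automorphism_isometry[OF assms(1)]
    automorphism_P[OF assms(1)] automorphism_roots[OF assms(1)] assms(2))+

lemma automorphism_adjacent:
  assumes f: "automorphism b P L f" and "f ` C = C" and rs: "adjacent C r s"
  shows "adjacent C (f r) (f s)"
proof -
  obtain p where p: "p \<in> P" "b p r = 0" "b p s = 0" using rs unfolding adjacent_def by blast
  have "f p \<in> P" using p(1) automorphism_P[OF f] by blast
  moreover have "\<not> pos_prop (f r) (f s)"
  proof
    assume "pos_prop (f r) (f s)"
    from pos_prop_linear[OF automorphism_linear[OF automorphism_inv[OF f]] this]
    have "pos_prop r s" using automorphism_bij[OF f] by (simp add: bij_is_inj)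
    then show False using rs unfolding adjacent_def by blast
  qed
  moreover have "wall C (f r)" "wall C (f s)"
    using automorphism_wall[OF f, of C r] automorphism_wall[OF f, of C s] assms(2) rs
    by (simp_all add: adjacent_def)
  moreover have "b (f p) (f r) = 0" "b (f p) (f s) = 0" using p by (simp_all add: automorphism_isometry[OF f])
  ultimately show ?thesis unfolding adjacent_def by blast
qed

lemma automorphism_side:
  assumes f: "automorphism b P L f" and C: "f ` C = C" and v: "v \<in> side b P C r"
  shows "f v \<in> side b P C (f r)"
proof -
  have "f ` closure C \<subseteq> closure (f ` C)"
    by (rule closure_linear_image_subset[OF automorphism_linear[OF f]])
  then have "f v \<in> closure C" using v C by (auto simp: side_def)
  moreover have "f v \<in> P" using v automorphism_P[OF f] by (auto simp: side_def)
  ultimately show ?thesis using v automorphism_isometry[OF f] by (auto simp: side_def mirror_def)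
qed

section \<open>Orientation of consecutive corners\<close>

text \<open>Both determinants are compared with that of \<open>(r, s, t)\<close>. The coefficient of \<open>p\<close> in \<open>t\<close> is positive, because
\<open>b p t\<close> and \<open>b p p\<close> are negative; likewise for \<open>p'\<close> in \<open>r\<close>.\<close>

lemma orientation_step:
  assumes rs: "adjacent C r s" and st: "adjacent C s t" and rt: "\<not> pos_prop r t"
    and p: "p \<in> P" "b p r = 0" "b p s = 0" and p': "p' \<in> P" "b p' s = 0" "b p' t = 0"
  shows "\<exists>c>0. det3 s t p' = c * det3 r s p"
proof -
  have W: "wall C r" "wall C s" "wall C t" "\<not> pos_prop r s" "\<not> pos_prop s t"
    using rs st by (auto simp: adjacent_def)
  have pt: "b p t < 0" by (rule corner_other_walls[OF W(1,2,4) p W(3) rt W(5)])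
  have p'r: "b p' r < 0"
    using corner_other_walls[OF W(2,3,5) p' W(1)] W(4) rt pos_prop_sym by blast
  have pp: "b p p < 0" "b p' p' < 0" using P_neg p(1) p'(1) by auto
  obtain x y z where t: "t = x *\<^sub>R r + y *\<^sub>R s + z *\<^sub>R p"
    using corner_span[OF less_imp_neq[OF walls_gram_pos[OF W(1,2,4) p], symmetric], of p t] pp p by auto
  obtain x' y' z' where r: "r = x' *\<^sub>R s + y' *\<^sub>R t + z' *\<^sub>R p'"
    using corner_span[OF less_imp_neq[OF walls_gram_pos[OF W(2,3,5) p'], symmetric], of p' r] pp p' by auto
  have "b p t = z * b p p" "b p' r = z' * b p' p'"
    by (subst t, simp add: bil p, subst r, simp add: bil p')
  then have z: "z > 0" "z' > 0" using pt p'r pp by (auto simp: mult_less_0_iff)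
  have "det3 r s (x *\<^sub>R r + y *\<^sub>R s + z *\<^sub>R p) = z * det3 r s p"
    for r s p :: "real^3" and x y z by (simp add: det_3 algebra_simps)
  then have "det3 r s t = z * det3 r s p"
    "det3 s t r = z' * det3 s t p'"
    using t r by metis+
  moreover have "det3 s t r = det3 r s t"
    by (simp add: det_3 algebra_simps)
  ultimately have "det3 s t p' = (z / z') * det3 r s p"
    using z by (simp add: field_simps)
  then show ?thesis using z by (intro exI[of _ "z / z'"]) simp
qed

text \<open>The determinant of \<open>(r, s, corner_vec r s)\<close> is a positive multiple of \<open>det e\<close> at every corner, so the corner
vector is on the same side of the cone throughout a chain exactly because the orientation is constant.\<close>

lemma corner_vec_cone_step:
  assumes rs: "adjacent C r s" and st: "adjacent C s t" and rt: "\<not> pos_prop r t"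
    and g: "gram2 r s > 0" "gram2 s t > 0" and cv: "c *\<^sub>R corner_vec r s \<in> P" "c = 1 \<or> c = -1"
  shows "c *\<^sub>R corner_vec s t \<in> P"
proof -
  obtain q where q: "q \<in> P" "b q s = 0" "b q t = 0" using st unfolding adjacent_def by blast
  obtain z where z: "z \<noteq> 0" "corner_vec s t = z *\<^sub>R q" using gram2_pos_corner_vec[OF g(2) q] by blast
  obtain a where a: "a > 0"
    "det3 s t q = a * det3 r s (c *\<^sub>R corner_vec r s)"
    using orientation_step[OF rs st rt cv(1) _ _ q] by (auto simp: bil corner_vec_perp)
  have lin: "det3 r s (c *\<^sub>R p) = c * det3 r s p"
    for r s p :: "real^3" and c by (simp add: det_3 algebra_simps)
  have e: "det e \<noteq> 0" using inv_e(1) by (simp add: invertible_det_nz)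
  have "gram2 s t * det e = z * det3 s t q"
    using det_corner_vec[of s t] unfolding z(2) lin by (rule HOL.sym)
  then have "gram2 s t * det e = z * (a * (c * (gram2 r s * det e)))"
    unfolding a(2) lin det_corner_vec .
  then have "((z * c) * (a * gram2 r s)) * det e = gram2 s t * det e" by (simp only: mult_ac)
  then have "(z * c) * (a * gram2 r s) = gram2 s t" using e by simp
  then have "(z * c) * (a * gram2 r s) > 0" "a * gram2 r s > 0" using g a(1) by auto
  then have "c * z > 0" by (simp add: zero_less_mult_iff mult.commute)
  then show ?thesis using P_scale[OF q(1)] unfolding z(2) by simp
qed

section \<open>Chains of roots\<close>

lemma chain_transfer:
  assumes "chain b P L I x" "\<And>i. i \<in> I \<Longrightarrow> x i = y i" shows "chain b P L I y"
proof -
  note c = assms(1)[unfolded chain_def]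
  have I: "(\<Inter>i\<in>I. neg_half b (y i)) = (\<Inter>i\<in>I. neg_half b (x i))" using assms(2) by simp
  show ?thesis
    unfolding chain_def I
  proof (intro conjI ballI allI impI)
    show "{i..j} \<subseteq> I" if "i \<in> I" "j \<in> I" for i j using c that by (elim conjE) blast
    show "root b L (y i)" if "i \<in> I" for i using c assms(2)[OF that] that by (elim conjE) auto
    fix i j assume ij: "i \<in> I" "j \<in> I" "i < j"
    have *: "b (x i) (x j) \<le> 0 \<and> (if j = i + 1 then normalized_product b (x i) (x j) \<ge> -1
         else normalized_product b (x i) (x j) < -1)"
      using c[THEN conjunct2, THEN conjunct2, THEN conjunct1] ij by blast
    show "b (y i) (y j) \<le> 0"
      "if j = i + 1 then normalized_product b (y i) (y j) \<ge> -1 else normalized_product b (y i) (y j) < -1"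
      using * unfolding assms(2)[OF ij(1)] assms(2)[OF ij(2)] by (rule conjunct1, rule conjunct2)
  next
    show "(\<Inter>i\<in>I. neg_half b (x i)) \<noteq> {}" using c by (elim conjE)
    fix i assume i: "i \<in> I \<and> i + 1 \<in> I"
    then have "common_simple b P L (x i) (x (i + 1))"
      using c[THEN conjunct2, THEN conjunct2, THEN conjunct2, THEN conjunct2] by blast
    then show "common_simple b P L (y i) (y (i + 1))" using assms(2)[of i] assms(2)[of "i + 1"] i by simp
  qed
qed

lemma chain_pair:
  assumes "chain b P L {1..n} x" "1 \<le> i" "i < j" "j \<le> n"
  shows "b (x i) (x j) \<le> 0" "j = i + 1 \<Longrightarrow> normalized_product b (x i) (x j) \<ge> -1"
  using assms unfolding chain_def by (auto split: if_splits)

lemma chain_adjacent: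
  assumes "chain b P L {1..n} x" "\<And>i. i \<in> {1..n} \<Longrightarrow> wall C (x i)" "1 \<le> i" "i + 1 \<le> n"
  shows "adjacent C (x i) (x (i + 1))" "gram2 (x i) (x (i + 1)) > 0"
  using neighbours_meet[of C "x i" "x (i + 1)"] chain_pair[OF assms(1,3), of "i + 1"] assms by auto

text \<open>The chamber named in the definition of a next root is bounded by the last two members, which meet in a
corner of \<open>C\<close>; so it is \<open>C\<close>.\<close>

lemma next_root_step:
  assumes j: "2 \<le> j" and ch: "chain b P L {1..j} x" and W: "\<And>i. i \<in> {1..j} \<Longrightarrow> wall C (x i)"
    and nx: "next_root b P L {1..j} x (x (j + 1))"
  shows "wall C (x (j + 1))" "chain b P L {1..j + 1} x \<or> closed_chain b P L 1 (j + 1) x"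
proof -
  obtain k C' m where k: "k \<in> {1..j}" "\<forall>i\<in>{1..j}. i \<le> k"
    and c: "chain b P L (insert (k + 1) {1..j}) (x(k + 1 := x (j + 1))) \<or>
      ({1..j} = {m..k} \<and> closed_chain b P L m (k + 1) (x(k + 1 := x (j + 1))))"
    and b': "\<forall>i\<in>insert (k + 1) {1..j}. k - 1 \<le> i \<longrightarrow> bounds b P L C' ((x(k + 1 := x (j + 1))) i)"
    using nx unfolding next_root_def by blast
  have kj: "k = j" using k(1) k(2)[rule_format, of j] j by simp
  have ins: "insert (j + 1) {1..j} = {1..j + 1}" using j by auto
  have "m = 1" if "{1..j} = {m..j}" using that j by (metis Icc_eq_Icc atLeastatMost_empty_iff not_le add_le_same_cancel1 one_le_numeral order_trans)
  then show "chain b P L {1..j + 1} x \<or> closed_chain b P L 1 (j + 1) x"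
    using c unfolding kj fun_upd_triv ins by blast
  have b'': "bounds b P L C' (x i)" if "i \<in> {j - 1..j + 1}" for i
    using b' that j unfolding kj fun_upd_triv ins by auto
  have ch': "chamber b P L C'" using b''[of j] bounds_chamber by auto
  have W': "wall C' (x i)" if "i \<in> {j - 1..j + 1}" for i using b''[OF that] bounds_iff_wall[OF ch'] by simp
  have "adjacent C (x (j - 1)) (x j)" using chain_adjacent(1)[OF ch W, of "j - 1"] j by simp
  then obtain p where "\<not> pos_prop (x (j - 1)) (x j)" "p \<in> P" "b p (x (j - 1)) = 0" "b p (x j) = 0"
    unfolding adjacent_def by blast
  then have "C' = C" using chamber_determined[of C "x (j - 1)" C' "x j" p] W W' j by auto
  then show "wall C (x (j + 1))" using W' by auto
qed

lemma closed_chain_describes: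
  assumes C: "chamber b P L C" and cl: "closed_chain b P L 1 n x" and W: "\<And>i. i \<in> {1..n} \<Longrightarrow> wall C (x i)"
  shows "describes_boundary_component b P L C (x ` {1..n})"
proof -
  have n: "3 \<le> n" using cl unfolding closed_chain_def by simp
  have nonpos: "b (x i) (x j) \<le> 0" if "i \<in> {1..n}" "j \<in> {1..n}" "i \<noteq> j" for i j
    using cl that unfolding closed_chain_def by blast
  have npp: "\<not> pos_prop (x i) (x j)" if "i \<in> {1..n}" "j \<in> {1..n}" "i \<noteq> j" for i j
    using nonpos_not_pos_prop[OF wall_pos[OF W]] nonpos that by blast
  have adj: "adjacent C (x i) (x (cyc_succ 1 n i))" if i: "i \<in> {1..n}" for i
  proof (rule neighbours_meet(2))
    have s: "cyc_succ 1 n i \<in> {1..n}" "cyc_succ 1 n i \<noteq> i" using i n by (auto simp: cyc_succ_def)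
    show "wall C (x i)" "wall C (x (cyc_succ 1 n i))" using W i s by auto
    show "b (x i) (x (cyc_succ 1 n i)) \<le> 0" using nonpos i s by metis
    show "normalized_product b (x i) (x (cyc_succ 1 n i)) \<ge> -1"
      using cl i s unfolding closed_chain_def by metis
  qed
  let ?\<Phi> = "x ` {1..n}"
  have "(\<Union>r\<in>?\<Phi>. side b P C r) \<in> components (P \<inter> frontier C)"
  proof (rule sides_form_component[of ?\<Phi> C "x 1"])
    show "wall C r" if "r \<in> ?\<Phi>" for r using that W by blast
    show "x 1 \<in> ?\<Phi>" using n by auto
    have "adjacent C (x j) (x (j + 1))" if "1 \<le> j" "j < n" for j
      using adj[of j] that by (simp add: cyc_succ_def)
    then show "(x 1, r) \<in> (linked C ?\<Phi>)\<^sup>*" if "r \<in> ?\<Phi>" for r using linked_along[of 1 n C x ?\<Phi>] that by auto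
    show "\<exists>s\<in>?\<Phi>. \<exists>s'\<in>?\<Phi>. adjacent C r s \<and> adjacent C r s' \<and> \<not> pos_prop s s'" if r: "r \<in> ?\<Phi>" for r
    proof -
      obtain i where i: "i \<in> {1..n}" "r = x i" using r by blast
      define l where "l = (if i = 1 then n else i - 1)"
      have l: "l \<in> {1..n}" "cyc_succ 1 n l = i" "cyc_succ 1 n i \<in> {1..n}" "cyc_succ 1 n i \<noteq> l"
        using i n by (auto simp: l_def cyc_succ_def)
      have "adjacent C r (x (cyc_succ 1 n i))" using adj i by simp
      moreover have "adjacent C r (x l)" using adj[OF l(1)] adjacent_sym l(2) i(2) by simp
      ultimately show ?thesis using npp[OF l(3,1,4)] l by blast
    qed
  qed
  moreover have "\<forall>r\<in>?\<Phi>. bounds b P L C r" using W bounds_iff_wall[OF C] by blast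
  ultimately show ?thesis unfolding describes_boundary_component_def by blast
qed

end

section \<open>Admissible lattices are Lorentzian\<close>

text \<open>Cauchy--Schwarz for the definite part \<open>a1, a2\<close>: orthogonality of a negative vector \<open>y\<close> to \<open>z\<close> bounds the third
coordinate of \<open>z\<close> by the first two.\<close>

lemma diagonal_form_perp:
  fixes a1 a2 a3 :: real
  assumes a: "a1 > 0" "a2 > 0" "a3 < 0"
    and y: "a1 * y1\<^sup>2 + a2 * y2\<^sup>2 + a3 * y3\<^sup>2 < 0"
    and yz: "a1 * (y1 * z1) + a2 * (y2 * z2) + a3 * (y3 * z3) = 0"
    and z: "z1 \<noteq> 0 \<or> z2 \<noteq> 0 \<or> z3 \<noteq> 0"
  shows "a1 * z1\<^sup>2 + a2 * z2\<^sup>2 + a3 * z3\<^sup>2 > 0"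
proof (cases "z3 = 0")
  case True
  then have "z1 \<noteq> 0 \<or> z2 \<noteq> 0" using z by simp
  then have "a1 * z1\<^sup>2 > 0 \<or> a2 * z2\<^sup>2 > 0" using a by auto
  moreover have "a1 * z1\<^sup>2 \<ge> 0" "a2 * z2\<^sup>2 \<ge> 0" using a by auto
  ultimately show ?thesis using True by auto
next
  case False
  define k where "k = - a3"
  have k: "k > 0" using a by (simp add: k_def)
  define A B E where "A = a1 * y1\<^sup>2 + a2 * y2\<^sup>2" and "B = a1 * z1\<^sup>2 + a2 * z2\<^sup>2"
    and "E = a1 * (y1 * z1) + a2 * (y2 * z2)"
  have "A * B - E\<^sup>2 = a1 * a2 * (y1 * z2 - y2 * z1)\<^sup>2"
    by (simp add: A_def B_def E_def algebra_simps power2_eq_square)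
  moreover have "\<dots> \<ge> 0" using a by simp
  ultimately have cs: "E\<^sup>2 \<le> A * B" by simp
  have E: "E = k * (y3 * z3)" using yz by (simp add: E_def k_def)
  have A: "A < k * y3\<^sup>2" "A \<ge> 0" using y a by (simp_all add: A_def k_def)
  have "k * z3\<^sup>2 < B"
  proof (rule ccontr)
    assume "\<not> k * z3\<^sup>2 < B"
    then have "A * B \<le> A * (k * z3\<^sup>2)" using A(2) by (intro mult_left_mono) auto
    also have "\<dots> < (k * y3\<^sup>2) * (k * z3\<^sup>2)" using A(1) k False by (intro mult_strict_right_mono) auto
    also have "\<dots> = E\<^sup>2" by (simp add: E power_mult_distrib power2_eq_square)
    finally show False using cs by simp
  qed
  then show ?thesis by (simp add: B_def k_def)
qed

lemma signature_perp_pos: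
  fixes b :: "3 form"
  assumes b: "symmetric_form b" and e: "invertible e" and sig: "has_signature (gram b e) 2 1"
    and v: "b v v < 0" "b v w = 0" and w: "w \<noteq> 0"
  shows "b w w > 0"
proof -
  interpret B: bounded_bilinear b
    using b by (simp add: symmetric_form_def bilinear_conv_bounded_bilinear)
  obtain Q :: "real^3^3" where Q: "invertible Q"
    and diag: "\<And>i j. i \<noteq> j \<Longrightarrow> (transpose Q ** gram b e ** Q) $ i $ j = 0"
    and pos: "card {i. (transpose Q ** gram b e ** Q) $ i $ i > 0} = 2"
    and neg: "card {i. (transpose Q ** gram b e ** Q) $ i $ i < 0} = 1"
    using sig unfolding has_signature_def by blast
  define G where "G = transpose Q ** gram b e ** Q"
  define d where "d i = G $ i $ i" for i
  define T where "T = transpose e ** Q"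
  have "invertible T" unfolding T_def using e Q by (simp add: invertible_mult transpose_invertible)
  then obtain T' where T': "T ** T' = mat 1" unfolding invertible_def by blast
  define c where "c u = T' *v u" for u
  have Tc: "T *v c u = u" for u by (simp add: c_def matrix_vector_mul_assoc T')
  have sum_e: "transpose e *v x = (\<Sum>i\<in>UNIV. x $ i *\<^sub>R e $ i)" for x
    by (simp add: vec_eq_iff matrix_vector_mult_def transpose_def mult.commute)
  have be: "b (transpose e *v x) (transpose e *v y) = x \<bullet> (gram b e *v y)" for x y
    unfolding sum_e by (simp add: sum_3 B.add_left B.add_right B.scaleR_left B.scaleR_right inner_vec_def
        matrix_vector_mult_def gram_def algebra_simps)
  have tr: "(Q *v x) \<bullet> z = x \<bullet> (transpose Q *v z)" for x z
    using dot_lmul_matrix[of x "transpose Q" z] by (simp only: vector_transpose_matrix)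
  have bT: "b (T *v x) (T *v y) = x \<bullet> (G *v y)" for x y
    unfolding T_def G_def by (simp only: matrix_vector_mul_assoc[symmetric] be tr)
  have G: "G $ i $ j = (if i = j then d i else 0)" for i j
    using diag by (simp add: d_def G_def)
  have form: "b u u' = d 1 * (c u $ 1 * c u' $ 1) + d 2 * (c u $ 2 * c u' $ 2) + d 3 * (c u $ 3 * c u' $ 3)" for u u'
  proof -
    have "b u u' = c u \<bullet> (G *v c u')" using bT[of "c u" "c u'"] by (simp add: Tc)
    then show ?thesis by (simp add: inner_vec_def matrix_vector_mult_def G sum_3)
  qed
  obtain n where n: "{i. d i < 0} = {n}" using neg card_1_singletonE unfolding d_def G_def by blast
  have "{i. d i > 0} = UNIV - {n}"
  proof (rule card_seteq)
    show "{i. d i > 0} \<subseteq> UNIV - {n}" using n by fastforce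
    show "card (UNIV - {n}) \<le> card {i. d i > 0}" using pos by (simp add: d_def G_def card_Diff_singleton)
  qed simp
  then have dn: "d n < 0" "\<And>i. i \<noteq> n \<Longrightarrow> d i > 0" using n by auto
  have w': "c w $ 1 \<noteq> 0 \<or> c w $ 2 \<noteq> 0 \<or> c w $ 3 \<noteq> 0"
  proof (rule ccontr)
    assume "\<not> ?thesis"
    then have "c w = 0" by (simp add: vec_eq_iff forall_3)
    then show False using Tc[of w] w by simp
  qed
  show ?thesis
  proof (cases "n = 1")
    case True
    then have "d 2 > 0" "d 3 > 0" "d 1 < 0" using dn by auto
    from diagonal_form_perp[OF this, of "c v $ 2" "c v $ 3" "c v $ 1" "c w $ 2" "c w $ 3" "c w $ 1"]
    show ?thesis using v w' by (simp add: form power2_eq_square) (auto simp: algebra_simps)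
  next
    case n1: False
    show ?thesis
    proof (cases "n = 2")
      case True
      then have "d 1 > 0" "d 3 > 0" "d 2 < 0" using dn by auto
      from diagonal_form_perp[OF this, of "c v $ 1" "c v $ 3" "c v $ 2" "c w $ 1" "c w $ 3" "c w $ 2"]
      show ?thesis using v w' by (simp add: form power2_eq_square) (auto simp: algebra_simps)
    next
      case False
      then have "n = 3" using n1 exhaust_3[of n] by auto
      then have "d 1 > 0" "d 2 > 0" "d 3 < 0" using dn by auto
      from diagonal_form_perp[OF this, of "c v $ 1" "c v $ 2" "c v $ 3" "c w $ 1" "c w $ 2" "c w $ 3"]
      show ?thesis using v w' by (simp add: form power2_eq_square)
    qed
  qed
qed

lemma unscaled_integral:
  assumes "unscaled b L" "x \<in> L" "y \<in> L" shows "b x y \<in> O_ring"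
proof -
  have "b x y \<in> span_over O_ring {b x y | x y. x \<in> L \<and> y \<in> L}"
    unfolding span_over_def using assms(2,3)
    by (intro CollectI exI[of _ "{b x y}"] exI[of _ "\<lambda>_. 1"]) auto
  then show ?thesis using assms(1) unfolding unscaled_def by simp
qed

lemma admissible_arith_lattice:
  assumes adm: "admissible_lattice b L" and P: "neg_cone_component b P"
  shows "\<exists>e. arith_lattice b P L e"
proof -
  obtain e where e: "O_basis L e" "hyperbolic_arithmetic (gram b e)"
    and b: "symmetric_form b" and un: "unscaled b L"
    using adm unfolding admissible_lattice_def is_lattice_def by blast
  have inv: "invertible e" using e(1) unfolding O_basis_def by blast
  have sig: "has_signature (gram b e) 2 1" "pos_def (\<chi> i j. gal (gram b e $ i $ j))"
    using e(2) unfolding hyperbolic_arithmetic_def by auto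
  have eL: "e $ i \<in> L" for i
  proof -
    have "e $ i = (\<Sum>j\<in>UNIV. (if j = i then 1 else 0) *\<^sub>R e $ j)"
      by (simp add: if_distrib[of "\<lambda>x. x *\<^sub>R _"] sum.delta cong: if_cong)
    moreover have "range (\<lambda>j. if j = i then 1 else 0 :: real) \<subseteq> O_ring" by auto
    moreover have "L = {(\<Sum>i\<in>UNIV. a i *\<^sub>R e $ i) | a. range a \<subseteq> O_ring}"
      using e(1) unfolding O_basis_def by simp
    ultimately show ?thesis by (simp only:) (intro CollectI exI[of _ "\<lambda>j. if j = i then 1 else 0"] conjI refl, simp)
  qed
  have "arith_lattice b P L e"
  proof
    show "symmetric_form b" "neg_cone_component b P" "O_basis L e"
      "pos_def (\<chi> i j. gal (gram b e $ i $ j))" using b P e(1) sig(2) .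
    show "b w w > 0" if "b v v < 0" "b v w = 0" "w \<noteq> 0" for v w
      by (rule signature_perp_pos[OF b inv sig(1) that])
    show "b (e $ i) (e $ j) \<in> O_ring" for i j by (rule unscaled_integral[OF un eL eL])
  qed
  then show ?thesis by blast
qed

section \<open>Chains repeated by an automorphism\<close>

lemma power_orbit_base: "x \<in> A \<Longrightarrow> x \<in> power_orbit f A"
  unfolding power_orbit_def by (intro UN_I[of 0] UnI1) (auto intro: image_eqI)

lemma power_orbit_closed:
  assumes f: "bij f" and r: "r \<in> power_orbit f A"
  shows "f r \<in> power_orbit f A" "inv f r \<in> power_orbit f A"
proof -
  have ff: "f (inv f x) = x" "inv f (f x) = x" for x
    using f by (simp_all add: bij_is_surj surj_f_inv_f bij_is_inj)
  have I: "(f ^^ n) x \<in> power_orbit f A" "(inv f ^^ n) x \<in> power_orbit f A" if "x \<in> A" for n x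
    using that unfolding power_orbit_def by blast+
  obtain n x where nx: "x \<in> A" "r = (f ^^ n) x \<or> r = (inv f ^^ n) x"
    using r unfolding power_orbit_def by blast
  have "f ((f ^^ n) x) = (f ^^ Suc n) x" "inv f ((inv f ^^ n) x) = (inv f ^^ Suc n) x" by simp_all
  then have up: "f ((f ^^ n) x) \<in> power_orbit f A" "inv f ((inv f ^^ n) x) \<in> power_orbit f A"
    using I[OF nx(1), of "Suc n"] by metis+
  have "f ((inv f ^^ n) x) \<in> power_orbit f A \<and> inv f ((f ^^ n) x) \<in> power_orbit f A"
  proof (cases n)
    case 0
    then show ?thesis using I[OF nx(1), of 1] by simp
  next
    case (Suc k)
    then show ?thesis using I[OF nx(1), of k] by (simp add: ff)
  qed
  then show "f r \<in> power_orbit f A" "inv f r \<in> power_orbit f A" using up nx(2) by auto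
qed

lemma power_orbit_induct [consumes 1, case_names base image preimage]:
  assumes "r \<in> power_orbit f A" "\<And>x. x \<in> A \<Longrightarrow> Q x" "\<And>x. Q x \<Longrightarrow> Q (f x)" "\<And>x. Q x \<Longrightarrow> Q (inv f x)"
  shows "Q r"
proof -
  obtain n x where nx: "x \<in> A" "r = (f ^^ n) x \<or> r = (inv f ^^ n) x"
    using assms(1) unfolding power_orbit_def by blast
  have "Q ((f ^^ n) x)" "Q ((inv f ^^ n) x)" using assms nx(1) by (induction n) auto
  then show ?thesis using nx(2) by auto
qed

context arith_lattice
begin

lemma automorphism_pos_prop_iff:
  assumes "automorphism b P L f" shows "pos_prop (f r) (f s) \<longleftrightarrow> pos_prop r s"
  using pos_prop_linear[OF automorphism_linear[OF assms], of r s]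
    pos_prop_linear[OF automorphism_linear[OF automorphism_inv[OF assms]], of "f r" "f s"]
    automorphism_bij[OF assms] by (auto simp: bij_is_inj)

text \<open>The match of two corners propagates backwards along the chain, because the previous wall is
determined as the neighbour of \<open>x j\<close> different from \<open>x (j + 1)\<close>.\<close>

lemma repetition_descends:
  fixes x :: "int \<Rightarrow> real^3"
  assumes f: "automorphism b P L f" and fC: "f ` C = C" and im: "1 \<le> i" "i < m"
    and adj: "\<And>j. 1 \<le> j \<Longrightarrow> j \<le> m \<Longrightarrow> adjacent C (x j) (x (j + 1))"
    and npp: "\<And>j. 1 \<le> j \<Longrightarrow> j + 2 \<le> m + 1 \<Longrightarrow> \<not> pos_prop (x j) (x (j + 2))"
    and fi: "pos_prop (f (x i)) (x m)" "pos_prop (f (x (i + 1))) (x (m + 1))"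
  shows "int d \<le> i - 1 \<Longrightarrow>
    pos_prop (f (x (i - int d))) (x (m - int d)) \<and> pos_prop (f (x (i - int d + 1))) (x (m - int d + 1))"
proof (induction d)
  case (Suc d)
  define j where "j = i - int d"
  define j' where "j' = m - int d"
  have jj: "2 \<le> j" "j \<le> i" "j < j'" "j' \<le> m" using Suc.prems im by (auto simp: j_def j'_def)
  have IH: "pos_prop (f (x j)) (x j')" "pos_prop (f (x (j + 1))) (x (j' + 1))"
    using Suc by (auto simp: j_def j'_def)
  have "adjacent C (f (x j)) (f (x (j - 1)))"
    using automorphism_adjacent[OF f fC adjacent_sym[OF adj[of "j - 1"]]] jj by simp
  moreover have "root b L (x j')" using wall_root[of C "x j'"] adj[of j'] jj by (simp add: adjacent_def)
  ultimately have "adjacent C (x j') (f (x (j - 1)))" using adjacent_scale IH(1) by blast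
  moreover have "adjacent C (x j') (x (j' - 1))" "adjacent C (x j') (x (j' + 1))"
    using adjacent_sym[OF adj[of "j' - 1"]] adj[of j'] jj by auto
  moreover have "\<not> pos_prop (x (j' - 1)) (x (j' + 1))" using npp[of "j' - 1"] jj by (simp add: add.commute)
  ultimately have "pos_prop (x (j' - 1)) (f (x (j - 1))) \<or> pos_prop (x (j' + 1)) (f (x (j - 1)))"
    using third_neighbour by blast
  moreover have "\<not> pos_prop (x (j' + 1)) (f (x (j - 1)))"
proof
    assume "pos_prop (x (j' + 1)) (f (x (j - 1)))"
    then have "pos_prop (f (x (j + 1))) (f (x (j - 1)))" using IH(2) pos_prop_trans by blast
    then have "pos_prop (x (j - 1)) (x (j - 1 + 2))"
      unfolding automorphism_pos_prop_iff[OF f] using pos_prop_sym by (simp add: add.commute)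
    then show False using npp[of "j - 1"] jj im by simp
  qed
  ultimately have "pos_prop (f (x (j - 1))) (x (j' - 1))" using pos_prop_sym by blast
  then show ?case using IH(1) by (simp add: j_def j'_def algebra_simps)
qed (use fi in simp)

text \<open>The orbit contains both neighbours of each of its walls. Inside the segment this is clear; at the last wall
the following one is the image of \<open>x (i + 2)\<close>. For the first wall the match between \<open>f (x i)\<close> and \<open>x m\<close> is
carried backwards along the chain until \<open>f (x 1)\<close> is reached.\<close>

lemma periodic_chain_describes:
  assumes C: "chamber b P L C" and f: "automorphism b P L f" and fC: "f ` C = C"
    and im: "1 \<le> i" "i < m"
    and adj: "\<And>j. 1 \<le> j \<Longrightarrow> j \<le> m \<Longrightarrow> adjacent C (x j) (x (j + 1))"
    and npp: "\<And>j. 1 \<le> j \<Longrightarrow> j + 2 \<le> m + 1 \<Longrightarrow> \<not> pos_prop (x j) (x (j + 2))"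
    and fi: "pos_prop (f (x i)) (x m)" "pos_prop (f (x (i + 1))) (x (m + 1))"
  shows "describes_boundary_component b P L C (power_orbit f (x ` {1..m + 1 :: int}))"
proof -
  let ?\<Phi> = "power_orbit f (x ` {1..m + 1})"
  let ?E = "linked C ?\<Phi>"
  note bij = automorphism_bij[OF f]
  have ff: "f (inv f r) = r" "inv f (f r) = r" for r
    using bij by (simp_all add: bij_is_surj surj_f_inv_f bij_is_inj)
  have g: "automorphism b P L (inv f)" by (rule automorphism_inv[OF f])
  have gC: "inv f ` C = C" using fC image_inv_f_f[OF bij_is_inj[OF bij], of C] by simp
  have xin: "x j \<in> ?\<Phi>" if "j \<in> {1..m + 1}" for j by (rule power_orbit_base) (rule imageI[OF that])
  note closed = power_orbit_closed[OF bij, of _ "x ` {1..m + 1}"]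
  have fadj: "adjacent C (f r) (f s)" "adjacent C (inv f r) (inv f s)" if "adjacent C r s" for r s
    using automorphism_adjacent[OF f fC that] automorphism_adjacent[OF g gC that] .
  have Wx: "wall C (x j)" if "j \<in> {1..m + 1}" for j
  proof (cases "j = m + 1")
    case True
    then show ?thesis using adj[of m] im by (simp add: adjacent_def)
  next
    case False
    then show ?thesis using adj[of j] that by (simp add: adjacent_def)
  qed
  have W: "wall C r" if "r \<in> ?\<Phi>" for r
    using that
  proof (induction rule: power_orbit_induct)
    case (image r)
    then show ?case using automorphism_wall[OF f, of C r] fC by simp
  next
    case (preimage r)
    then show ?case using automorphism_wall[OF g, of C r] gC by simp
  qed (use Wx in blast)
  define d where "d = m - i"
  have d1: "1 \<le> d" "d + 1 \<le> m" using im by (auto simp: d_def)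
  have f1: "pos_prop (f (x 1)) (x (d + 1))" and f2: "pos_prop (f (x 2)) (x (d + 2))"
    using repetition_descends[OF f fC im adj npp fi, of "nat (i - 1)"] im by (auto simp: d_def algebra_simps)
  have ends: "adjacent C (x 1) (inv f (x d))" "\<not> pos_prop (x 2) (inv f (x d))"
    "adjacent C (x (m + 1)) (f (x (i + 2)))" "\<not> pos_prop (x m) (f (x (i + 2)))"
  proof -
    have "pos_prop (inv f (x (d + 1))) (x 1)"
      using f1 automorphism_pos_prop_iff[OF g, of "f (x 1)" "x (d + 1)"] pos_prop_sym by (auto simp: ff)
    then show "adjacent C (x 1) (inv f (x d))"
      using adjacent_scale[OF fadj(2)[OF adjacent_sym[OF adj[of d]]]] d1 wall_root[OF Wx[of 1]] im by simp
    show "\<not> pos_prop (x 2) (inv f (x d))"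
    proof
      assume "pos_prop (x 2) (inv f (x d))"
      then have "pos_prop (f (x 2)) (x d)" using automorphism_pos_prop_iff[OF f, of "x 2" "inv f (x d)"] by (simp add: ff)
      then have "pos_prop (x d) (x (d + 2))" using f2 pos_prop_sym pos_prop_trans by blast
      then show False using npp[of d] d1 by simp
    qed
    have "adjacent C (f (x (i + 1))) (f (x (i + 2)))" using fadj(1)[OF adj[of "i + 1"]] im by (simp add: add.commute)
    then show "adjacent C (x (m + 1)) (f (x (i + 2)))"
      using adjacent_scale[OF _ fi(2)] wall_root[OF Wx[of "m + 1"]] im by simp
    show "\<not> pos_prop (x m) (f (x (i + 2)))"
    proof
      assume "pos_prop (x m) (f (x (i + 2)))"
      then have "pos_prop (f (x i)) (f (x (i + 2)))" using fi(1) pos_prop_trans by blast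
      then show False unfolding automorphism_pos_prop_iff[OF f] using npp[of i] im by simp
    qed
  qed
  have two: "\<exists>s\<in>?\<Phi>. \<exists>s'\<in>?\<Phi>. adjacent C r s \<and> adjacent C r s' \<and> \<not> pos_prop s s'" if "r \<in> ?\<Phi>" for r
    using that
  proof (induction rule: power_orbit_induct)
    case (base r)
    then obtain j where j: "1 \<le> j" "j \<le> m + 1" "r = x j" by auto
    consider "j = 1" | "j = m + 1" | "2 \<le> j" "j \<le> m" using j by linarith
    then show ?case
    proof cases
      case 1
      have "x 2 \<in> ?\<Phi>" "inv f (x d) \<in> ?\<Phi>" using xin[of 2] xin[of d] closed(2) d1 im by auto
      moreover have "adjacent C r (x 2)" using adj[of 1] 1 j im by simp
      ultimately show ?thesis using ends(1,2) 1 j by blast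
    next
      case 2
      have "x m \<in> ?\<Phi>" "f (x (i + 2)) \<in> ?\<Phi>" using xin[of m] xin[of "i + 2"] closed(1) im by auto
      moreover have "adjacent C r (x m)" using adjacent_sym[OF adj[of m]] 2 j im by simp
      ultimately show ?thesis using ends(3,4) 2 j by blast
    next
      case 3
      have "x (j - 1) \<in> ?\<Phi>" "x (j + 1) \<in> ?\<Phi>" using xin 3 by auto
      moreover have "adjacent C r (x (j - 1))" "adjacent C r (x (j + 1))"
        using adjacent_sym[OF adj[of "j - 1"]] adj[of j] 3 j by auto
      moreover have "\<not> pos_prop (x (j - 1)) (x (j + 1))" using npp[of "j - 1"] 3 by (simp add: add.commute)
      ultimately show ?thesis by blast
    qed
  next
    case (image r)
    then obtain s s' where "s \<in> ?\<Phi>" "s' \<in> ?\<Phi>" "adjacent C r s" "adjacent C r s'" "\<not> pos_prop s s'" by blast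
    then show ?case using closed(1) fadj(1) automorphism_pos_prop_iff[OF f] by blast
  next
    case (preimage r)
    then obtain s s' where "s \<in> ?\<Phi>" "s' \<in> ?\<Phi>" "adjacent C r s" "adjacent C r s'" "\<not> pos_prop s s'" by blast
    then show ?case using closed(2) fadj(2) automorphism_pos_prop_iff[OF g] by blast
  qed
  have sym: "(s, r) \<in> ?E\<^sup>*" if "(r, s) \<in> ?E\<^sup>*" for r s
  proof -
    have "sym ?E" by (auto simp: sym_def linked_def)
    from symD[OF sym_rtrancl[OF this] that] show ?thesis .
  qed
  have lift: "(h r, h s) \<in> ?E\<^sup>*"
    if rs: "(r, s) \<in> ?E\<^sup>*" and h: "automorphism b P L h" "h ` C = C" "\<And>r. r \<in> ?\<Phi> \<Longrightarrow> h r \<in> ?\<Phi>" for h r s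
    using rs
  proof (induction rule: rtrancl_induct)
    case (step s t)
    then obtain v where v: "v \<in> side b P C s" "v \<in> side b P C t" and st: "s \<in> ?\<Phi>" "t \<in> ?\<Phi>"
      unfolding linked_def by blast
    have "(h s, h t) \<in> ?E"
      by (rule linkedI[OF automorphism_side[OF h(1,2) v(1)] automorphism_side[OF h(1,2) v(2)] h(3) h(3)]) (fact st)+
    then show ?case using step.IH by (rule rtrancl_into_rtrancl[rotated])
  qed simp
  have along: "(x 1, x j) \<in> ?E\<^sup>*" if "1 \<le> j" "j \<le> m + 1" for j
    by (rule linked_along[OF _ _ that]) (use adj xin in auto)
  have x1f: "(x 1, f (x 1)) \<in> ?E\<^sup>*"
  proof -
    obtain v where "v \<in> side b P C (x m)" using adjacent_corner[OF adj[of m]] im by auto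
    then have "(x m, f (x i)) \<in> ?E"
      using pos_prop_side[OF fi(1)] xin[of m] closed(1)[OF xin[of i]] im by (auto intro: linkedI)
    then have "(x 1, f (x i)) \<in> ?E\<^sup>*" using along[of m] im by (simp add: rtrancl_into_rtrancl)
    moreover have "(f (x i), f (x 1)) \<in> ?E\<^sup>*"
      using lift[OF sym f fC closed(1)] along[of i] im by simp
    ultimately show ?thesis by (rule rtrancl_trans)
  qed
  have reach: "(x 1, r) \<in> ?E\<^sup>*" if "r \<in> ?\<Phi>" for r
    using that
  proof (induction rule: power_orbit_induct)
    case (base r)
    then show ?case using along by auto
  next
    case (image r)
    show ?case using rtrancl_trans[OF x1f lift[OF image f fC closed(1)]] .
  next
    case (preimage r)
    have "(inv f (f (x 1)), inv f (x 1)) \<in> ?E\<^sup>*" by (rule lift[OF sym[OF x1f] g gC closed(2)])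
    then have "(x 1, inv f (x 1)) \<in> ?E\<^sup>*" by (simp only: ff)
    from rtrancl_trans[OF this lift[OF preimage g gC closed(2)]] show ?case .
  qed
  have "(\<Union>r\<in>?\<Phi>. side b P C r) \<in> components (P \<inter> frontier C)"
    by (rule sides_form_component[of ?\<Phi> C "x 1", OF W xin reach two]) (use im in auto)
  moreover have "\<forall>r\<in>?\<Phi>. bounds b P L C r" using W bounds_iff_wall[OF C] by blast
  ultimately show ?thesis unfolding describes_boundary_component_def by blast
qed

end

section \<open>Repetition of corners\<close>

context arith_lattice
begin

lemma corner_commute: "corner b P s r = corner b P r s"
  by (auto simp: corner_def)

lemma corner_basis_adjacent:
  assumes C: "chamber b P L C" and rs: "adjacent C r s"
    and p: "p \<in> P" "b p r = 0" "b p s = 0" "primitive L p"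
    and o: "\<omega> * det3 r s p > 0"
  shows "corner_basis b P L \<omega> C (corner b P r s) r s p"
  unfolding corner_basis_def
proof (intro conjI refl)
  have W: "wall C r" "wall C s" "\<not> pos_prop r s" using rs by (auto simp: adjacent_def)
  show "bounds b P L C r" "bounds b P L C s" using W bounds_iff_wall[OF C] by auto
  show "corner b P r s \<subseteq> closure C"
    using corner_in_closure[OF W] by (auto simp: corner_def mirror_def)
  show "p \<in> corner b P r s" using p by (simp add: corner_def mirror_def)
qed fact+

text \<open>Which of the two orders of the walls is a corner basis depends on the sign \<open>\<omega>\<close>. An orientation preserving
map keeps that order, and the image of a primitive vector under an automorphism is primitive, so no primitive
vector has to be computed at the second corner.\<close>

lemma corner_basis_and_image:
  assumes C: "chamber b P L C" and f: "automorphism b P L f" "f ` C = C" "det (matrix f) > 0"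
    and rs: "adjacent C r s" "gram2 r s > 0" and \<omega>: "\<omega> \<in> {1, -1}"
  shows "\<exists>a t p. corner_basis b P L \<omega> C (corner b P r s) a t p \<and>
    corner_basis b P L \<omega> C (corner b P (f r) (f s)) (f a) (f t) (f p)"
proof -
  obtain q where q: "q \<in> P" "b q r = 0" "b q s = 0" using rs(1) unfolding adjacent_def by blast
  obtain z where z: "z \<noteq> 0" "corner_vec r s = z *\<^sub>R q" using gram2_pos_corner_vec[OF rs(2) q] by blast
  have L: "r \<in> L" "s \<in> L" using rs(1) wall_root root_L unfolding adjacent_def by blast+
  have cv0: "corner_vec r s \<noteq> 0" using z P_nonzero[OF q(1)] by simp
  obtain p0 c where p0: "primitive L p0" "c \<noteq> 0" "p0 = c *\<^sub>R corner_vec r s"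
    using primitive_on_line[OF corner_vec_L[OF L] cv0] by blast
  define x where "x = c * z"
  have x: "x \<noteq> 0" "p0 = x *\<^sub>R q" using z p0 by (auto simp: x_def)
  have "primitive L (- p0)"
  proof -
    have "inj (uminus :: real^3 \<Rightarrow> real^3)" by (rule injI) simp
    moreover have "linear (uminus :: real^3 \<Rightarrow> real^3)" by (rule linearI) auto
    moreover have "- v \<in> L" if "v \<in> L" for v using L_scale[OF that that, of "- 1"] O_minus[OF O_int(3)] by simp
    then have "uminus ` L = L" by (metis image_subset_iff minus_minus image_eqI subsetI subset_antisym)
    ultimately show ?thesis using primitive_image p0(1) by blast
  qed
  then have "primitive L (sgn x *\<^sub>R p0)" using p0(1) x(1) by (auto simp: sgn_real_def)
  moreover have "sgn x *\<^sub>R p0 = \<bar>x\<bar> *\<^sub>R q" using x by (simp add: abs_sgn mult.commute)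
  ultimately obtain p where p: "p \<in> P" "b p r = 0" "b p s = 0" "primitive L p"
    and px: "p = \<bar>x\<bar> *\<^sub>R q" using P_scale[OF q(1), of "\<bar>x\<bar>"] x(1) q by (auto simp: bil)
  have lin: "det3 r s (c *\<^sub>R p) = c * det3 r s p"
    for r s p :: "real^3" and c by (simp add: det_3 algebra_simps)
  have "det3 r s (corner_vec r s) \<noteq> 0"
    using rs(2) inv_e(1) by (simp add: det_corner_vec invertible_det_nz)
  then have d0: "det3 r s p \<noteq> 0" using x(1) unfolding z(2) px lin by simp
  have swap: "det3 s r p = - det3 r s p"
    by (simp add: det_3 algebra_simps)
  have both: ?thesis if at: "adjacent C a t" "corner b P a t = corner b P r s"
      "corner b P (f a) (f t) = corner b P (f r) (f s)" "b p a = 0" "b p t = 0"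
      "\<omega> * det3 a t p > 0" for a t
  proof -
    have fp: "f p \<in> P" using p(1) automorphism_P[OF f(1)] by blast
    have "primitive L (f p)"
      using primitive_image[OF automorphism_linear[OF f(1)] bij_is_inj[OF automorphism_bij[OF f(1)]]
          automorphism_L[OF f(1)] p(4)] .
    moreover have "\<omega> * det3 (f a) (f t) (f p) > 0"
    proof -
      have "\<omega> * det3 (f a) (f t) (f p) = det (matrix f) * (\<omega> * det3 a t p)"
        by (simp add: det_linear_image[OF automorphism_linear[OF f(1)]])
      moreover have "\<dots> > 0" using f(3) at(6) by (rule mult_pos_pos)
      ultimately show ?thesis by (simp only:)
    qed
    ultimately have "corner_basis b P L \<omega> C (corner b P (f a) (f t)) (f a) (f t) (f p)"
      using corner_basis_adjacent[OF C automorphism_adjacent[OF f(1,2) at(1)] fp] at(4,5)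
      by (simp add: automorphism_isometry[OF f(1)])
    moreover have "corner_basis b P L \<omega> C (corner b P a t) a t p"
      using corner_basis_adjacent[OF C at(1) p(1) at(4,5) p(4) at(6)] .
    ultimately show ?thesis unfolding at(2,3) by blast
  qed
  show ?thesis
  proof (cases "\<omega> * det3 r s p > 0")
    case True
    then show ?thesis using both[OF rs(1) refl refl p(2,3)] by blast
  next
    case False
    then have "\<omega> * det3 s r p > 0" using d0 \<omega> unfolding swap by auto
    then show ?thesis using both[OF adjacent_sym[OF rs(1)] corner_commute corner_commute p(3,2)] by blast
  qed
qed

lemma infinite_chain_repeats:
  assumes C: "chamber b P L C"
    and adj: "\<And>j. 1 \<le> j \<Longrightarrow> adjacent C (x j) (x (j + 1))"
    and gpos: "\<And>j. 1 \<le> j \<Longrightarrow> gram2 (x j) (x (j + 1)) > 0"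
    and npp: "\<And>j. 1 \<le> j \<Longrightarrow> \<not> pos_prop (x j) (x (j + 2))"
    and \<omega>: "\<omega> \<in> {1, -1}"
  shows "\<exists>\<psi> i m. automorphism b P L \<psi> \<and> orientation_preserving \<psi> \<and> \<psi> ` C = C \<and> 1 \<le> i \<and> i < m \<and> k \<le> m \<and>
    pos_prop (\<psi> (x i)) (x m) \<and> pos_prop (\<psi> (x (i + 1))) (x (m + 1 :: int)) \<and>
    (\<exists>a s p. corner_basis b P L \<omega> C (corner b P (x i) (x (i + 1))) a s p \<and>
      corner_basis b P L \<omega> C (corner b P (x m) (x (m + 1))) (\<psi> a) (\<psi> s) (\<psi> p))"
proof -
  have "\<exists>u. u > 0 \<and> normal_root (u *\<^sub>R x (int n + 1))" for n
    using exists_normal_root[of "x (int n + 1)"] adj[of "int n + 1"] wall_root unfolding adjacent_def by force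
  then obtain u where u: "\<And>n. u n > 0" "\<And>n. normal_root (u n *\<^sub>R x (int n + 1))" by metis
  define y where "y n = u n *\<^sub>R x (int n + 1)" for n
  have yx: "pos_prop (x (int n + 1)) (y n)" for n unfolding pos_prop_def y_def using u(1) by blast
  have yroot: "root b L (y n)" for n using u(2) unfolding normal_root_def y_def by blast
  have yadj: "adjacent C (y n) (y (Suc n))" for n
  proof -
    have "adjacent C (x (int n + 1)) (x (int (Suc n) + 1))" using adj[of "int n + 1"] by (simp add: add.commute)
    then show ?thesis
      using adjacent_scale[OF _ yx yroot] adjacent_sym by blast
  qed
  have ygram: "gram2 (y n) (y (Suc n)) > 0" for n
  proof -
    have "gram2 (y n) (y (Suc n)) = (u n)\<^sup>2 * (u (Suc n))\<^sup>2 * gram2 (x (int n + 1)) (x (int (Suc n) + 1))"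
      by (simp add: gram2_def y_def bil algebra_simps power2_eq_square)
    moreover have "gram2 (x (int n + 1)) (x (int (Suc n) + 1)) > 0"
      using gpos[of "int n + 1"] by (simp add: add.commute)
    ultimately show ?thesis using u(1)[of n] u(1)[of "Suc n"] by simp
  qed
  have ynpp: "\<not> pos_prop (y n) (y (Suc (Suc n)))" for n
  proof
    assume "pos_prop (y n) (y (Suc (Suc n)))"
    then have "pos_prop (x (int n + 1)) (x (int (Suc (Suc n)) + 1))"
      using yx pos_prop_sym pos_prop_trans by metis
    then show False using npp[of "int n + 1"] by (simp add: add.commute)
  qed
  obtain c :: real where c: "c = 1 \<or> c = -1" "c *\<^sub>R corner_vec (y 0) (y 1) \<in> P"
  proof -
    obtain q where q: "q \<in> P" "b q (y 0) = 0" "b q (y 1) = 0" using yadj[of 0] unfolding adjacent_def by auto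
    obtain z where z: "z \<noteq> 0" "corner_vec (y 0) (y 1) = z *\<^sub>R q"
      using gram2_pos_corner_vec[OF _ q] ygram[of 0] by auto
    have "b (corner_vec (y 0) (y 1)) (corner_vec (y 0) (y 1)) = z\<^sup>2 * b q q"
      unfolding z(2) by (simp add: bil power2_eq_square)
    then have "b (corner_vec (y 0) (y 1)) (corner_vec (y 0) (y 1)) < 0"
      using P_neg[OF q(1)] z(1) by (simp add: mult_pos_neg)
    then have "1 *\<^sub>R corner_vec (y 0) (y 1) \<in> P \<or> (- 1) *\<^sub>R corner_vec (y 0) (y 1) \<in> P"
      using P_or_minus by simp
    then show ?thesis using that by metis
  qed
  have cone: "c *\<^sub>R corner_vec (y n) (y (Suc n)) \<in> P" for n
  proof (induction n)
    case (Suc n)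
    then show ?case by (rule corner_vec_cone_step[OF yadj yadj ynpp ygram ygram _ c(1)])
  qed (use c(2) in simp)
  obtain i m l l' where im: "i < m" "nat k \<le> m"
    and g: "b (y m) (y m) = b (y i) (y i)" "b (y (Suc m)) (y (Suc m)) = b (y (Suc i)) (y (Suc i))"
      "b (y m) (y (Suc m)) = b (y i) (y (Suc i))"
    and l: "l \<in> L" "l' \<in> L" "y m - y i = (D * gram2 (y i) (y (Suc i))) *\<^sub>R l"
      "y (Suc m) - y (Suc i) = (D * gram2 (y i) (y (Suc i))) *\<^sub>R l'"
    using corner_pigeonhole[of y "nat k", OF u(2)[folded y_def] ygram] by blast
  define \<psi> where "\<psi> = corner_map (y i) (y (Suc i)) (y m) (y (Suc m))"
  have \<Delta>: "gram2 (y i) (y (Suc i)) \<noteq> 0" using ygram[of i] by simp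
  have yL: "y n \<in> L" for n using yroot root_L by blast
  have \<psi>: "automorphism b P L \<psi>"
    unfolding \<psi>_def
    by (rule corner_automorphism[OF yL yL yL yL \<Delta> g l(3,4,1,2)]) (use cone[of i] cone[of m] c(1) in auto)
  have on: "\<psi> (y i) = y m" "\<psi> (y (Suc i)) = y (Suc m)"
    unfolding \<psi>_def by (rule corner_map_on_corner[OF \<Delta>])+
  have det: "det (matrix \<psi>) = 1" unfolding \<psi>_def by (rule corner_map_det[OF \<Delta> g])
  have W: "wall C (y n)" for n using yadj[of n] by (simp add: adjacent_def)
  obtain q where q: "\<not> pos_prop (y m) (y (Suc m))" "q \<in> P" "b q (y m) = 0" "b q (y (Suc m)) = 0"
    using yadj[of m] unfolding adjacent_def by blast
  have W': "wall (\<psi> ` C) (y m)" "wall (\<psi> ` C) (y (Suc m))"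
    using automorphism_wall[OF \<psi> W, of i] automorphism_wall[OF \<psi> W, of "Suc i"] by (simp_all add: on)
  have \<psi>C: "\<psi> ` C = C" by (rule chamber_determined[OF W W'(1) W W'(2) q])
  have img: "pos_prop (\<psi> (x (int n + 1))) (x (int n' + 1))" if "\<psi> (y n) = y n'" for n n'
    using pos_prop_linear[OF automorphism_linear[OF \<psi>] yx[of n]] pos_prop_sym[OF yx[of n']] that
      pos_prop_trans by metis
  have cn: "corner b P (y n) (y (Suc n)) = corner b P (x (int n + 1)) (x (int n + 1 + 1))" for n
    using u(1)[of n] u(1)[of "Suc n"] by (auto simp: corner_def mirror_def y_def bil add.commute add.left_commute)
  obtain a s p where "corner_basis b P L \<omega> C (corner b P (y i) (y (Suc i))) a s p"
    "corner_basis b P L \<omega> C (corner b P (y m) (y (Suc m))) (\<psi> a) (\<psi> s) (\<psi> p)"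
    using corner_basis_and_image[OF C \<psi> \<psi>C _ yadj[of i] ygram \<omega>] det by (auto simp: on)
  then have "\<exists>a s p. corner_basis b P L \<omega> C (corner b P (x (int i + 1)) (x (int i + 1 + 1))) a s p \<and>
      corner_basis b P L \<omega> C (corner b P (x (int m + 1)) (x (int m + 1 + 1))) (\<psi> a) (\<psi> s) (\<psi> p)"
    unfolding cn by blast
  moreover have "pos_prop (\<psi> (x (int i + 1))) (x (int m + 1))" by (rule img[OF on(1)])
  moreover have "pos_prop (\<psi> (x (int i + 1 + 1))) (x (int m + 1 + 1))"
    using img[OF on(2)] by (simp add: add.commute)
  moreover have "orientation_preserving \<psi>" unfolding orientation_preserving_def by (simp add: det)
  moreover have "1 \<le> int i + 1" "int i + 1 < int m + 1" "k \<le> int m + 1" using im by auto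
  ultimately show ?thesis using \<psi> \<psi>C by blast
qed

section \<open>Prolonging a chain\<close>

lemma closed_chain_transfer:
  assumes "closed_chain b P L m n x" "\<And>i. i \<in> {m..n} \<Longrightarrow> x i = y i"
  shows "closed_chain b P L m n y"
proof -
  note c = assms(1)[unfolded closed_chain_def]
  have I: "(\<Inter>i\<in>{m..n}. neg_half b (y i)) = (\<Inter>i\<in>{m..n}. neg_half b (x i))" using assms(2) by simp
  show ?thesis
    unfolding closed_chain_def I
  proof (intro conjI ballI impI)
    show "m + 2 \<le> n" by (rule c[THEN conjunct1])
    show "(\<Inter>i\<in>{m..n}. neg_half b (x i)) \<noteq> {}"
      by (rule c[THEN conjunct2, THEN conjunct2, THEN conjunct2, THEN conjunct1])
    show "root b L (y i)" if "i \<in> {m..n}" for i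
      using bspec[OF c[THEN conjunct2, THEN conjunct1] that] unfolding assms(2)[OF that] .
    fix i j assume ij: "i \<in> {m..n}" "j \<in> {m..n}" "i \<noteq> j"
    have *: "b (x i) (x j) \<le> 0 \<and> (if j = cyc_succ m n i \<or> i = cyc_succ m n j
        then normalized_product b (x i) (x j) \<ge> -1 else normalized_product b (x i) (x j) < -1)"
      using c[THEN conjunct2, THEN conjunct2, THEN conjunct1] ij by blast
    show "b (y i) (y j) \<le> 0" "if j = cyc_succ m n i \<or> i = cyc_succ m n j
        then normalized_product b (y i) (y j) \<ge> -1 else normalized_product b (y i) (y j) < -1"
      using * unfolding assms(2)[OF ij(1)] assms(2)[OF ij(2)] by (rule conjunct1, rule conjunct2)
  next
    fix i assume i: "i \<in> {m..n}"
    then have "cyc_succ m n i \<in> {m..n}" by (auto simp: cyc_succ_def)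
    moreover have "common_simple b P L (x i) (x (cyc_succ m n i))"
      using c[THEN conjunct2, THEN conjunct2, THEN conjunct2, THEN conjunct2] i by blast
    ultimately show "common_simple b P L (y i) (y (cyc_succ m n i))" using assms(2) i by simp
  qed
qed

lemma next_root_transfer:
  assumes "next_root b P L {m..n} y v" "\<And>i. i \<in> {m..n} \<Longrightarrow> x i = y i"
  shows "next_root b P L {m..n} x v"
proof -
  obtain k where k: "k \<in> {m..n}" "\<forall>i\<in>{m..n}. i \<le> k" "root b L v"
    and c: "chain b P L (insert (k + 1) {m..n}) (y(k + 1 := v)) \<or>
      (\<exists>m'. {m..n} = {m'..k} \<and> closed_chain b P L m' (k + 1) (y(k + 1 := v)))"
    and B: "\<exists>C. \<forall>i\<in>insert (k + 1) {m..n}. k - 1 \<le> i \<longrightarrow> bounds b P L C ((y(k + 1 := v)) i)"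
    using assms(1) unfolding next_root_def by blast
  have eq: "(y(k + 1 := v)) i = (x(k + 1 := v)) i" if "i \<in> insert (k + 1) {m..n}" for i
    using assms(2) that by auto
  have "closed_chain b P L m' (k + 1) (x(k + 1 := v))"
    if "{m..n} = {m'..k}" "closed_chain b P L m' (k + 1) (y(k + 1 := v))" for m'
  proof -
    have I: "i \<in> {m'..k + 1} \<Longrightarrow> (x(k + 1 := v)) i = (y(k + 1 := v)) i" for i
      using eq[of i] that(1) by force
    show ?thesis by (rule closed_chain_transfer[OF that(2)]) (rule I[symmetric])
  qed
  moreover have "chain b P L (insert (k + 1) {m..n}) (x(k + 1 := v))"
    if "chain b P L (insert (k + 1) {m..n}) (y(k + 1 := v))"
    by (rule chain_transfer[OF that]) (rule eq)
  moreover have "\<exists>C. \<forall>i\<in>insert (k + 1) {m..n}. k - 1 \<le> i \<longrightarrow> bounds b P L C ((x(k + 1 := v)) i)"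
    using B eq by metis
  ultimately show ?thesis using k c unfolding next_root_def by blast
qed

text \<open>The prolongation is built as a sequence of total functions, each changing its predecessor at one place; since
the notions involved depend only on the values on the index set, the diagonal function inherits them.\<close>

lemma next_root_extension_exists:
  assumes nx: "\<And>n x. 1 \<le> n \<Longrightarrow> chain b P L {1..n} x \<Longrightarrow> \<exists>v. next_root b P L {1..n} x v"
    and N: "1 \<le> N"
  shows "\<exists>x. next_root_extension b P L N r x"
proof -
  define X :: "nat \<Rightarrow> int \<Rightarrow> real^3" where
    "X = rec_nat r (\<lambda>n f. f(N + int n + 1 := SOME v. next_root b P L {1..N + int n} f v))"
  have X: "X 0 = r" "X (Suc n) = (X n)(N + int n + 1 := SOME v. next_root b P L {1..N + int n} (X n) v)" for n
    by (simp_all add: X_def)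
  have stable: "X (n + d) i = X n i" if "i \<le> N + int n" for n d i
    by (induction d) (use that in \<open>auto simp: X\<close>)
  define x where "x i = X (nat (i - N)) i" for i
  have xX: "x i = X n i" if "i \<le> N + int n" for i n
  proof -
    have "nat (i - N) + (n - nat (i - N)) = n" using that by simp
    then show ?thesis using stable[of i "nat (i - N)" "n - nat (i - N)"] by (simp add: x_def)
  qed
  have "next_root b P L {1..j} x (x (j + 1))" if j: "N \<le> j" and ch: "chain b P L {1..j} x" for j
  proof -
    define n where "n = nat (j - N)"
    have jn: "j = N + int n" using j by (simp add: n_def)
    have eq: "x i = X n i" if "i \<in> {1..j}" for i using xX that jn by auto
    have "chain b P L {1..j} (X n)" by (rule chain_transfer[OF ch]) (rule eq)
    then have "\<exists>v. next_root b P L {1..j} (X n) v" using nx[of j "X n"] j N by simp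
    then have "next_root b P L {1..j} (X n) (SOME v. next_root b P L {1..j} (X n) v)" by (rule someI_ex)
    moreover have "x (j + 1) = (SOME v. next_root b P L {1..j} (X n) v)"
      using xX[of "j + 1" "Suc n"] by (simp add: X jn)
    ultimately show ?thesis using next_root_transfer eq by simp
  qed
  moreover have "x i = r i" if "i \<in> {1..N}" for i using xX[of i 0] that by (simp add: X)
  ultimately show ?thesis unfolding next_root_extension_def by blast
qed

lemma extension_describes:
  assumes C: "chamber b P L C" and k: "1 \<le> k" and \<omega>: "\<omega> \<in> {1, -1}"
    and ch: "chain b P L {1..k + 1} r" and W: "\<And>i. i \<in> {1..k + 1} \<Longrightarrow> wall C (r i)"
    and ext: "next_root_extension b P L (k + 1) r x"
  shows "\<exists>m\<ge>k. (\<forall>n\<in>{k + 1..m}. chain b P L {1..n} x) \<and>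
        ((closed_chain b P L 1 (m + 1) x \<and>
          describes_boundary_component b P L C (x ` {1..m + 1}))
        \<or>
         (chain b P L {1..m + 1} x \<and>
          (\<exists>\<psi> i. automorphism b P L \<psi> \<and> orientation_preserving \<psi> \<and> 1 \<le> i \<and> i < m \<and>
            (\<exists>a s p a' s' p'.
               corner_basis b P L \<omega> C (corner b P (x i) (x (i + 1))) a s p \<and>
               corner_basis b P L \<omega> C (corner b P (x m) (x (m + 1))) a' s' p' \<and>
               \<psi> a = a' \<and> \<psi> s = s' \<and> \<psi> p = p') \<and>
            describes_boundary_component b P L C (power_orbit \<psi> (x ` {1..m + 1})))))"
proof -
  have xr: "x i = r i" if "i \<in> {1..k + 1}" for i using ext that unfolding next_root_extension_def by blast
  have nx: "next_root b P L {1..j} x (x (j + 1))" if "k + 1 \<le> j" "chain b P L {1..j} x" for j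
    using ext that unfolding next_root_extension_def by blast
  have ch0: "chain b P L {1..k + 1} x" by (rule chain_transfer[OF ch]) (rule xr[symmetric])
  have walls: "\<forall>i\<in>{1..k + 1 + int d}. wall C (x i)"
    if "\<forall>n\<in>{k + 1..k + int d}. chain b P L {1..n} x" for d
    using that
  proof (induction d)
    case (Suc d)
    then have IH: "\<forall>i\<in>{1..k + 1 + int d}. wall C (x i)" by auto
    have c: "chain b P L {1..k + 1 + int d} x" using Suc.prems by auto
    have "wall C (x (k + 1 + int d + 1))"
      by (rule next_root_step(1)[OF _ c _ nx[OF _ c]]) (use IH k in auto)
    then show ?case using IH by (metis atLeastAtMost_iff add.assoc int_Suc zle_add1_eq_le le_less not_le add.commute)
  qed (use W xr in auto)
  show ?thesis
  proof (cases "\<exists>d. \<not> chain b P L {1..k + 1 + int d} x")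
    case True
    \<comment> \<open>The first index at which the prolongation is not a linear chain is where it closes up.\<close>
    define d where "d = (LEAST d. \<not> chain b P L {1..k + 1 + int d} x)"
    have nd: "\<not> chain b P L {1..k + 1 + int d} x" unfolding d_def using True by (rule LeastI_ex)
    have lt: "chain b P L {1..k + 1 + int d'} x" if "d' < d" for d'
      using not_less_Least[of d' "\<lambda>d. \<not> chain b P L {1..k + 1 + int d} x"] that unfolding d_def by blast
    have d0: "d \<noteq> 0" using nd ch0 by (metis add_0_right of_nat_0)
    define m where "m = k + int d"
    have mch: "chain b P L {1..n} x" if "n \<in> {k + 1..m}" for n
    proof -
      have "nat (n - k - 1) < d" using that by (auto simp: m_def nat_less_iff)
      from lt[OF this] show ?thesis using that by simp
    qed
    have Wm: "wall C (x i)" if "i \<in> {1..m + 1}" for i using walls[of d] mch that by (simp add: m_def add.commute add.left_commute)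
    have m: "k + 1 \<le> m" using d0 by (simp add: m_def)
    have cm: "chain b P L {1..m} x" using mch m by simp
    have "closed_chain b P L 1 (m + 1) x"
      using next_root_step(2)[OF _ cm _ nx[OF m cm], of C] Wm nd m k by (auto simp: m_def add.commute add.left_commute)
    then show ?thesis using closed_chain_describes[OF C _ Wm] mch m by (intro exI[of _ m]) auto
  next
    case False
    have all: "chain b P L {1..n} x" if "k + 1 \<le> n" for n
      using False[simplified, rule_format, of "nat (n - k - 1)"] that by simp
    have Wx: "wall C (x j)" if "1 \<le> j" for j using walls[of "nat j"] all that k by simp
    have big: "\<exists>n. k + 1 \<le> n \<and> j \<le> n" for j by (rule exI[of _ "max (k + 1) j"]) simp
    have nonpos: "b (x i) (x j) \<le> 0" if "1 \<le> i" "i < j" for i j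
      using big[of j] chain_pair(1)[OF all that] by blast
    have adj: "adjacent C (x j) (x (j + 1))" "gram2 (x j) (x (j + 1)) > 0" if "1 \<le> j" for j
      using big[of "j + 1"] chain_adjacent[OF all, of _ C j] Wx that by (metis atLeastAtMost_iff)+
    have npp: "\<not> pos_prop (x j) (x (j + 2))" if "1 \<le> j" for j
      using nonpos_not_pos_prop[OF wall_pos[OF Wx[OF that]] nonpos[OF that]] by simp
    obtain \<psi> i m where \<psi>: "automorphism b P L \<psi>" "orientation_preserving \<psi>" "\<psi> ` C = C"
      and im: "1 \<le> i" "i < m" "k \<le> m"
      and p: "pos_prop (\<psi> (x i)) (x m)" "pos_prop (\<psi> (x (i + 1))) (x (m + 1))"
      and cb: "\<exists>a s p. corner_basis b P L \<omega> C (corner b P (x i) (x (i + 1))) a s p \<and>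
        corner_basis b P L \<omega> C (corner b P (x m) (x (m + 1))) (\<psi> a) (\<psi> s) (\<psi> p)"
      using infinite_chain_repeats[OF C adj npp \<omega>, of k] by blast
    have "describes_boundary_component b P L C (power_orbit \<psi> (x ` {1..m + 1}))"
      by (rule periodic_chain_describes[OF C \<psi>(1,3) im(1,2) adj(1) npp p]) auto
    then show ?thesis using \<psi> im cb all by (intro exI[of _ m] conjI disjI2) (auto, blast)
  qed
qed

end

theorem theorem3:
  fixes b :: "3 form" and L P C :: "(real^3) set" and \<omega> :: real
    and r :: "int \<Rightarrow> real^3" and k :: int
  assumes L_lattice: "admissible_lattice b L" "strongly_squarefree b L"
    and L_in_T: "in_list_T b L"
    and orientation: "\<omega> \<in> {1, -1}"
    and cone: "neg_cone_component b P"
    and next_previous: "\<And>m n x. m \<le> n \<Longrightarrow> chain b P L {m..n} x \<Longrightarrow>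
          (\<exists>v. next_root b P L {m..n} x v) \<and> (\<exists>v. previous_root b P L {m..n} x v)"
    and k: "1 \<le> k"
    and chain: "chain b P L {1..k + 1} r"
    and chamber: "chamber b P L C" "\<And>i. i \<in> {1..k + 1} \<Longrightarrow> bounds b P L C (r i)"
  shows "(\<exists>x. next_root_extension b P L (k + 1) r x) \<and>
    (\<forall>x. next_root_extension b P L (k + 1) r x \<longrightarrow>
      (\<exists>m\<ge>k. (\<forall>n\<in>{k + 1..m}. chain b P L {1..n} x) \<and>
        ((closed_chain b P L 1 (m + 1) x \<and>
          describes_boundary_component b P L C (x ` {1..m + 1}))
        \<or>
         (chain b P L {1..m + 1} x \<and>
          (\<exists>\<psi> i. automorphism b P L \<psi> \<and> orientation_preserving \<psi> \<and> 1 \<le> i \<and> i < m \<and>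
            (\<exists>a s p a' s' p'.
               corner_basis b P L \<omega> C (corner b P (x i) (x (i + 1))) a s p \<and>
               corner_basis b P L \<omega> C (corner b P (x m) (x (m + 1))) a' s' p' \<and>
               \<psi> a = a' \<and> \<psi> s = s' \<and> \<psi> p = p') \<and>
            describes_boundary_component b P L C (power_orbit \<psi> (x ` {1..m + 1})))))))"
proof -
  obtain e where "arith_lattice b P L e" using admissible_arith_lattice[OF L_lattice(1) cone] by blast
  then interpret arith_lattice b P L e .
  have W: "wall C (r i)" if "i \<in> {1..k + 1}" for i
    using chamber(2)[OF that] bounds_iff_wall[OF chamber(1)] by simp
  have "\<exists>x. next_root_extension b P L (k + 1) r x"
    by (rule next_root_extension_exists) (use next_previous k in auto)
  then show ?thesis using extension_describes[OF chamber(1) k orientation chain W] by blast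
qed

end
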